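(* Let $X$ and $Y$ be reflexive Banach spaces, let $r\in(1,\infty]$, and let $T$ be a singular integral operator of Volterra type, bounded from $L^r(\mathbb{R}_+;X)$ to $L^r(\mathbb{R}_+;Y)$ with $\|T\|_{L^r(\mathbb{R}_+;X)\to L^r(\mathbb{R}_+;Y)}=B$, whose kernel $K$ satisfies the standard kernel estimates of Volterra type with constants $M$ and $\sigma\in(0,1]$. Then $T$ is of weak type $(1,1)$ and of strong type $(p,p)$ for every $1<p<\infty$, with $$\|Tf\|_{L^{1,\infty}(\mathbb{R}_+;Y)}\le C(M+B)\,\|f\|_{L^1(\mathbb{R}_+;X)},$$ $$\|Tf\|_{L^p(\mathbb{R}_+;Y)}\le C_p(M+B)\,\|f\|_{L^p(\mathbb{R}_+;X)},\qquad 1<p<\infty,$$ where $C$ depends only on $\sigma$, and $C_p$ depends only on $p$ and $\sigma$.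
   Context: $\mathbb{R}_+=(0,\infty)$ with Lebesgue measure $|\cdot|$. For a Banach space $Z$, $L^p(\mathbb{R}_+;Z)$ is the Bochner space of $Z$-valued functions on $\mathbb{R}_+$, and $\|g\|_{L^{1,\infty}(\mathbb{R}_+;Z)}=\sup_{\lambda>0}\lambda\,|\{t\in\mathbb{R}_+:\|g(t)\|_Z>\lambda\}|$. $\mathcal{L}(X,Y)$ is the space of bounded linear operators from $X$ to $Y$ with the operator norm. Standard singular kernel of Volterra type: a function $K$ assigning to each pair $0<s<t<\infty$ an operator $K(t,s)\in\mathcal{L}(X,Y)$ such that, for some constants $M$ and $\sigma\in(0,1]$, the following standard kernel estimates of Volterra type hold: (i) $\|K(t,s)\|_{\mathcal{L}(X,Y)}\le \dfrac{M}{t-s}$ for all $0<s<t<\infty$; (ii) $\|K(t,s)-K(t,s_0)\|_{\mathcal{L}(X,Y)}\le \dfrac{M|s-s_0|^\sigma}{(t-s_0)^{1+\sigma}}$ for all $s,s_0,t>0$ with $t>s_0$ and $t-s_0\ge 2|s-s_0|$; (iii) $\|K(t,s)-K(t_0,s)\|_{\mathcal{L}(X,Y)}\le \dfrac{M|t-t_0|^\sigma}{(t_0-s)^{1+\sigma}}$ for all $s,t,t_0>0$ with $t_0>s$ and $t_0-s\ge 2|t-t_0|$. Singular integral operator of Volterra type: a bounded linear operator $T:L^r(\mathbb{R}_+;X)\to L^r(\mathbb{R}_+;Y)$, for some $r\in(1,\infty]$, for which there is a kernel $K$ satisfying (i)--(iii) such that, whenever $f\in L^r(\mathbb{R}_+;X)$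 has compact support, $$Tf(t)=\int_0^t K(t,s)f(s)\,ds\qquad\text{for almost every } t\in\mathbb{R}_+ \text{ not in the support of } f .$$ Meaning of weak type $(1,1)$ and strong type $(p,p)$: the stated inequalities hold for all smooth compactly supported $f:\mathbb{R}_+\to X$ (on which $T$ is defined). By density, $T$ restricted to such functions then extends uniquely to a bounded linear operator $L^1(\mathbb{R}_+;X)\to L^{1,\infty}(\mathbb{R}_+;Y)$, respectively $L^p(\mathbb{R}_+;X)\to L^p(\mathbb{R}_+;Y)$, still denoted $T$ and satisfying the same inequality for all $f$ in the space. When $r<\infty$, this extension agrees with the original $T$ on $L^r\cap L^1$, respectively $L^r\cap L^p$. *)

theory Defs
  imports "HOL-Analysis.Analysis" "HOL-Probability.Essential_Supremum"
begin

definition reflexive_space :: "'a::banach itself \<Rightarrow> bool" where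
  "reflexive_space _ \<longleftrightarrow>
     (\<forall>\<phi> :: ('a \<Rightarrow>\<^sub>L real) \<Rightarrow>\<^sub>L real. \<exists>x. \<forall>u. blinfun_apply \<phi> u = blinfun_apply u x)"

abbreviation halfline :: "real measure" where
  "halfline \<equiv> lebesgue_on {0<..}"

text \<open>
  The Banach spaces below need not be separable, whereas the library's Bochner integral
  \<^const>\<open>has_bochner_integral\<close> is restricted to second countable types. The next two definitions
  are Bochner's notions of a strongly measurable function and of the integral for arbitrary
  normed spaces, on top of the library's simple functions.
\<close>

definition strongly_measurable :: "'a measure \<Rightarrow> ('a \<Rightarrow> 'b::real_normed_vector) \<Rightarrow> bool" where
  "strongly_measurable M f \<longleftrightarrow>
     (\<exists>s. (\<forall>i::nat. simple_function M (s i)) \<and> (AE x in M. (\<lambda>i. s i x) \<longlonglongrightarrow> f x))"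

definition has_strong_integral ::
    "'a measure \<Rightarrow> ('a \<Rightarrow> 'b::real_normed_vector) \<Rightarrow> 'b \<Rightarrow> bool" where
  "has_strong_integral M f x \<longleftrightarrow> strongly_measurable M f \<and>
     (\<exists>s. (\<forall>i::nat. Bochner_Integration.simple_bochner_integrable M (s i)) \<and>
          (\<lambda>i. \<integral>\<^sup>+ y. ennreal (norm (f y - s i y)) \<partial>M) \<longlonglongrightarrow> 0 \<and>
          (\<lambda>i. Bochner_Integration.simple_bochner_integral M (s i)) \<longlonglongrightarrow> x)"

text \<open>
  Elements of the Lebesgue--Bochner spaces on the half-line are represented by functions on the
  whole real line whose values at nonpositive arguments are irrelevant; identification almost
  everywhere is left implicit. The exponent \<open>p\<close> ranges over \<open>1 \<le> p \<le> \<infinity>\<close>.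
\<close>

definition Lp_norm :: "ennreal \<Rightarrow> (real \<Rightarrow> 'b::real_normed_vector) \<Rightarrow> ennreal" where
  "Lp_norm p f =
     (if p = \<infinity> then esssup halfline (\<lambda>t. ennreal (norm (f t)))
      else let I = (\<integral>\<^sup>+ t. ennreal (norm (f t) powr enn2real p) \<partial>halfline)
           in if I = \<infinity> then \<infinity> else ennreal (enn2real I powr (1 / enn2real p)))"

definition Lp_space :: "ennreal \<Rightarrow> (real \<Rightarrow> 'b::real_normed_vector) set" where
  "Lp_space p = {f. strongly_measurable halfline f \<and> Lp_norm p f < \<infinity>}"

definition weak_L1_norm :: "(real \<Rightarrow> 'b::real_normed_vector) \<Rightarrow> ennreal" where
  "weak_L1_norm g =
     (SUP c\<in>{0<..}. ennreal c * emeasure halfline {t \<in> {0<..}. norm (g t) > c})"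

definition Lp_linear_operator ::
    "ennreal \<Rightarrow> ((real \<Rightarrow> 'a::banach) \<Rightarrow> (real \<Rightarrow> 'b::banach)) \<Rightarrow> bool" where
  "Lp_linear_operator r T \<longleftrightarrow>
     (\<forall>f\<in>Lp_space r. T f \<in> Lp_space r) \<and>
     (\<forall>f\<in>Lp_space r. \<forall>g\<in>Lp_space r.
        (AE t in halfline. f t = g t) \<longrightarrow> (AE t in halfline. T f t = T g t)) \<and>
     (\<forall>f\<in>Lp_space r. \<forall>g\<in>Lp_space r. AE t in halfline. T (\<lambda>s. f s + g s) t = T f t + T g t) \<and>
     (\<forall>c. \<forall>f\<in>Lp_space r. AE t in halfline. T (\<lambda>s. c *\<^sub>R f s) t = c *\<^sub>R T f t)"

text \<open>The operator norm; it is finite exactly for bounded operators.\<close>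

definition Lp_opnorm ::
    "ennreal \<Rightarrow> ((real \<Rightarrow> 'a::banach) \<Rightarrow> (real \<Rightarrow> 'b::banach)) \<Rightarrow> ennreal" where
  "Lp_opnorm r T = (SUP f\<in>{f \<in> Lp_space r. Lp_norm r f \<le> 1}. Lp_norm r (T f))"

text \<open>Only the values \<open>K t s\<close> with \<open>0 < s < t\<close> are constrained.\<close>

definition volterra_kernel ::
    "real \<Rightarrow> real \<Rightarrow> (real \<Rightarrow> real \<Rightarrow> 'a::banach \<Rightarrow>\<^sub>L 'b::banach) \<Rightarrow> bool" where
  "volterra_kernel M \<sigma> K \<longleftrightarrow>
     (\<forall>t s. 0 < s \<and> s < t \<longrightarrow> norm (K t s) \<le> M / (t - s)) \<and>
     (\<forall>t s s0. 0 < s \<and> 0 < s0 \<and> 0 < t \<and> s0 < t \<and> 2 * \<bar>s - s0\<bar> \<le> t - s0 \<longrightarrow>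
        norm (K t s - K t s0) \<le> M * \<bar>s - s0\<bar> powr \<sigma> / (t - s0) powr (1 + \<sigma>)) \<and>
     (\<forall>s t t0. 0 < s \<and> 0 < t \<and> 0 < t0 \<and> s < t0 \<and> 2 * \<bar>t - t0\<bar> \<le> t0 - s \<longrightarrow>
        norm (K t s - K t0 s) \<le> M * \<bar>t - t0\<bar> powr \<sigma> / (t0 - s) powr (1 + \<sigma>))"

text \<open>
  The support of an almost-everywhere class: the complement in the half-line of the largest open
  set on which \<open>f\<close> vanishes almost everywhere. It is relatively closed in the open half-line, so
  its compactness says that it is bounded and bounded away from \<open>0\<close>.
\<close>

definition ess_support :: "(real \<Rightarrow> 'b::real_normed_vector) \<Rightarrow> real set" where
  "ess_support f =
     {t \<in> {0<..}. \<forall>e>0. \<not> (AE s in halfline. \<bar>s - t\<bar> < e \<longrightarrow> f s = 0)}"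

definition has_volterra_kernel ::
    "ennreal \<Rightarrow> ((real \<Rightarrow> 'a::banach) \<Rightarrow> (real \<Rightarrow> 'b::banach))
       \<Rightarrow> (real \<Rightarrow> real \<Rightarrow> 'a \<Rightarrow>\<^sub>L 'b) \<Rightarrow> bool" where
  "has_volterra_kernel r T K \<longleftrightarrow>
     (\<forall>f\<in>Lp_space r. compact (ess_support f) \<longrightarrow>
        (AE t in halfline. t \<notin> ess_support f \<longrightarrow>
           has_strong_integral (lebesgue_on {0<..<t}) (\<lambda>s. blinfun_apply (K t s) (f s)) (T f t)))"

definition test_functions :: "(real \<Rightarrow> 'a::real_normed_vector) set" where
  "test_functions =
     {f. (\<exists>D :: nat \<Rightarrow> real \<Rightarrow> 'a. (\<forall>t>0. D 0 t = f t) \<and>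
            (\<forall>n. \<forall>t>0. (D n has_vector_derivative D (Suc n) t) (at t))) \<and>
         (\<exists>S. compact S \<and> S \<subseteq> {0<..} \<and> (\<forall>t>0. t \<notin> S \<longrightarrow> f t = 0))}"

text \<open>
  The constants of the theorem depend on \<open>\<sigma>\<close>, respectively \<open>p\<close> and \<open>\<sigma>\<close>, alone; in particular
  not on the Banach spaces. Since those are type variables, an existential quantifier inside a
  theorem would only yield constants that may depend on them, so the constants are given as
  (deliberately crude) closed expressions. Their precise values have no significance.
\<close>

definition weak_type_const :: "real \<Rightarrow> real" where
  "weak_type_const \<sigma> = 2 powr (1000 / \<sigma>)"

definition strong_type_const :: "real \<Rightarrow> real \<Rightarrow> real" where
  "strong_type_const p \<sigma> = 2 powr (1000 * (p + 1 / (p - 1) + 1 / \<sigma>))"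

end

theory Submission
  imports Defs
begin

text \<open>
  The proof is Calderon-Zygmund theory for kernels living on \<open>s < t\<close>. A function \<open>f\<close> that vanishes
  to the left of some \<open>a > 0\<close> is studied on the dyadic intervals (cells) based at \<open>a\<close>. They stay
  away from the origin, and any two of them have a common ancestor. For a good class of functions,
  the uniform limits of dyadic step functions, two properties of \<open>T\<close> carry everything; every test
  function agrees on the half-line with a member of this class, for a suitable \<open>a\<close>.

  \<^item> A bounded \<open>g\<close> with \<open>|g| \<le> h\<close> and \<open>B h \<le> \<lambda>\<close> satisfies \<open>|{|T g| > \<lambda>}| \<le> \<parallel>g\<parallel>\<^sub>1 / h\<close> (lemma
    \<open>T_super_level\<close>). The exponent \<open>r\<close> does not occur in this inequality, and it is the only use
    made of the norm of \<open>T\<close>; hence all later constants are independent of \<open>r\<close>, and \<open>r = \<infinity>\<close> is not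
    a special case.

  \<^item> \<open>T f\<close> vanishes to the left of the support of \<open>f\<close> (lemma \<open>T_causal\<close>).

  Weak type. For a step function \<open>f\<close> the maximal cells on which the mean of \<open>|f|\<close> exceeds \<open>\<alpha>\<close> are
  finite in number. Subtracting from \<open>f\<close> its mean on each of them leaves \<open>g\<close> with \<open>|g| \<le> 2 \<alpha>\<close>, to
  which the first property applies. The remainder is a finite sum of atoms: functions \<open>b\<close> of
  integral zero, each living on a cell \<open>Q\<close>. By causality \<open>T b\<close> vanishes to the left of \<open>Q\<close>, and to
  the right of its double the regularity of the kernel in \<open>s\<close> bounds the integral of \<open>|T b|\<close>
  (lemma \<open>T_atom\<close>). Choosing \<open>\<alpha>\<close> proportional to \<open>\<lambda> / (M + B)\<close> gives \<open>weak_type_step\<close>, and the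
  first property passes it on to uniform limits (\<open>weak_type\<close>).

  Strong type. All \<open>1 < p < \<infinity>\<close> are treated at once by comparing \<open>T f\<close> with a maximal function
  of \<open>f\<close>, the supremum over the cells containing \<open>t\<close> of the mean of \<open>|f|\<close> over the cell and its
  two left neighbours. Let \<open>m\<close> bound these means for all ancestors of a cell \<open>J\<close>. Then \<open>|T f|\<close>
  differs on \<open>J\<close> from a constant by at most \<open>C (M + B) m / \<epsilon>\<close>, with \<open>C\<close> depending only on \<open>\<sigma>\<close>,
  except on a set of measure at most \<open>\<epsilon> |J|\<close> (lemma \<open>T_oscillation\<close>): the part of \<open>f\<close> to the right of \<open>J\<close> does not
  contribute, the part near \<open>J\<close> is controlled by the weak type inequality, and the contribution of
  the part far to the left is almost constant by the regularity of the kernel in \<open>t\<close>. Applied to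
  the parents of the maximal cells in which \<open>{|T f| > \<lambda>}\<close> has density more than \<open>1/4\<close>, this yields the
  inequality (lemma \<open>good_lambda\<close>)
  \<open>|{|T f| > 2 \<lambda>}| \<le> 8 \<epsilon> |{|T f| > \<lambda>}| + |{maximal function > c \<epsilon> \<lambda> / (M + B)}|\<close>, where \<open>c\<close>
  depends only on \<open>\<sigma>\<close>.
  Multiplying by \<open>\<lambda>\<^sup>p\<close> and summing over \<open>\<lambda> = 2\<^sup>n, 2\<^sup>n\<^sup>-\<^sup>1, \<dots>\<close> one absorbs the first term when
  \<open>8 \<epsilon> 2\<^sup>p = 1/2\<close>; the sum being absorbed is finite because of the weak type inequality and
  \<open>p > 1\<close>. The second term is the \<open>L\<^sup>p\<close> estimate for the maximal function.
\<close>

section \<open>Dyadic cells on a half-line\<close>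

text \<open>
  A cell is a pair \<open>(k, m)\<close>, standing for the \<open>m\<close>-th interval of length \<open>2\<^sup>k\<close> to the right of the
  base point \<open>a\<close>; so the combinatorics of cells does not involve \<open>a\<close>.
\<close>

definition side :: "int \<times> nat \<Rightarrow> real" where
  "side J = 2 powi fst J"

definition left :: "real \<Rightarrow> int \<times> nat \<Rightarrow> real" where
  "left a J = a + real (snd J) * side J"

definition cell :: "real \<Rightarrow> int \<times> nat \<Rightarrow> real set" where
  "cell a J = {left a J ..< left a J + side J}"

definition ancestor :: "nat \<Rightarrow> int \<times> nat \<Rightarrow> int \<times> nat" where
  "ancestor j J = (fst J + int j, snd J div 2 ^ j)"

definition cell_at :: "real \<Rightarrow> int \<Rightarrow> real \<Rightarrow> int \<times> nat" where
  "cell_at a k t = (k, nat \<lfloor>(t - a) / 2 powi k\<rfloor>)"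

definition maximal_cells :: "(int \<times> nat) set \<Rightarrow> (int \<times> nat) set" where
  "maximal_cells S = {J \<in> S. \<forall>j\<ge>1. ancestor j J \<notin> S}"

lemma side_pos [simp]: "0 < side J"
  by (simp add: side_def)

lemma side_nonneg [simp]: "0 \<le> side J"
  by (simp add: less_imp_le)

lemma side_neq_0 [simp]: "side J \<noteq> 0"
  using side_pos[of J] by linarith

lemma left_ge: "a \<le> left a J"
  by (simp add: left_def)

lemma left_in_cell [simp]: "left a J \<in> cell a J"
  by (simp add: cell_def)

lemma cell_ge: "t \<in> cell a J \<Longrightarrow> a \<le> t"
  using left_ge[of a J] by (auto simp: cell_def)

lemma cell_sets [measurable, simp]: "cell a J \<in> sets borel" "cell a J \<in> sets lebesgue"
  by (auto simp: cell_def)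

lemma emeasure_cell [simp]: "emeasure lebesgue (cell a J) = ennreal (side J)"
  by (simp add: cell_def less_imp_le)

lemma side_ancestor: "side (ancestor j J) = 2 ^ j * side J"
  by (simp add: side_def ancestor_def power_int_add)

lemma ancestor_0 [simp]: "ancestor 0 J = J"
  by (simp add: ancestor_def)

lemma ancestor_ancestor: "ancestor i (ancestor j J) = ancestor (i + j) J"
  by (simp add: ancestor_def prod_eq_iff div_mult2_eq[symmetric] power_add[symmetric] add.commute)

lemma cell_at_mem: "a \<le> t \<Longrightarrow> t \<in> cell a (cell_at a k t)"
proof -
  assume "a \<le> t"
  define x where "x = (t - a) / 2 powi k"
  have x0: "0 \<le> x" using \<open>a \<le> t\<close> by (simp add: x_def)
  have t: "t = a + x * 2 powi k" by (simp add: x_def)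
  have "real (nat \<lfloor>x\<rfloor>) \<le> x" "x < real (nat \<lfloor>x\<rfloor>) + 1"
    using x0 by linarith+
  then have "real (nat \<lfloor>x\<rfloor>) * 2 powi k \<le> x * 2 powi k"
      "x * 2 powi k < (real (nat \<lfloor>x\<rfloor>) + 1) * 2 powi k"
    by (auto intro!: mult_right_mono mult_strict_right_mono)
  then show ?thesis
    by (simp add: cell_def left_def side_def cell_at_def x_def[symmetric] t algebra_simps)
qed

lemma fst_cell_at [simp]: "fst (cell_at a k t) = k"
  by (simp add: cell_at_def)

lemma cell_at_eqI:
  assumes "t \<in> cell a J" shows "cell_at a (fst J) t = J"
proof -
  have "real (snd J) \<le> (t - a) / 2 powi fst J" "(t - a) / 2 powi fst J < real (snd J) + 1"
    using assms by (auto simp: cell_def left_def side_def field_simps)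
  then have "\<lfloor>(t - a) / 2 powi fst J\<rfloor> = int (snd J)"
    by (simp add: floor_eq_iff)
  then show ?thesis by (simp add: cell_at_def prod_eq_iff)
qed

lemma cell_subset_ancestor: "cell a J \<subseteq> cell a (ancestor j J)"
proof -
  have "real (snd J div 2 ^ j) * (2 ^ j * side J) \<le> real (snd J) * side J"
  proof -
    have "snd J div 2 ^ j * 2 ^ j \<le> snd J" by (simp add: div_times_less_eq_dividend)
    then have "real (snd J div 2 ^ j * 2 ^ j) \<le> real (snd J)"
      by (simp only: of_nat_le_iff)
    then have "real (snd J div 2 ^ j * 2 ^ j) * side J \<le> real (snd J) * side J"
      by (rule mult_right_mono) simp
    then show ?thesis by (simp add: mult.assoc)
  qed
  moreover have "(real (snd J) + 1) * side J \<le> (real (snd J div 2 ^ j) + 1) * (2 ^ j * side J)"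
  proof -
    have "snd J < snd J div 2 ^ j * 2 ^ j + 2 ^ j"
      using dividend_less_div_times[of "2 ^ j" "snd J"] by (simp add: add.commute)
    then have "snd J + 1 \<le> (snd J div 2 ^ j + 1) * 2 ^ j" by simp
    then have "real (snd J + 1) \<le> real ((snd J div 2 ^ j + 1) * 2 ^ j)"
      by (simp only: of_nat_le_iff)
    moreover have "real ((snd J div 2 ^ j + 1) * 2 ^ j) = (real (snd J div 2 ^ j) + 1) * 2 ^ j"
      by (simp add: algebra_simps)
    ultimately have "(real (snd J) + 1) * side J \<le> (real (snd J div 2 ^ j) + 1) * 2 ^ j * side J"
      by (intro mult_right_mono) auto
    then show ?thesis by (simp only: mult.assoc)
  qed
  ultimately show ?thesis
    using side_ancestor[of j J]
    by (auto simp: cell_def left_def ancestor_def algebra_simps)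
qed

lemma cells_nested:
  assumes "t \<in> cell a J" "t \<in> cell a J'" "fst J \<le> fst J'"
  shows "J' = ancestor (nat (fst J' - fst J)) J"
proof -
  let ?A = "ancestor (nat (fst J' - fst J)) J"
  have "t \<in> cell a ?A" using assms(1) cell_subset_ancestor by blast
  then have "cell_at a (fst J') t = ?A"
    using cell_at_eqI[of t a ?A] assms(3) by (simp add: ancestor_def)
  then show ?thesis using cell_at_eqI[OF assms(2)] by simp
qed

lemma cell_mem_cong:
  assumes "s \<in> cell a J'" "t \<in> cell a J'" "fst J' \<le> fst J" "s \<in> cell a J"
  shows "t \<in> cell a J"
proof -
  have "J = ancestor (nat (fst J - fst J')) J'" by (rule cells_nested[OF assms(1,4,3)])
  then show ?thesis using cell_subset_ancestor[of a J'] assms(2) by (metis subsetD)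
qed

text \<open>
  The dyadic intervals of the whole line split into two quadrants with no common ancestor; on a
  half-line the ancestors of a single cell already exhaust everything.
\<close>

lemma ancestor_mem_all: 
  assumes "a \<le> t" shows "\<exists>j. t \<in> cell a (ancestor j J)"
proof -
  obtain j where j: "(t - a) / side J + real (snd J) < 2 ^ j"
    using real_arch_pow[of 2] by auto
  have "0 \<le> (t - a) / side J" using assms by simp
  then have "real (snd J) < 2 ^ j" using j by linarith
  then have "snd J < 2 ^ j" by (metis of_nat_less_iff of_nat_numeral of_nat_power)
  then have "left a (ancestor j J) = a" by (simp add: left_def ancestor_def)
  moreover have "t - a < 2 ^ j * side J"
  proof -
    have "(t - a) / side J < 2 ^ j" using j by linarith
    then show ?thesis by (simp add: pos_divide_less_eq)
  qed
  ultimately show ?thesis using assms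
    by (intro exI[of _ j]) (auto simp: cell_def side_ancestor)
qed

lemma maximal_cells_subset: "maximal_cells S \<subseteq> S"
  by (auto simp: maximal_cells_def)

lemma maximal_cells_parent: "J \<in> maximal_cells S \<Longrightarrow> ancestor 1 J \<notin> S"
  by (auto simp: maximal_cells_def)

lemma disjoint_maximal_cells: "disjoint_family_on (cell a) (maximal_cells S)"
proof (unfold disjoint_family_on_def disjoint_iff, intro ballI impI allI notI)
  fix J J' t assume J: "J \<in> maximal_cells S" "J' \<in> maximal_cells S" "J \<noteq> J'"
    and t: "t \<in> cell a J" "t \<in> cell a J'"
  have *: False if "J \<in> maximal_cells S" "J' \<in> maximal_cells S" "J \<noteq> J'" 
     "t \<in> cell a J" "t \<in> cell a J'" "fst J \<le> fst J'" for J J'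
  proof -
    have e: "J' = ancestor (nat (fst J' - fst J)) J" using cells_nested that by blast
    then have "nat (fst J' - fst J) \<noteq> 0" using that(3) by (metis ancestor_0)
    then show False using that(1,2) e maximal_cells_subset unfolding maximal_cells_def
      by (metis (mono_tags, lifting) less_one linorder_not_le mem_Collect_eq)
  qed
  show False using *[OF J t] *[OF J(2,1) J(3)[symmetric] t(2,1)] by (meson linear)
qed

lemma maximal_cell_exists:
  assumes J: "J \<in> S" and bounded: "\<And>J. J \<in> S \<Longrightarrow> side J \<le> b"
  obtains j where "ancestor j J \<in> maximal_cells S"
proof -
  obtain n where n: "b / side J < 2 ^ n" using real_arch_pow[of 2] by auto
  have bd: "j \<le> n" if "ancestor j J \<in> S" for j
  proof (rule ccontr)
    assume "\<not> j \<le> n"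
    then have "(2::real) ^ n \<le> 2 ^ j" by (intro power_increasing) auto
    moreover have "2 ^ j * side J \<le> b" using bounded[OF that] by (simp add: side_ancestor)
    moreover have "b < 2 ^ n * side J" using n by (simp add: pos_divide_less_eq)
    moreover have "2 ^ n * side J \<le> 2 ^ j * side J" using calculation(1) by (intro mult_right_mono) auto
    ultimately show False by linarith
  qed
  define j where "j = Max {j. ancestor j J \<in> S}"
  have fin: "finite {j. ancestor j J \<in> S}" 
    by (rule finite_subset[of _ "{..n}"]) (use bd in auto)
  have "0 \<in> {j. ancestor j J \<in> S}" using J by simp
  then have "{j. ancestor j J \<in> S} \<noteq> {}" by blast
  then have "j \<in> {j. ancestor j J \<in> S}" unfolding j_def using fin Max_in by blast
  moreover have "ancestor i (ancestor j J) \<notin> S" if "i \<ge> 1" for i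
  proof
    assume "ancestor i (ancestor j J) \<in> S"
    then have "i + j \<le> j" unfolding ancestor_ancestor j_def using fin by (intro Max_ge) auto
    then show False using that by simp
  qed
  ultimately show thesis using that by (auto simp: maximal_cells_def)
qed

lemma UN_maximal_cells:
  assumes "\<And>J. J \<in> S \<Longrightarrow> side J \<le> b"
  shows "(\<Union>J\<in>maximal_cells S. cell a J) = (\<Union>J\<in>S. cell a J)"
proof
  show "(\<Union>J\<in>S. cell a J) \<subseteq> (\<Union>J\<in>maximal_cells S. cell a J)"
  proof clarify
    fix k m t assume "(k, m) \<in> S" "t \<in> cell a (k, m)"
    then obtain j where "ancestor j (k, m) \<in> maximal_cells S"
      using maximal_cell_exists assms by metis
    then show "t \<in> (\<Union>J\<in>maximal_cells S. cell a J)"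
      using \<open>t \<in> cell a (k, m)\<close> cell_subset_ancestor by blast
  qed
qed (use maximal_cells_subset in blast)

text \<open>
  Maximal cells are disjoint. Besides Lebesgue measure, \<open>N\<close> will be the measure \<open>|f| dt\<close> in selections
  by the mean of \<open>|f|\<close>, and the restriction of Lebesgue measure to \<open>E\<close> in selections by the
  density of \<open>E\<close>.
\<close>

lemma nn_integral_maximal_cells:
  assumes "sets N = sets lebesgue"
  shows "(\<integral>\<^sup>+J. emeasure N (cell a J) \<partial>count_space (maximal_cells S))
     = emeasure N (\<Union>J\<in>maximal_cells S. cell a J)"
  by (intro emeasure_UN_countable[symmetric] disjoint_maximal_cells) (auto simp: assms)

lemma small_cell_subset_open:
  assumes "open U" "t \<in> U" "a \<le> t"
  obtains k where "k \<le> 0" "cell a (cell_at a k t) \<subseteq> U"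
proof -
  obtain e where e: "e > 0" "\<And>s. \<bar>s - t\<bar> < e \<Longrightarrow> s \<in> U"
    using assms by (force simp: open_dist dist_real_def)
  obtain n where n: "(1/2) ^ n < e" using real_arch_pow_inv[OF e(1), of "1/2"] by auto
  have s: "side (cell_at a (- int n) t) < e" using n
    by (simp add: side_def power_int_minus field_simps)
  have "cell a (cell_at a (- int n) t) \<subseteq> U"
  proof
    fix s assume "s \<in> cell a (cell_at a (- int n) t)"
    with cell_at_mem[OF assms(3), of "- int n"] s show "s \<in> U"
      by (intro e(2)) (auto simp: cell_def)
  qed
  then show thesis using that[of "- int n"] by simp
qed

section \<open>Strong measurability and the strong integral\<close>

text \<open>
  Lebesgue measure is complete, so the values of the limit on the exceptional null set cannot
  destroy measurability. The target space is not assumed separable.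
\<close>

lemma AE_limit_borel_measurable:
  fixes f :: "real \<Rightarrow> 'b::metric_space"
  assumes S: "S \<in> sets lebesgue"
    and u: "\<And>i. u i \<in> borel_measurable (lebesgue_on S)"
    and lim: "AE x in lebesgue_on S. (\<lambda>i. u i x) \<longlonglongrightarrow> f x"
  shows "f \<in> borel_measurable (lebesgue_on S)"
proof -
  let ?M = "lebesgue_on S"
  have complete: "A \<in> sets ?M" if "A \<subseteq> N" "N \<in> null_sets ?M" for A N
  proof -
    have "N \<in> null_sets lebesgue" "N \<subseteq> S" using that S by (auto simp: null_sets_restrict_space)
    then have "A \<in> null_sets lebesgue" "A \<subseteq> S" using completion.complete2[OF that(1)] that(1) by auto
    then show ?thesis using S by (auto simp: sets_restrict_space_iff)
  qed
  obtain N where N: "N \<in> null_sets ?M" "\<And>x. x \<in> S - N \<Longrightarrow> (\<lambda>i. u i x) \<longlonglongrightarrow> f x"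
  proof -
    obtain N where N: "{x \<in> space ?M. \<not> (\<lambda>i. u i x) \<longlonglongrightarrow> f x} \<subseteq> N"
        "emeasure ?M N = 0" "N \<in> sets ?M"
      using lim by (rule AE_E)
    show thesis
    proof (rule that)
      show "N \<in> null_sets ?M" using N(2,3) by (rule null_setsI)
      show "(\<lambda>i. u i x) \<longlonglongrightarrow> f x" if "x \<in> S - N" for x
        using N(1) that by auto
    qed
  qed
  have f': "(\<lambda>x. if x \<in> N then undefined else f x) \<in> borel_measurable ?M"
  proof (rule borel_measurable_LIMSEQ_metric)
    show "(\<lambda>x. if x \<in> N then undefined else u i x) \<in> borel_measurable ?M" for i
    proof (rule measurable_If_set[OF measurable_const u])
      show "N \<inter> space ?M \<in> sets ?M" using null_setsD2[OF N(1)] by (simp only: sets.Int_space_eq2)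
    qed simp
    show "(\<lambda>i. if x \<in> N then undefined else u i x) \<longlonglongrightarrow> (if x \<in> N then undefined else f x)"
      if "x \<in> space ?M" for x
    proof (cases "x \<in> N")
      case False then show ?thesis using that N(2)[of x] by simp
    qed simp
  qed
  show ?thesis
  proof (rule measurableI)
    fix A :: "'b set" assume A: "A \<in> sets borel"
    let ?g = "\<lambda>x. if x \<in> N then undefined else f x"
    have split: "f -` A \<inter> space ?M = (?g -` A \<inter> space ?M - N) \<union> (f -` A \<inter> space ?M \<inter> N)" by auto
    have "?g -` A \<inter> space ?M \<in> sets ?M" by (rule measurable_sets[OF f' A])
    moreover have "f -` A \<inter> space ?M \<inter> N \<in> sets ?M" by (rule complete[OF _ N(1)]) simp
    moreover have "N \<in> sets ?M" using N(1) by (rule null_setsD2)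
    ultimately show "f -` A \<inter> space ?M \<in> sets ?M"
      by (subst split) (intro sets.Un sets.Diff)
  qed simp
qed

lemma strongly_measurable_norm:
  fixes f :: "real \<Rightarrow> 'b::real_normed_vector"
  assumes "S \<in> sets lebesgue" "strongly_measurable (lebesgue_on S) f"
  shows "(\<lambda>x. norm (f x)) \<in> borel_measurable (lebesgue_on S)"
proof -
  obtain s where s: "\<And>i::nat. simple_function (lebesgue_on S) (s i)"
      "AE x in lebesgue_on S. (\<lambda>i. s i x) \<longlonglongrightarrow> f x"
    using assms(2) by (auto simp: strongly_measurable_def)
  show ?thesis
  proof (rule AE_limit_borel_measurable[OF assms(1)])
    show "(\<lambda>x. norm (s i x)) \<in> borel_measurable (lebesgue_on S)" for i
      by (intro borel_measurable_simple_function simple_function_compose1[OF s(1)])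
    show "AE x in lebesgue_on S. (\<lambda>i. norm (s i x)) \<longlonglongrightarrow> norm (f x)"
      using s(2) by eventually_elim (rule tendsto_norm)
  qed
qed

lemma strongly_measurable_diff:
  assumes "strongly_measurable M f" "strongly_measurable M g"
  shows "strongly_measurable M (\<lambda>x. f x - g x)"
proof -
  obtain s u where s: "\<And>i::nat. simple_function M (s i)" "AE x in M. (\<lambda>i. s i x) \<longlonglongrightarrow> f x"
    and u: "\<And>i::nat. simple_function M (u i)" "AE x in M. (\<lambda>i. u i x) \<longlonglongrightarrow> g x"
    using assms by (auto simp: strongly_measurable_def)
  have "AE x in M. (\<lambda>i. s i x - u i x) \<longlonglongrightarrow> f x - g x"
    using s(2) u(2) by eventually_elim (rule tendsto_diff)
  moreover have "simple_function M (\<lambda>x. s i x - u i x)" for i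
    by (intro simple_function_compose2[OF s(1) u(1)])
  ultimately show ?thesis unfolding strongly_measurable_def by (intro exI[of _ "\<lambda>i x. s i x - u i x"]) auto
qed

lemma strongly_measurable_simple: "simple_function M f \<Longrightarrow> strongly_measurable M f"
  unfolding strongly_measurable_def by (intro exI[of _ "\<lambda>_. f"]) auto

lemma simple_bochner_integrable_simple: "Bochner_Integration.simple_bochner_integrable M f \<Longrightarrow> simple_function M f"
  by (auto elim: simple_bochner_integrable.cases)

lemma simple_bochner_integral_norm_le:
  assumes h: "Bochner_Integration.simple_bochner_integrable M h"
  shows "ennreal (norm (Bochner_Integration.simple_bochner_integral M h)) \<le> (\<integral>\<^sup>+ t. ennreal (norm (h t)) \<partial>M)"
proof -
  have "ennreal (norm (Bochner_Integration.simple_bochner_integral M h))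
         \<le> ennreal (Bochner_Integration.simple_bochner_integral M (\<lambda>t. norm (h t)))"
    by (intro ennreal_leI simple_bochner_integral_norm_bound h)
  also have "\<dots> = (\<integral>\<^sup>+ t. ennreal (norm (h t)) \<partial>M)"
    by (intro simple_bochner_integral_eq_nn_integral simple_bochner_integrable_compose2[of "\<lambda>x y. norm x", OF _ h h]) auto
  finally show ?thesis .
qed

lemma has_strong_integral_simple:
  assumes "Bochner_Integration.simple_bochner_integrable M f"
  shows "has_strong_integral M f (Bochner_Integration.simple_bochner_integral M f)"
  unfolding has_strong_integral_def
proof (intro conjI exI[of _ "\<lambda>_. f"] allI)
  show "strongly_measurable M f"
    by (intro strongly_measurable_simple simple_bochner_integrable_simple assms)
qed (use assms in simp_all)

lemma has_strong_integral_diff: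
  fixes f g :: "real \<Rightarrow> 'b::real_normed_vector"
  assumes S: "S \<in> sets lebesgue"
    and f: "has_strong_integral (lebesgue_on S) f x" and g: "has_strong_integral (lebesgue_on S) g y"
  shows "has_strong_integral (lebesgue_on S) (\<lambda>t. f t - g t) (x - y)"
proof -
  let ?M = "lebesgue_on S"
  obtain s u where s: "\<And>i::nat. Bochner_Integration.simple_bochner_integrable ?M (s i)"
        "(\<lambda>i. \<integral>\<^sup>+ t. ennreal (norm (f t - s i t)) \<partial>?M) \<longlonglongrightarrow> 0"
        "(\<lambda>i. Bochner_Integration.simple_bochner_integral ?M (s i)) \<longlonglongrightarrow> x"
    and u: "\<And>i::nat. Bochner_Integration.simple_bochner_integrable ?M (u i)"
        "(\<lambda>i. \<integral>\<^sup>+ t. ennreal (norm (g t - u i t)) \<partial>?M) \<longlonglongrightarrow> 0"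
        "(\<lambda>i. Bochner_Integration.simple_bochner_integral ?M (u i)) \<longlonglongrightarrow> y"
    using f g by (auto simp: has_strong_integral_def)
  have sm: "strongly_measurable ?M f" "strongly_measurable ?M g"
    using f g by (auto simp: has_strong_integral_def)
  have meas: "(\<lambda>t. norm (f t - s i t)) \<in> borel_measurable ?M"
    "(\<lambda>t. norm (g t - u i t)) \<in> borel_measurable ?M" for i
    by (intro strongly_measurable_norm[OF S] strongly_measurable_diff sm
        strongly_measurable_simple simple_bochner_integrable_simple s(1) u(1))+
  show ?thesis unfolding has_strong_integral_def
  proof (intro conjI exI[of _ "\<lambda>i t. s i t - u i t"] allI)
    show "strongly_measurable ?M (\<lambda>t. f t - g t)" using sm by (rule strongly_measurable_diff)
    show "Bochner_Integration.simple_bochner_integrable ?M (\<lambda>t. s i t - u i t)" for i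
      by (rule simple_bochner_integrable_compose2[where p = "\<lambda>x y. x - y", OF _ s(1) u(1)]) simp
    show "(\<lambda>i. Bochner_Integration.simple_bochner_integral ?M (\<lambda>t. s i t - u i t)) \<longlonglongrightarrow> x - y"
      using s(3) u(3) by (simp add: simple_bochner_integral_diff[OF s(1) u(1)] tendsto_diff)
    show "(\<lambda>i. \<integral>\<^sup>+ t. ennreal (norm (f t - g t - (s i t - u i t))) \<partial>?M) \<longlonglongrightarrow> 0"
    proof (rule tendsto_sandwich[OF _ _ tendsto_const])
      have "(\<lambda>i. (\<integral>\<^sup>+ t. ennreal (norm (f t - s i t)) \<partial>?M) + (\<integral>\<^sup>+ t. ennreal (norm (g t - u i t)) \<partial>?M))
          \<longlonglongrightarrow> 0 + 0" by (intro tendsto_add s u)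
      then show "(\<lambda>i. (\<integral>\<^sup>+ t. ennreal (norm (f t - s i t)) \<partial>?M) + (\<integral>\<^sup>+ t. ennreal (norm (g t - u i t)) \<partial>?M))
          \<longlonglongrightarrow> 0" by simp
      have "norm (f t - g t - (s i t - u i t)) \<le> norm (f t - s i t) + norm (g t - u i t)" for i t
        using norm_triangle_ineq4[of "f t - s i t" "g t - u i t"] by (simp add: algebra_simps)
      then have "(\<integral>\<^sup>+ t. ennreal (norm (f t - g t - (s i t - u i t))) \<partial>?M)
         \<le> (\<integral>\<^sup>+ t. ennreal (norm (f t - s i t)) + ennreal (norm (g t - u i t)) \<partial>?M)" for i
        by (intro nn_integral_mono) (simp add: ennreal_plus[symmetric] del: ennreal_plus)
      then show "\<forall>\<^sub>F i in sequentially. (\<integral>\<^sup>+ t. ennreal (norm (f t - g t - (s i t - u i t))) \<partial>?M)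
         \<le> (\<integral>\<^sup>+ t. ennreal (norm (f t - s i t)) \<partial>?M) + (\<integral>\<^sup>+ t. ennreal (norm (g t - u i t)) \<partial>?M)"
        using meas by (simp add: nn_integral_add)
    qed simp
  qed
qed

lemma has_strong_integral_norm_bound:
  fixes f :: "real \<Rightarrow> 'b::real_normed_vector"
  assumes S: "S \<in> sets lebesgue" and f: "has_strong_integral (lebesgue_on S) f x"
  shows "ennreal (norm x) \<le> (\<integral>\<^sup>+ t. ennreal (norm (f t)) \<partial>lebesgue_on S)"
proof -
  let ?M = "lebesgue_on S"
  obtain s where s: "\<And>i::nat. Bochner_Integration.simple_bochner_integrable ?M (s i)"
        "(\<lambda>i. \<integral>\<^sup>+ t. ennreal (norm (f t - s i t)) \<partial>?M) \<longlonglongrightarrow> 0"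
        "(\<lambda>i. Bochner_Integration.simple_bochner_integral ?M (s i)) \<longlonglongrightarrow> x"
    using f by (auto simp: has_strong_integral_def)
  have sm: "strongly_measurable ?M f" using f by (auto simp: has_strong_integral_def)
  have meas: "(\<lambda>t. norm (f t - s i t)) \<in> borel_measurable ?M" "(\<lambda>t. norm (f t)) \<in> borel_measurable ?M" for i
    by (intro strongly_measurable_norm[OF S] strongly_measurable_diff sm
        strongly_measurable_simple simple_bochner_integrable_simple s(1))+
  show ?thesis
  proof (rule LIMSEQ_le)
    show "(\<lambda>i. ennreal (norm (Bochner_Integration.simple_bochner_integral ?M (s i)))) \<longlonglongrightarrow> ennreal (norm x)"
      by (intro tendsto_ennrealI tendsto_norm s)
    have "(\<lambda>i. (\<integral>\<^sup>+ t. ennreal (norm (f t)) \<partial>?M) + (\<integral>\<^sup>+ t. ennreal (norm (f t - s i t)) \<partial>?M))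
        \<longlonglongrightarrow> (\<integral>\<^sup>+ t. ennreal (norm (f t)) \<partial>?M) + 0"
      by (intro tendsto_add s tendsto_const)
    then show "(\<lambda>i. (\<integral>\<^sup>+ t. ennreal (norm (f t)) \<partial>?M) + (\<integral>\<^sup>+ t. ennreal (norm (f t - s i t)) \<partial>?M))
        \<longlonglongrightarrow> (\<integral>\<^sup>+ t. ennreal (norm (f t)) \<partial>?M)" by simp
    have "ennreal (norm (Bochner_Integration.simple_bochner_integral ?M (s i)))
       \<le> (\<integral>\<^sup>+ t. ennreal (norm (f t)) \<partial>?M) + (\<integral>\<^sup>+ t. ennreal (norm (f t - s i t)) \<partial>?M)" for i
    proof -
      have "ennreal (norm (Bochner_Integration.simple_bochner_integral ?M (s i)))
         \<le> (\<integral>\<^sup>+ t. ennreal (norm (s i t)) \<partial>?M)"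
        by (rule simple_bochner_integral_norm_le[OF s(1)])
      also have "\<dots> \<le> (\<integral>\<^sup>+ t. ennreal (norm (f t)) + ennreal (norm (f t - s i t)) \<partial>?M)"
      proof (intro nn_integral_mono)
        fix t have "norm (s i t) \<le> norm (f t) + norm (f t - s i t)"
          by (metis norm_minus_commute norm_triangle_sub)
        then show "ennreal (norm (s i t)) \<le> ennreal (norm (f t)) + ennreal (norm (f t - s i t))"
          by (simp add: ennreal_plus[symmetric] del: ennreal_plus)
      qed
      finally show ?thesis using meas by (simp add: nn_integral_add)
    qed
    then show "\<exists>N. \<forall>n\<ge>N. ennreal (norm (Bochner_Integration.simple_bochner_integral ?M (s n)))
       \<le> (\<integral>\<^sup>+ t. ennreal (norm (f t)) \<partial>?M) + (\<integral>\<^sup>+ t. ennreal (norm (f t - s n t)) \<partial>?M)" by blast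
  qed
qed

section \<open>Dyadic step functions and their uniform limits\<close>

definition dyadic_step :: "real \<Rightarrow> int \<Rightarrow> real \<Rightarrow> (real \<Rightarrow> 'a::real_normed_vector) \<Rightarrow> bool" where
  "dyadic_step a k L g \<longleftrightarrow>
     (\<forall>m. \<forall>t\<in>cell a (k, m). g t = g (left a (k, m))) \<and> (\<forall>t. t < a \<or> L \<le> t \<longrightarrow> g t = 0)"

text \<open>
  The working class: uniform limits of dyadic steps with a common bounded support. It contains
  the smooth functions with compact support in \<open>(a, \<infinity>)\<close> and is stable under sums and under truncation at grid
  points; on an approximating step function every selection of cells by means is finite, because
  below the scale of the step the mean of \<open>|f|\<close> is its value.
\<close>

definition admissible :: "real \<Rightarrow> (real \<Rightarrow> 'a::real_normed_vector) \<Rightarrow> bool" where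
  "admissible a f \<longleftrightarrow> (\<exists>L. \<forall>e>0. \<exists>k g. dyadic_step a k L g \<and> (\<forall>t. norm (f t - g t) \<le> e))"

lemma dyadic_stepD:
  assumes "dyadic_step a k L g"
  shows "t \<in> cell a (k, m) \<Longrightarrow> g t = g (left a (k, m))" "t < a \<Longrightarrow> g t = 0" "L \<le> t \<Longrightarrow> g t = 0"
  using assms by (auto simp: dyadic_step_def)

lemma dyadic_step_const:
  assumes "dyadic_step a k L g" "s \<in> cell a (k, m)" "t \<in> cell a (k, m)"
  shows "g s = g t"
  using assms dyadic_stepD(1) by metis

lemma dyadic_step_mono:
  assumes g: "dyadic_step a k L g" and "k' \<le> k" "L \<le> L'"
  shows "dyadic_step a k' L' g"
  unfolding dyadic_step_def
proof (intro conjI allI ballI impI)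
  fix m t assume t: "t \<in> cell a (k', m)"
  have e: "fst (ancestor (nat (k - k')) (k', m)) = k" using assms(2) by (simp add: ancestor_def)
  obtain m' where m': "ancestor (nat (k - k')) (k', m) = (k, m')" using e by (metis prod.collapse)
  have "cell a (k', m) \<subseteq> cell a (k, m')" using cell_subset_ancestor m' by metis
  then show "g t = g (left a (k', m))"
    using dyadic_step_const[OF g] t left_in_cell by blast
qed (use assms in \<open>auto simp: dyadic_step_def\<close>)

lemma dyadic_step_compose2:
  assumes "dyadic_step a k L f" "dyadic_step a k L g" "p 0 0 = 0"
  shows "dyadic_step a k L (\<lambda>t. p (f t) (g t))"
  using assms by (auto simp: dyadic_step_def)

lemma dyadic_step_indicator:
  assumes "dyadic_step a k L f" and "\<And>m s t. s \<in> cell a (k, m) \<Longrightarrow> t \<in> cell a (k, m) \<Longrightarrow> s \<in> A \<Longrightarrow> t \<in> A"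
  shows "dyadic_step a k L (\<lambda>t. indicator A t *\<^sub>R f t)"
  unfolding dyadic_step_def
proof (intro conjI allI ballI impI)
  fix m t assume t: "t \<in> cell a (k, m)"
  have "indicator A t = (indicator A (left a (k, m)) :: real)"
    using assms(2)[OF t left_in_cell] assms(2)[OF left_in_cell t] by (auto simp: indicator_def)
  then show "indicator A t *\<^sub>R f t = indicator A (left a (k, m)) *\<^sub>R f (left a (k, m))"
    using dyadic_stepD(1)[OF assms(1) t] by simp
qed (use assms(1) in \<open>auto simp: dyadic_step_def\<close>)

lemma dyadic_step_range:
  assumes g: "dyadic_step a k L g"
  shows "finite (range g)"
proof -
  define N where "N = nat \<lceil>(L - a) / 2 powi k\<rceil>"
  have "range g \<subseteq> insert 0 ((\<lambda>m. g (left a (k, m))) ` {..N})"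
  proof clarify
    fix t assume n: "g t \<notin> (\<lambda>m. g (left a (k, m))) ` {..N}"
    show "g t = 0"
    proof (rule ccontr)
      assume "g t \<noteq> 0"
      then have t: "a \<le> t" "t < L" using dyadic_stepD(2,3)[OF g, of t] by (auto simp: not_less[symmetric])
      define m where "m = snd (cell_at a k t)"
      have tm: "t \<in> cell a (k, m)" using cell_at_mem[OF t(1)] by (simp add: m_def cell_at_def)
      have "real m \<le> (t - a) / 2 powi k" using tm by (auto simp: cell_def left_def side_def field_simps)
      also have "\<dots> \<le> (L - a) / 2 powi k" using t by (intro divide_right_mono) auto
      also have "\<dots> \<le> real N" by (simp add: N_def real_nat_ceiling_ge)
      finally have "m \<le> N" by simp
      then show False using n dyadic_stepD(1)[OF g tm] by auto
    qed
  qed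
  then show ?thesis by (rule finite_subset) auto
qed

lemma dyadic_step_vimage:
  assumes g: "dyadic_step a k L g"
  shows "g -` {y} \<in> sets borel"
proof -
  have "g -` {y} = (if y = 0 then {..<a} else {}) \<union> (\<Union>m\<in>{m. g (left a (k, m)) = y}. cell a (k, m))"
    (is "_ = ?R")
  proof (intro set_eqI iffI)
    fix t assume t: "t \<in> g -` {y}"
    show "t \<in> ?R"
    proof (cases "t < a")
      case True then show ?thesis using t dyadic_stepD(2)[OF g] by auto
    next
      case False
      define m where "m = snd (cell_at a k t)"
      have tm: "t \<in> cell a (k, m)" using cell_at_mem[of a t k] False by (simp add: m_def cell_at_def)
      then show ?thesis using t dyadic_stepD(1)[OF g tm] by auto
    qed
  next
    fix t assume "t \<in> ?R"
    then show "t \<in> g -` {y}" using dyadic_stepD(1,2)[OF g] by (auto split: if_splits)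
  qed
  also have "\<dots> \<in> sets borel" by (intro sets.Un sets.countable_UN') auto
  finally show ?thesis .
qed

lemma dyadic_step_simple: 
  assumes "dyadic_step a k L g" shows "simple_function lebesgue g"
  unfolding simple_function_def
proof (intro conjI ballI)
  show "finite (g ` space lebesgue)" using dyadic_step_range[OF assms] by simp
  show "g -` {x} \<inter> space lebesgue \<in> sets lebesgue" for x
    using dyadic_step_vimage[OF assms, of x] by (simp add: sets_completionI_sets)
qed

lemma dyadic_step_bounded: 
  assumes "dyadic_step a k L g" obtains c where "0 < c" "\<And>t. norm (g t) \<le> c"
proof -
  have "finite (range (\<lambda>t. norm (g t)))"
    using finite_imageI[OF dyadic_step_range[OF assms], of norm] by (simp add: image_image)
  then have "norm (g t) \<le> Max (range (\<lambda>t. norm (g t)))" for t by (intro Max_ge) auto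
  then have "norm (g t) \<le> \<bar>Max (range (\<lambda>t. norm (g t)))\<bar> + 1" for t
    using abs_ge_self[of "Max (range (\<lambda>t. norm (g t)))"] by (meson add_increasing2 order_trans zero_le_one)
  then show thesis by (rule that[rotated]) linarith
qed

lemma admissible_step: "dyadic_step a k L g \<Longrightarrow> admissible a g"
  unfolding admissible_def by (intro exI[of _ L] allI impI exI[of _ k] exI[of _ g]) auto

lemma admissible_support:
  assumes "admissible a f"
  obtains L where "\<And>t. t < a \<or> L \<le> t \<Longrightarrow> f t = 0" "a < L"
    "\<And>e. e > 0 \<Longrightarrow> \<exists>k g. dyadic_step a k L g \<and> (\<forall>t. norm (f t - g t) \<le> e)"
proof -
  obtain L0 where "\<And>e. e > 0 \<Longrightarrow> \<exists>k g. dyadic_step a k L0 g \<and> (\<forall>t. norm (f t - g t) \<le> e)"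
    using assms by (auto simp: admissible_def)
  then have L: "\<And>e. e > 0 \<Longrightarrow> \<exists>k g. dyadic_step a k (max L0 (a + 1)) g \<and> (\<forall>t. norm (f t - g t) \<le> e)"
    using dyadic_step_mono max.cobounded1 order_refl by metis
  have "f t = 0" if "t < a \<or> (max L0 (a + 1)) \<le> t" for t
  proof (rule ccontr)
    assume "f t \<noteq> 0"
    then have pos: "0 < norm (f t) / 2" by simp
    obtain k g where "dyadic_step a k (max L0 (a + 1)) g" "\<forall>s. norm (f s - g s) \<le> norm (f t) / 2"
      using L[OF pos] by blast
    then have "norm (f t) \<le> norm (f t) / 2"
      using that dyadic_stepD(2,3)[of a k "max L0 (a + 1)" g t] by (metis diff_zero)
    then show False using \<open>f t \<noteq> 0\<close> by simp
  qed
  then show thesis using that[of "max L0 (a + 1)"] L by auto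
qed

lemma admissible_eq_0:
  assumes "admissible a f" "t < a" shows "f t = 0"
  using admissible_support[OF assms(1)] assms(2) by metis

text \<open>
  Addition and subtraction share the same estimate, which is all that uniform approximation needs.
\<close>

lemma admissible_combine:
  assumes f: "admissible a f" and g: "admissible a g" and p0: "p 0 0 = 0"
    and lip: "\<And>x y u v. norm (p x y - p u v) \<le> norm (x - u) + norm (y - v)"
  shows "admissible a (\<lambda>t. p (f t) (g t))"
proof -
  obtain L where L: "\<And>e. e > 0 \<Longrightarrow> \<exists>k h. dyadic_step a k L h \<and> (\<forall>t. norm (f t - h t) \<le> e)"
    using admissible_support[OF f] by metis
  obtain L' where L': "\<And>e. e > 0 \<Longrightarrow> \<exists>k h. dyadic_step a k L' h \<and> (\<forall>t. norm (g t - h t) \<le> e)"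
    using admissible_support[OF g] by metis
  show ?thesis unfolding admissible_def
  proof (intro exI[of _ "max L L'"] allI impI)
    fix e :: real assume "e > 0"
    then obtain k h k' h' where h: "dyadic_step a k L h" "\<forall>t. norm (f t - h t) \<le> e / 2"
        "dyadic_step a k' L' h'" "\<forall>t. norm (g t - h' t) \<le> e / 2"
      using L[OF half_gt_zero] L'[OF half_gt_zero] by metis
    have "dyadic_step a (min k k') (max L L') (\<lambda>t. p (h t) (h' t))"
      by (rule dyadic_step_compose2[where p = p, OF dyadic_step_mono[OF h(1)] dyadic_step_mono[OF h(3)] p0]) auto
    moreover have "norm (p (f t) (g t) - p (h t) (h' t)) \<le> e" for t
      using lip[of "f t" "g t" "h t" "h' t"] h(2,4)[rule_format, of t] by linarith
    ultimately show "\<exists>k h. dyadic_step a k (max L L') h \<and> (\<forall>t. norm (p (f t) (g t) - h t) \<le> e)"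
      by blast
  qed
qed

lemma admissible_add: "admissible a f \<Longrightarrow> admissible a g \<Longrightarrow> admissible a (\<lambda>t. f t + g t)"
  by (rule admissible_combine[where p = "(+)"]) (auto simp: norm_diff_triangle_ineq)

lemma admissible_diff: "admissible a f \<Longrightarrow> admissible a g \<Longrightarrow> admissible a (\<lambda>t. f t - g t)"
proof (rule admissible_combine[where p = "(-)"])
  show "norm (x - y - (u - v)) \<le> norm (x - u) + norm (y - v)" for x y u v :: 'a
    using norm_triangle_ineq4[of "x - u" "y - v"] by (simp add: algebra_simps)
qed auto

lemma admissible_zero: "admissible a (\<lambda>t. 0)"
  by (rule admissible_step[of a 0 a]) (auto simp: dyadic_step_def)

lemma admissible_sum:
  "finite F \<Longrightarrow> (\<And>i. i \<in> F \<Longrightarrow> admissible a (f i)) \<Longrightarrow> admissible a (\<lambda>t. \<Sum>i\<in>F. f i t)"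
  by (induction F rule: finite_induct) (auto intro: admissible_zero admissible_add)

lemma admissible_indicator:
  assumes f: "admissible a f"
    and A: "\<And>m s t. s \<in> cell a (k, m) \<Longrightarrow> t \<in> cell a (k, m) \<Longrightarrow> s \<in> A \<Longrightarrow> t \<in> A"
  shows "admissible a (\<lambda>t. indicator A t *\<^sub>R f t)"
proof -
  obtain L where L: "\<And>e. e > 0 \<Longrightarrow> \<exists>k h. dyadic_step a k L h \<and> (\<forall>t. norm (f t - h t) \<le> e)"
    using admissible_support[OF f] by metis
  show ?thesis unfolding admissible_def
  proof (intro exI[of _ L] allI impI)
    fix e :: real assume e: "e > 0"
    then obtain k' h where h: "dyadic_step a k' L h" "\<forall>t. norm (f t - h t) \<le> e"
      using L by blast
    have sub: "\<exists>m'. cell a (min k k', m) \<subseteq> cell a (k, m')" for m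
    proof -
      have "fst (ancestor (nat (k - min k k')) (min k k', m)) = k" by (simp add: ancestor_def)
      then show ?thesis using cell_subset_ancestor by (metis prod.collapse)
    qed
    have "dyadic_step a (min k k') L (\<lambda>t. indicator A t *\<^sub>R h t)"
      using sub A by (intro dyadic_step_indicator dyadic_step_mono[OF h(1)]) (auto, blast)
    moreover have "norm (indicator A t *\<^sub>R f t - indicator A t *\<^sub>R h t) \<le> e" for t
      using h(2)[rule_format, of t] e by (auto simp: indicator_def)
    ultimately show "\<exists>k h. dyadic_step a k L h \<and> (\<forall>t. norm (indicator A t *\<^sub>R f t - h t) \<le> e)"
      by blast
  qed
qed

lemma admissible_scaleR: 
  assumes "admissible a f" shows "admissible a (\<lambda>t. c *\<^sub>R f t)"
proof -
  obtain L where L: "\<And>e. e > 0 \<Longrightarrow> \<exists>k h. dyadic_step a k L h \<and> (\<forall>t. norm (f t - h t) \<le> e)"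
    using admissible_support[OF assms] by metis
  show ?thesis unfolding admissible_def
  proof (intro exI[of _ L] allI impI)
    fix e :: real assume "e > 0"
    then have pos: "e / (\<bar>c\<bar> + 1) > 0" by simp
    obtain k h where h: "dyadic_step a k L h" "\<And>t. norm (f t - h t) \<le> e / (\<bar>c\<bar> + 1)"
      using L[OF pos] by blast
    have "dyadic_step a k L (\<lambda>t. c *\<^sub>R h t)"
      by (rule dyadic_step_compose2[where p = "\<lambda>x y. c *\<^sub>R x", OF h(1) h(1)]) simp
    moreover have "norm (c *\<^sub>R f t - c *\<^sub>R h t) \<le> e" for t
    proof -
      have "norm (c *\<^sub>R f t - c *\<^sub>R h t) = \<bar>c\<bar> * norm (f t - h t)"
        by (simp add: scaleR_diff_right[symmetric])
      also have "\<dots> \<le> \<bar>c\<bar> * (e / (\<bar>c\<bar> + 1))" by (intro mult_left_mono h) simp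
      also have "\<dots> \<le> e" using \<open>e > 0\<close> by (simp add: field_simps)
      finally show ?thesis .
    qed
    ultimately show "\<exists>k h. dyadic_step a k L h \<and> (\<forall>t. norm (c *\<^sub>R f t - h t) \<le> e)" by blast
  qed
qed

lemma admissible_bounded:
  assumes "admissible a f" obtains c where "0 < c" "\<And>t. norm (f t) \<le> c"
proof -
  obtain k h L where h: "dyadic_step a k L h" "\<And>t. norm (f t - h t) \<le> 1"
    using admissible_support[OF assms] zero_less_one by metis
  obtain c where c: "0 < c" "\<And>t. norm (h t) \<le> c" using dyadic_step_bounded[OF h(1)] by blast
  show thesis
  proof (rule that[of "c + 1"])
    fix t show "norm (f t) \<le> c + 1" using norm_triangle_sub[of "f t" "h t"] h(2)[of t] c(2)[of t] by linarith
  qed (use c(1) in simp)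
qed

lemma admissible_simple_approx:
  fixes f :: "real \<Rightarrow> 'a::real_normed_vector"
  assumes "admissible a f"
  obtains s where "\<And>i::nat. simple_function lebesgue (s i)" "\<And>i t. t < a \<Longrightarrow> s i t = 0" "\<And>t. (\<lambda>i. s i t) \<longlonglongrightarrow> f t"
proof -
  obtain L where L: "\<And>e. e > 0 \<Longrightarrow> \<exists>k h. dyadic_step a k L h \<and> (\<forall>t. norm (f t - h t) \<le> e)"
    using admissible_support[OF assms] by metis
  have "\<forall>i::nat. \<exists>h. \<exists>k. dyadic_step a k L h \<and> (\<forall>t. norm (f t - h t) \<le> 1 / Suc i)"
    using L by (metis of_nat_0_less_iff zero_less_Suc zero_less_divide_1_iff)
  then obtain s where s: "\<And>i. \<exists>k. dyadic_step a k L (s i)" "\<And>i t. norm (f t - s i t) \<le> 1 / Suc i"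
    by metis
  show thesis
  proof (rule that[of s])
    show "simple_function lebesgue (s i)" for i using s(1) dyadic_step_simple by blast
    show "s i t = 0" if "t < a" for i t using s(1)[of i] dyadic_stepD(2) that by blast
    show "(\<lambda>i. s i t) \<longlonglongrightarrow> f t" for t
    proof (rule metric_LIMSEQ_I)
      fix e :: real assume "0 < e"
      then obtain n where n: "1 / Suc n < e" using nat_approx_posE by blast
      have "dist (s i t) (f t) < e" if "i \<ge> n" for i
      proof -
        have "1 / real (Suc i) \<le> 1 / real (Suc n)" using that by (intro divide_left_mono) auto
        then show ?thesis using s(2)[of t i] n by (simp add: dist_norm norm_minus_commute)
      qed
      then show "\<exists>no. \<forall>n\<ge>no. dist (s n t) (f t) < e" by blast
    qed
  qed
qed

lemma admissible_norm_measurable: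
  assumes "admissible a f" shows "(\<lambda>t. norm (f t)) \<in> borel_measurable lebesgue"
proof -
  obtain s where s: "\<And>i::nat. simple_function lebesgue (s i)" "\<And>t. (\<lambda>i. s i t) \<longlonglongrightarrow> f t"
    using admissible_simple_approx[OF assms] by metis
  show ?thesis
  proof (rule borel_measurable_LIMSEQ_real)
    show "(\<lambda>t. norm (s i t)) \<in> borel_measurable lebesgue" for i
      by (intro borel_measurable_simple_function simple_function_compose1[OF s(1)])
    show "(\<lambda>i. norm (s i t)) \<longlonglongrightarrow> norm (f t)" for t by (intro tendsto_norm s)
  qed
qed

lemma admissible_ennreal_measurable:
  "admissible a f \<Longrightarrow> (\<lambda>t. ennreal (norm (f t))) \<in> borel_measurable lebesgue"
  by (rule measurable_compose[OF admissible_norm_measurable measurable_ennreal])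

lemma admissible_strongly_measurable:
  assumes "admissible a f" "0 < a" shows "strongly_measurable halfline f"
proof -
  obtain s where s: "\<And>i::nat. simple_function lebesgue (s i)" "\<And>i t. t < a \<Longrightarrow> s i t = 0" "\<And>t. (\<lambda>i. s i t) \<longlonglongrightarrow> f t"
    using admissible_simple_approx[OF assms(1)] by metis
  have "simple_function halfline (s i)" for i
  proof -
    have "(\<lambda>t. indicator {0<..} t *\<^sub>R s i t) = s i"
      using s(2) assms(2) by (auto simp: fun_eq_iff indicator_def)
    then show ?thesis by (simp add: simple_function_restrict_space s(1))
  qed
  then show ?thesis unfolding strongly_measurable_def using s(3) by blast
qed

lemma admissible_integral_finite:
  assumes "admissible a f" shows "(\<integral>\<^sup>+ t. ennreal (norm (f t)) \<partial>lebesgue) < \<infinity>"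
proof -
  obtain L where L: "\<And>t. t < a \<or> L \<le> t \<Longrightarrow> f t = 0" "a < L" using admissible_support[OF assms] by metis
  obtain c where c: "0 < c" "\<And>t. norm (f t) \<le> c" using admissible_bounded[OF assms] by metis
  have "(\<integral>\<^sup>+ t. ennreal (norm (f t)) \<partial>lebesgue) \<le> (\<integral>\<^sup>+ t. ennreal c * indicator {a..L} t \<partial>lebesgue)"
    using c L(1) by (intro nn_integral_mono) (auto simp: indicator_def intro: ennreal_leI)
  also have "\<dots> = ennreal c * ennreal (L - a)" using L by (simp add: nn_integral_cmult_indicator)
  also have "\<dots> < \<infinity>" by (simp add: ennreal_mult_less_top)
  finally show ?thesis .
qed

section \<open>Level sets and Lebesgue norms on the half-line\<close>

definition super_level :: "(real \<Rightarrow> 'b::real_normed_vector) \<Rightarrow> real \<Rightarrow> real set" where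
  "super_level F c = {t \<in> {0<..}. c < norm (F t)}"

lemma halfline_sets [simp]: "{0::real<..} \<in> sets lebesgue"
  by simp

lemma AE_halfline: "(AE t in halfline. P t) \<longleftrightarrow> (AE t in lebesgue. 0 < t \<longrightarrow> P t)"
  by (subst AE_restrict_space_iff) auto

lemma nn_integral_halfline: "(\<integral>\<^sup>+ t. f t \<partial>halfline) = (\<integral>\<^sup>+ t. f t * indicator {0<..} t \<partial>lebesgue)"
  by (subst nn_integral_restrict_space) auto

lemma super_level_sets:
  assumes "strongly_measurable halfline F" shows "super_level F c \<in> sets lebesgue"
proof -
  have "(\<lambda>t. norm (F t)) \<in> borel_measurable halfline"
    by (rule strongly_measurable_norm) (use assms in auto)
  then have "{t \<in> space halfline. c < norm (F t)} \<in> sets halfline"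
    by measurable
  then have "{t \<in> {0<..}. c < norm (F t)} \<in> sets halfline" by simp
  then show ?thesis by (simp add: super_level_def sets_restrict_space_iff)
qed

lemma super_level_add:
  assumes "strongly_measurable halfline G" "strongly_measurable halfline H"
    and eq: "AE t in halfline. F t = G t + H t"
  shows "emeasure lebesgue (super_level F (c + d))
    \<le> emeasure lebesgue (super_level G c) + emeasure lebesgue (super_level H d)"
proof -
  have "AE t in lebesgue. t \<in> super_level F (c + d) \<longrightarrow> t \<in> super_level G c \<union> super_level H d"
    using eq unfolding AE_halfline
  proof eventually_elim
    case (elim t)
    then show ?case using norm_triangle_ineq[of "G t" "H t"] by (auto simp: super_level_def)
  qed
  then have "emeasure lebesgue (super_level F (c + d)) \<le> emeasure lebesgue (super_level G c \<union> super_level H d)"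
    by (rule emeasure_mono_AE) (intro sets.Un super_level_sets assms)
  also have "\<dots> \<le> emeasure lebesgue (super_level G c) + emeasure lebesgue (super_level H d)"
    by (intro emeasure_subadditive super_level_sets assms)
  finally show ?thesis .
qed

text \<open>
  Estimates are proved for the integral of the \<open>p\<close>-th power; this lemma restores the root,
  including the convention for an infinite integral.
\<close>

lemma Lp_norm_le_iff:
  assumes "1 \<le> p" "0 \<le> C"
  shows "Lp_norm (ennreal p) f \<le> ennreal C
     \<longleftrightarrow> (\<integral>\<^sup>+ t. ennreal (norm (f t) powr p) \<partial>halfline) \<le> ennreal (C powr p)"
proof -
  define I where "I = (\<integral>\<^sup>+ t. ennreal (norm (f t) powr p) \<partial>halfline)"
  have e: "Lp_norm (ennreal p) f = (if I = \<infinity> then \<infinity> else ennreal (enn2real I powr (1 / p)))"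
    using assms by (simp add: Lp_norm_def I_def)
  show ?thesis
  proof (cases "I = \<infinity>")
    case True
    then show ?thesis unfolding e I_def[symmetric] by (simp add: top_unique)
  next
    case False
    then obtain x where x: "I = ennreal x" "0 \<le> x" by (cases I) auto
    have "x powr (1 / p) \<le> C \<longleftrightarrow> x \<le> C powr p"
    proof
      assume "x powr (1 / p) \<le> C"
      then have "(x powr (1 / p)) powr p \<le> C powr p" using assms by (intro powr_mono2) auto
      then show "x \<le> C powr p" using assms x by (simp add: powr_powr)
    next
      assume "x \<le> C powr p"
      then have "x powr (1 / p) \<le> (C powr p) powr (1 / p)" using assms x by (intro powr_mono2) auto
      then show "x powr (1 / p) \<le> C" using assms by (simp add: powr_powr)
    qed
    then show ?thesis using x assms unfolding e I_def[symmetric] by simp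
  qed
qed

lemma Lp_norm_top_le:
  assumes "strongly_measurable halfline f" "AE t in halfline. norm (f t) \<le> C"
  shows "Lp_norm \<infinity> f \<le> ennreal C"
proof -
  have "(\<lambda>t. norm (f t)) \<in> borel_measurable halfline"
    by (rule strongly_measurable_norm) (use assms in auto)
  then have "(\<lambda>t. ennreal (norm (f t))) \<in> borel_measurable halfline" by measurable
  moreover have "AE t in halfline. ennreal (norm (f t)) \<le> ennreal C"
    using assms(2) by eventually_elim (rule ennreal_leI)
  ultimately show ?thesis by (simp add: Lp_norm_def esssup_I)
qed

lemma Lp_norm_top_AE:
  assumes "Lp_norm \<infinity> f \<le> ennreal C" "0 \<le> C"
  shows "AE t in halfline. norm (f t) \<le> C"
proof -
  have "AE t in halfline. ennreal (norm (f t)) \<le> esssup halfline (\<lambda>t. ennreal (norm (f t)))"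
    by (rule esssup_AE)
  then show ?thesis
  proof eventually_elim
    case (elim t)
    moreover have "esssup halfline (\<lambda>t. ennreal (norm (f t))) \<le> ennreal C"
      using assms by (simp add: Lp_norm_def)
    ultimately have "ennreal (norm (f t)) \<le> ennreal C" by (rule order_trans)
    then show ?case using assms by simp
  qed
qed

text \<open>
  The essential support lies in any closed interval off which the function vanishes, and a limit
  of points of it belongs to it again; as it stays away from \<open>0\<close>, it is compact in the line.
\<close>

lemma ess_support_subset:
  assumes f: "\<And>t. 0 < t \<Longrightarrow> t \<notin> {u..v} \<Longrightarrow> f t = 0" and "0 < u"
  shows "ess_support f \<subseteq> {u..v}" "compact (ess_support f)"
proof -
  show sub: "ess_support f \<subseteq> {u..v}"
  proof
    fix t assume t: "t \<in> ess_support f"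
    show "t \<in> {u..v}"
    proof (rule ccontr)
      assume "t \<notin> {u..v}"
      moreover have "open (- {u..v})" by (intro open_Compl closed_real_atLeastAtMost)
      ultimately obtain e where "e > 0" "\<forall>s. dist s t < e \<longrightarrow> s \<in> - {u..v}"
        unfolding open_dist by blast
      then have e: "e > 0" "\<And>s. \<bar>s - t\<bar> < e \<Longrightarrow> s \<notin> {u..v}"
        by (auto simp: dist_real_def)
      have "AE s in halfline. \<bar>s - t\<bar> < e \<longrightarrow> f s = 0"
        unfolding AE_halfline using e(2) f by auto
      then show False using t e(1) by (auto simp: ess_support_def)
    qed
  qed
  have "closed (ess_support f)"
    unfolding closed_sequential_limits
  proof (intro allI impI, elim conjE)
    fix x l assume x: "\<forall>n. x n \<in> ess_support f" "x \<longlonglongrightarrow> l"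
    have "l \<in> {u..v}"
      using x sub closed_real_atLeastAtMost[of u v] unfolding closed_sequential_limits by blast
    show "l \<in> ess_support f" unfolding ess_support_def
    proof (intro CollectI conjI allI impI notI)
      show "l \<in> {0<..}" using \<open>l \<in> {u..v}\<close> assms by auto
      fix e :: real assume e: "0 < e" and ae: "AE s in halfline. \<bar>s - l\<bar> < e \<longrightarrow> f s = 0"
      obtain n where n: "\<bar>x n - l\<bar> < e / 2"
        using LIMSEQ_D[OF x(2), of "e / 2"] e by auto
      have "AE s in halfline. \<bar>s - x n\<bar> < e / 2 \<longrightarrow> f s = 0"
        using ae
      proof eventually_elim
        case (elim s)
        have "\<bar>s - l\<bar> \<le> \<bar>s - x n\<bar> + \<bar>x n - l\<bar>" by linarith
        then show ?case using elim n by linarith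
      qed
      then show False using x(1)[rule_format, of n] half_gt_zero[OF e] unfolding ess_support_def by blast
    qed
  qed
  moreover have "bounded (ess_support f)" using sub bounded_closed_interval bounded_subset by blast
  ultimately show "compact (ess_support f)" by (simp add: compact_eq_bounded_closed)
qed

section \<open>Singular integral operators of Volterra type\<close>

text \<open>
  The base point \<open>a\<close> of the grid is part of the locale; every test function gets its own.
\<close>

locale volterra_operator =
  fixes T :: "(real \<Rightarrow> 'x::banach) \<Rightarrow> (real \<Rightarrow> 'y::banach)"
    and K :: "real \<Rightarrow> real \<Rightarrow> 'x \<Rightarrow>\<^sub>L 'y"
    and r :: ennreal and B M \<sigma> a :: real
  assumes r: "1 < r"
    and sigma: "0 < \<sigma>" "\<sigma> \<le> 1"
    and linear: "Lp_linear_operator r T"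
    and B: "0 \<le> B" "Lp_opnorm r T = ennreal B"
    and kernel: "volterra_kernel M \<sigma> K"
    and representation: "has_volterra_kernel r T K"
    and a: "0 < a"
begin

lemma M_nonneg: "0 \<le> M"
proof -
  have "norm (K 2 1) \<le> M"
    using kernel[unfolded volterra_kernel_def, THEN conjunct1, rule_format, of 1 2] by simp
  then show ?thesis using norm_ge_zero[of "K 2 1"] by (rule order_trans[rotated])
qed

text \<open>
  Being bounded with bounded support, functions of the working class belong to every Lebesgue space,
  so \<open>T\<close> is defined on them whatever \<open>r\<close> is.
\<close>

lemma admissible_Lp:
  fixes f :: "real \<Rightarrow> 'x"
  assumes f: "admissible a f" shows "f \<in> Lp_space r"
proof -
  obtain c where c: "0 < c" "\<And>t. norm (f t) \<le> c" using admissible_bounded[OF f] by blast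
  have sm: "strongly_measurable halfline f" by (rule admissible_strongly_measurable[OF f a])
  have "Lp_norm r f < \<infinity>"
  proof (cases r)
    case top
    have "Lp_norm \<infinity> f \<le> ennreal c" by (rule Lp_norm_top_le[OF sm]) (simp add: c)
    then show ?thesis using top le_less_trans by fastforce
  next
    case (real p)
    have p: "1 < p" using r real by (simp add: ennreal_less_iff[of 1, simplified])
    obtain L where L: "\<And>t. t < a \<or> L \<le> t \<Longrightarrow> f t = 0" "a < L" using admissible_support[OF f] by metis
    have "(\<integral>\<^sup>+ t. ennreal (norm (f t) powr p) \<partial>halfline)
        \<le> (\<integral>\<^sup>+ t. ennreal (c powr p) * indicator {a..L} t \<partial>lebesgue)"
      unfolding nn_integral_halfline
      using c L(1) p by (intro nn_integral_mono) (auto simp: indicator_def intro!: ennreal_leI powr_mono2)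
    also have "\<dots> = ennreal (c powr p) * ennreal (L - a)" using L by (simp add: nn_integral_cmult_indicator)
    also have "\<dots> < \<infinity>" by (simp add: ennreal_mult_less_top)
    finally show ?thesis using p unfolding real(2) by (simp add: Lp_norm_def Let_def)
  qed
  then show ?thesis using sm by (simp add: Lp_space_def)
qed

lemma T_strongly_measurable: "admissible a f \<Longrightarrow> strongly_measurable halfline (T f)"
  using linear admissible_Lp unfolding Lp_linear_operator_def Lp_space_def by blast

lemma T_add: "admissible a f \<Longrightarrow> admissible a g \<Longrightarrow> AE t in halfline. T (\<lambda>s. f s + g s) t = T f t + T g t"
  using linear admissible_Lp unfolding Lp_linear_operator_def by blast

lemma T_scaleR: "admissible a f \<Longrightarrow> AE t in halfline. T (\<lambda>s. c *\<^sub>R f s) t = c *\<^sub>R T f t"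
  using linear admissible_Lp unfolding Lp_linear_operator_def by blast

lemma T_zero: "AE t in halfline. T (\<lambda>s. 0) t = 0"
  using T_scaleR[OF admissible_zero, of 0] by simp

lemma T_sum:
  assumes "finite F" "\<And>i. i \<in> F \<Longrightarrow> admissible a (f i)"
  shows "AE t in halfline. T (\<lambda>s. \<Sum>i\<in>F. f i s) t = (\<Sum>i\<in>F. T (f i) t)"
  using assms
proof (induction F rule: finite_induct)
  case empty
  then show ?case using T_zero by simp
next
  case (insert i F)
  have "AE t in halfline. T (\<lambda>s. \<Sum>i\<in>F. f i s) t = (\<Sum>i\<in>F. T (f i) t)" using insert by simp
  moreover have "AE t in halfline. T (\<lambda>s. f i s + (\<Sum>i\<in>F. f i s)) t = T (f i) t + T (\<lambda>s. \<Sum>i\<in>F. f i s) t"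
    by (intro T_add admissible_sum) (use insert in auto)
  ultimately show ?case
  proof eventually_elim
    case (elim t)
    then show ?case using insert(1,2) by simp
  qed
qed

lemma T_bound:
  assumes f: "f \<in> Lp_space r" and "Lp_norm r f \<le> 1"
  shows "Lp_norm r (T f) \<le> ennreal B"
  unfolding B(2)[symmetric] Lp_opnorm_def using assms by (intro SUP_upper) auto

text \<open>
  For \<open>r = \<infinity>\<close> the hypotheses give \<open>|T g| \<le> B h \<le> \<lambda>\<close> almost everywhere. For \<open>r < \<infinity>\<close> Chebyshev's
  inequality bounds the measure by \<open>(B / \<lambda>)\<^sup>r \<integral>|g|\<^sup>r \<le> (B / \<lambda>)\<^sup>r h\<^sup>r\<^sup>-\<^sup>1 \<integral>|g|\<close>, which is
  \<open>(B h / \<lambda>)\<^sup>r\<close> times \<open>\<integral>|g| / h\<close>. Either way \<open>r\<close> has disappeared from the conclusion.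
\<close>

lemma T_super_level:
  assumes g: "admissible a g" and h: "\<And>t. norm (g t) \<le> h" "0 < h"
    and l: "B * h \<le> l" "0 < l" and I: "(\<integral>\<^sup>+ t. ennreal (norm (g t)) \<partial>lebesgue) \<le> ennreal I" "0 < I"
  shows "emeasure lebesgue (super_level (T g) l) \<le> ennreal (I / h)"
proof (cases r)
  case top
  have gm: "admissible a (\<lambda>t. (1 / h) *\<^sub>R g t)" by (rule admissible_scaleR[OF g])
  have "Lp_norm r (\<lambda>t. (1 / h) *\<^sub>R g t) \<le> ennreal 1" unfolding top infinity_ennreal_def[symmetric]
    by (rule Lp_norm_top_le[OF admissible_strongly_measurable[OF gm a]]) (use h in \<open>simp add: field_simps\<close>)
  then have "Lp_norm \<infinity> (T (\<lambda>t. (1 / h) *\<^sub>R g t)) \<le> ennreal B"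
    using T_bound[OF admissible_Lp[OF gm]] top by simp
  then have "AE t in halfline. norm (T (\<lambda>t. (1 / h) *\<^sub>R g t) t) \<le> B"
    by (rule Lp_norm_top_AE[OF _ B(1)])
  then have "AE t in halfline. norm (T g t) \<le> l"
    using T_scaleR[OF g, of "1 / h"]
  proof eventually_elim
    case (elim t)
    then have "norm (T g t) \<le> B * h" using h(2) by (simp add: field_simps)
    then show ?case using l by simp
  qed
  then have "AE t in lebesgue. \<not> t \<in> super_level (T g) l"
    unfolding AE_halfline by eventually_elim (auto simp: super_level_def)
  then have "emeasure lebesgue {t \<in> space lebesgue. t \<in> super_level (T g) l} = 0"
    by (rule emeasure_eq_0_AE)
  then show ?thesis by simp
next
  case (real p)
  have p: "1 < p" using r real by (simp add: ennreal_less_iff[of 1, simplified])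
  \<comment> \<open>\<open>Q\<close> bounds the integral of \<open>|g|\<^sup>p\<close>, so scaling by \<open>c\<close> brings \<open>g\<close> into the unit ball.\<close>
  define Q where "Q = h powr (p - 1) * I"
  have Q: "0 < Q" using h I by (simp add: Q_def)
  define c where "c = Q powr (- (1 / p))"
  have "c powr p = Q powr (- (1 / p) * p)" unfolding c_def by (rule powr_powr)
  then have c: "0 < c" "c powr p = 1 / Q" using Q p
    by (simp_all add: c_def powr_minus_divide)
  have gm: "admissible a (\<lambda>t. c *\<^sub>R g t)" by (rule admissible_scaleR[OF g])
  have "(\<integral>\<^sup>+ t. ennreal (norm (c *\<^sub>R g t) powr p) \<partial>halfline) \<le>
      (\<integral>\<^sup>+ t. ennreal (1 / Q * h powr (p - 1)) * ennreal (norm (g t)) \<partial>lebesgue)"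
    unfolding nn_integral_halfline
  proof (rule nn_integral_mono)
    fix t
    have "norm (c *\<^sub>R g t) powr p = 1 / Q * norm (g t) powr (p - 1) * norm (g t)"
    proof -
      have "norm (g t) powr p = norm (g t) powr (p - 1) * norm (g t)"
        using powr_add[of "norm (g t)" "p - 1" 1] by simp
      then show ?thesis using c by (simp add: powr_mult)
    qed
    also have "\<dots> \<le> 1 / Q * h powr (p - 1) * norm (g t)"
      using Q h p by (intro mult_right_mono mult_left_mono powr_mono2) auto
    finally show "ennreal (norm (c *\<^sub>R g t) powr p) * indicator {0<..} t
        \<le> ennreal (1 / Q * h powr (p - 1)) * ennreal (norm (g t))"
      using Q by (auto simp: indicator_def ennreal_mult[symmetric] intro: ennreal_leI)
  qed
  also have "\<dots> = ennreal (1 / Q * h powr (p - 1)) * (\<integral>\<^sup>+ t. ennreal (norm (g t)) \<partial>lebesgue)"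
    by (intro nn_integral_cmult admissible_ennreal_measurable[OF g])
  also have "\<dots> \<le> ennreal (1 / Q * h powr (p - 1)) * ennreal I"
    by (intro mult_left_mono I) simp
  also have "\<dots> = ennreal (1 powr p)"
    using Q I by (subst ennreal_mult[symmetric]) (auto simp: Q_def)
  finally have "Lp_norm r (\<lambda>t. c *\<^sub>R g t) \<le> 1"
    using Lp_norm_le_iff[of p 1 "\<lambda>t. c *\<^sub>R g t"] p real by simp
  then have "Lp_norm (ennreal p) (T (\<lambda>t. c *\<^sub>R g t)) \<le> ennreal B"
    using T_bound[OF admissible_Lp[OF gm]] real by simp
  then have le: "(\<integral>\<^sup>+ t. ennreal (norm (T (\<lambda>t. c *\<^sub>R g t) t) powr p) \<partial>halfline) \<le> ennreal (B powr p)"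
    using p B by (intro Lp_norm_le_iff[THEN iffD1]) auto
  have "AE t in halfline. ennreal (norm (T (\<lambda>t. c *\<^sub>R g t) t) powr p)
      \<ge> ennreal ((c * l) powr p) * indicator (super_level (T g) l) t"
    using T_scaleR[OF g, of c]
  proof eventually_elim
    case (elim t)
    show ?case
    proof (cases "t \<in> super_level (T g) l")
      case True
      then have "l \<le> norm (T g t)" by (simp add: super_level_def)
      then show ?thesis using True elim c(1) l p
        by (auto intro!: ennreal_leI powr_mono2)
    qed simp
  qed
  then have "(\<integral>\<^sup>+ t. ennreal ((c * l) powr p) * indicator (super_level (T g) l) t \<partial>halfline)
      \<le> (\<integral>\<^sup>+ t. ennreal (norm (T (\<lambda>t. c *\<^sub>R g t) t) powr p) \<partial>halfline)"
    by (intro nn_integral_mono_AE)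
  also note le
  also have "(\<integral>\<^sup>+ t. ennreal ((c * l) powr p) * indicator (super_level (T g) l) t \<partial>halfline)
     = (\<integral>\<^sup>+ t. ennreal ((c * l) powr p) * indicator (super_level (T g) l) t \<partial>lebesgue)"
    unfolding nn_integral_halfline
    by (intro nn_integral_cong) (auto simp: indicator_def super_level_def)
  also have "\<dots> = ennreal ((c * l) powr p) * emeasure lebesgue (super_level (T g) l)"
    by (intro nn_integral_cmult_indicator super_level_sets T_strongly_measurable g)
  finally have "ennreal (l powr p / Q) * emeasure lebesgue (super_level (T g) l) \<le> ennreal (B powr p)"
    using c l by (simp add: powr_mult)
  then have "ennreal (Q / l powr p) * (ennreal (l powr p / Q) * emeasure lebesgue (super_level (T g) l))
      \<le> ennreal (Q / l powr p) * ennreal (B powr p)"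
    by (rule mult_left_mono) simp
  also have "ennreal (Q / l powr p) * (ennreal (l powr p / Q) * emeasure lebesgue (super_level (T g) l))
     = emeasure lebesgue (super_level (T g) l)"
    unfolding mult.assoc[symmetric] using Q l by (subst ennreal_mult[symmetric]) auto
  also have "ennreal (Q / l powr p) * ennreal (B powr p) = ennreal ((B * h) powr p / l powr p * (I / h))"
  proof -
    have "h powr p = h powr (p - 1) * h" using powr_add[of h "p - 1" 1] h by simp
    then have "Q / l powr p * B powr p = (B * h) powr p / l powr p * (I / h)"
      using h B by (simp add: Q_def powr_mult)
    then show ?thesis using Q by (simp add: ennreal_mult[symmetric])
  qed
  also have "\<dots> \<le> ennreal (1 * (I / h))"
  proof (intro ennreal_leI mult_right_mono)
    show "(B * h) powr p / l powr p \<le> 1"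
      using l h B p by (simp add: powr_mono2)
  qed (use h I in simp)
  finally show ?thesis by simp
qed

lemma T_kernel:
  assumes g: "admissible a g" and uv: "\<And>t. 0 < t \<Longrightarrow> t \<notin> {u..v} \<Longrightarrow> g t = 0" and "0 < u"
  shows "AE t in halfline. t \<notin> {u..v} \<longrightarrow> has_strong_integral (lebesgue_on {0<..<t}) (\<lambda>s. K t s (g s)) (T g t)"
proof -
  have sub: "ess_support g \<subseteq> {u..v}" "compact (ess_support g)"
    by (rule ess_support_subset[where f = g, OF uv \<open>0 < u\<close>]; simp)+
  have "AE t in halfline. t \<notin> ess_support g \<longrightarrow>
           has_strong_integral (lebesgue_on {0<..<t}) (\<lambda>s. blinfun_apply (K t s) (g s)) (T g t)"
    using representation admissible_Lp[OF g] sub(2)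
    unfolding has_volterra_kernel_def by blast
  then show ?thesis
    by eventually_elim (use sub(1) in blast)
qed

text \<open>
  For \<open>t < u\<close> the function vanishes on \<open>(0, t)\<close>, and \<open>t\<close> lies outside its support; so the kernel
  representation is available and its integral is zero.
\<close>

lemma T_causal:
  assumes g: "admissible a g" and u: "\<And>t. 0 < t \<Longrightarrow> t < u \<Longrightarrow> g t = 0" and "0 < u"
  shows "AE t in halfline. t < u \<longrightarrow> T g t = 0"
proof -
  obtain L where L: "\<And>t. t < a \<or> L \<le> t \<Longrightarrow> g t = 0" using admissible_support[OF g] by metis
  have "AE t in halfline. t \<notin> {u..L} \<longrightarrow> has_strong_integral (lebesgue_on {0<..<t}) (\<lambda>s. K t s (g s)) (T g t)"
    by (rule T_kernel[OF g _ \<open>0 < u\<close>]) (use u L in \<open>auto simp: not_le\<close>)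
  then show ?thesis
  proof eventually_elim
    case (elim t)
    show ?case
    proof
      assume t: "t < u"
      then have "ennreal (norm (T g t)) \<le> (\<integral>\<^sup>+ s. ennreal (norm (K t s (g s))) \<partial>lebesgue_on {0<..<t})"
        using elim by (intro has_strong_integral_norm_bound) auto
      also have "\<dots> = (\<integral>\<^sup>+ s. 0 \<partial>lebesgue_on {0<..<t})"
        using t u by (intro nn_integral_cong) auto
      finally show "T g t = 0" by simp
    qed
  qed
qed

end

section \<open>Atoms and the Calderon-Zygmund decomposition\<close>

text \<open>
  The modulus of continuity of the kernel over distance \<open>l\<close>, integrated over the points at distance
  at least \<open>2 l\<close> to the right of \<open>u\<close>.
\<close>

lemma nn_integral_power_tail:
  fixes l \<sigma> u :: real
  assumes "0 < l" "0 < \<sigma>"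
  shows "(\<integral>\<^sup>+ t. ennreal (l powr \<sigma> / (t - u) powr (1 + \<sigma>)) * indicator {u + 2 * l..} t \<partial>lebesgue)
    \<le> ennreal (1 / \<sigma>)"
proof -
  define f where "f = (\<lambda>t. l powr \<sigma> / (t - u) powr (1 + \<sigma>))"
  define F where "F = (\<lambda>t. - (l powr \<sigma> / \<sigma>) * (t - u) powr (- \<sigma>))"
  have "(\<integral>\<^sup>+ t. ennreal (f t) * indicator {u + 2 * l..} t \<partial>lborel) = ennreal (0 - F (u + 2 * l))"
  proof (rule nn_integral_FTC_atLeast)
    show "f \<in> borel_measurable borel" unfolding f_def by measurable
    show "0 \<le> f t" for t by (simp add: f_def)
    show "DERIV F t :> f t" if "u + 2 * l \<le> t" for t
    proof -
      have "0 < t - u" using that assms by linarith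
      then have "DERIV F t :> - (l powr \<sigma> / \<sigma>) * (- \<sigma> * (t - u) powr (- \<sigma> - 1))"
        unfolding F_def by (auto intro!: derivative_eq_intros simp: powr_diff field_simps)
      moreover have "(t - u) powr (- \<sigma> - 1) = 1 / (t - u) powr (1 + \<sigma>)"
        by (metis add.commute minus_add_distrib powr_minus_divide uminus_add_conv_diff diff_conv_add_uminus)
      ultimately show ?thesis using assms by (simp add: f_def)
    qed
    have "((\<lambda>t. (t - u) powr (- \<sigma>)) \<longlongrightarrow> 0) at_top"
    proof (rule tendsto_neg_powr)
      show "LIM x at_top. x - u :> at_top"
        using filterlim_tendsto_add_at_top[OF tendsto_const[of "- u"] filterlim_ident] by simp
    qed (use assms in simp)
    then show "(F \<longlongrightarrow> 0) at_top" unfolding F_def by (rule tendsto_mult_right_zero)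
  qed
  also have "0 - F (u + 2 * l) = 2 powr (- \<sigma>) / \<sigma>"
    using assms by (simp add: F_def powr_mult powr_minus field_simps)
  also have "ennreal \<dots> \<le> ennreal (1 / \<sigma>)"
  proof (intro ennreal_leI divide_right_mono)
    have "2 powr (- \<sigma>) \<le> 2 powr (0::real)" using assms by (intro powr_mono) auto
    then show "2 powr (- \<sigma>) \<le> (1::real)" by simp
  qed (use assms in simp)
  finally show ?thesis by (simp add: f_def nn_integral_completion)
qed

lemma dyadic_step_integrable:
  assumes g: "dyadic_step a k L g"
  shows "Bochner_Integration.simple_bochner_integrable lebesgue g"
  using admissible_integral_finite[OF admissible_step[OF g]]
  by (intro simple_bochner_integrableI_bounded dyadic_step_simple[OF g])

lemma simple_bochner_integral_cell:
  "Bochner_Integration.simple_bochner_integrable lebesgue (\<lambda>s. indicator (cell a J) s *\<^sub>R v)"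
  "Bochner_Integration.simple_bochner_integral lebesgue (\<lambda>s. indicator (cell a J) s *\<^sub>R v) = side J *\<^sub>R v"
proof -
  have s: "simple_function lebesgue (\<lambda>s. indicator (cell a J) s :: real)"
    by (rule simple_function_indicator) simp
  have i: "Bochner_Integration.simple_bochner_integrable lebesgue (\<lambda>s. indicator (cell a J) s :: real)"
    using s by (rule simple_bochner_integrable.intros) (simp add: indicator_eq_0_iff)
  have "ennreal (Bochner_Integration.simple_bochner_integral lebesgue (\<lambda>s. indicator (cell a J) s :: real))
      = (\<integral>\<^sup>+ s. ennreal (indicator (cell a J) s) \<partial>lebesgue)"
    by (rule simple_bochner_integral_eq_nn_integral[OF i]) simp
  also have "\<dots> = ennreal (side J)"
    by (simp add: ennreal_indicator)
  finally have "Bochner_Integration.simple_bochner_integral lebesgue (\<lambda>s. indicator (cell a J) s :: real) = side J"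
    by (subst (asm) ennreal_inj) (auto intro: simple_bochner_integral_nonneg)
  moreover have "linear (\<lambda>x::real. x *\<^sub>R v)" by (simp add: bounded_linear.linear bounded_linear_scaleR_left)
  ultimately show "Bochner_Integration.simple_bochner_integral lebesgue (\<lambda>s. indicator (cell a J) s *\<^sub>R v) = side J *\<^sub>R v"
    using simple_bochner_integral_linear[OF _ i, of "\<lambda>x. x *\<^sub>R v"] by simp
  show "Bochner_Integration.simple_bochner_integrable lebesgue (\<lambda>s. indicator (cell a J) s *\<^sub>R v)"
    by (rule simple_bochner_integrable_compose2[where p = "\<lambda>x y. x *\<^sub>R v", OF _ i i]) simp
qed

text \<open>
  The cells \<open>Q\<close> are the maximal ones, at or above the scale of the step function, on which the mean
  of \<open>|f|\<close> exceeds \<open>\<alpha>\<close>. The parent of such a cell has mean at most \<open>\<alpha>\<close>, so the cell itself has mean at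
  most \<open>2 \<alpha>\<close>. A cell of the smallest scale outside the selection has mean at most \<open>\<alpha>\<close>, and this
  mean is the norm of the constant value of \<open>f\<close> there.
\<close>

lemma calderon_zygmund_decomposition:
  fixes f :: "real \<Rightarrow> 'a::real_normed_vector"
  assumes f: "dyadic_step a k L f" and \<alpha>: "0 < \<alpha>"
    and I: "(\<integral>\<^sup>+ t. ennreal (norm (f t)) \<partial>lebesgue) \<le> ennreal I" "0 < I"
  obtains Q b where "finite Q"
    "\<And>J. J \<in> Q \<Longrightarrow> \<exists>L. dyadic_step a k L (b J)"
    "\<And>J t. t \<notin> cell a J \<Longrightarrow> b J t = 0"
    "\<And>J. J \<in> Q \<Longrightarrow> Bochner_Integration.simple_bochner_integral lebesgue (b J) = 0"
    "(\<Sum>J\<in>Q. side J) \<le> I / \<alpha>"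
    "(\<Sum>J\<in>Q. \<integral>\<^sup>+ t. ennreal (norm (b J t)) \<partial>lebesgue) \<le> ennreal (2 * I)"
    "\<And>t. norm (f t - (\<Sum>J\<in>Q. b J t)) \<le> 2 * \<alpha>"
proof -
  define N where "N = density lebesgue (\<lambda>t. ennreal (norm (f t)))"
  have adm: "admissible a f" by (rule admissible_step[OF f])
  have N: "sets N = sets lebesgue" by (simp add: N_def)
  have mass: "emeasure N A = (\<integral>\<^sup>+ t. ennreal (norm (f t)) * indicator A t \<partial>lebesgue)" if "A \<in> sets lebesgue" for A
    unfolding N_def by (rule emeasure_density[OF admissible_ennreal_measurable[OF adm] that])
  have total: "emeasure N A \<le> ennreal I" for A
  proof -
    have "emeasure N A \<le> emeasure N (space N)" by (rule emeasure_space)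
    also have "\<dots> = (\<integral>\<^sup>+ t. ennreal (norm (f t)) \<partial>lebesgue)"
      using mass[of UNIV] by (simp add: N_def)
    finally show ?thesis using I(1) by simp
  qed
  define S where "S = {J. k \<le> fst J \<and> ennreal (\<alpha> * side J) < emeasure N (cell a J)}"
  define Q where "Q = maximal_cells S"
  have bounded: "side J \<le> I / \<alpha>" if "J \<in> S" for J
  proof -
    have "ennreal (\<alpha> * side J) \<le> ennreal I" using that total[of "cell a J"] unfolding S_def by force
    then have "\<alpha> * side J \<le> I" using I(2) by simp
    then show ?thesis using \<alpha> by (simp add: field_simps)
  qed
  have "finite S"
  proof -
    obtain n where n: "I / \<alpha> < 2 ^ n" using real_arch_pow[of 2] by auto
    define m where "m = nat \<lceil>(L - a) / 2 powi k\<rceil>"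
    have "S \<subseteq> {k..int n} \<times> {..m}"
    proof
      fix J assume J: "J \<in> S"
      have "fst J \<le> int n"
      proof (rule ccontr)
        assume "\<not> fst J \<le> int n"
        then have "(2::real) powi int n \<le> 2 powi fst J" by (intro power_int_increasing) auto
        then show False using n bounded[OF J] by (simp add: side_def)
      qed
      moreover have "k \<le> fst J" using J by (simp add: S_def)
      moreover have "snd J \<le> m"
      proof -
        have "\<exists>t\<in>cell a J. f t \<noteq> 0"
        proof (rule ccontr)
          assume "\<not> (\<exists>t\<in>cell a J. f t \<noteq> 0)"
          then have "(\<lambda>t. ennreal (norm (f t)) * indicator (cell a J) t) = (\<lambda>t. 0)"
            by (auto simp: fun_eq_iff indicator_def)
          then have "emeasure N (cell a J) = 0" by (simp add: mass)
          then show False using J by (simp add: S_def)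
        qed
        then obtain t where t: "t \<in> cell a J" "f t \<noteq> 0" by blast
        have "t < L" using t(2) dyadic_stepD(3)[OF f, of t] by (meson not_less)
        then have "real (snd J) * side J < L - a" using t(1) by (simp add: cell_def left_def)
        moreover have "2 powi k \<le> side J" unfolding side_def using \<open>k \<le> fst J\<close> by (intro power_int_increasing) auto
        then have "real (snd J) * 2 powi k \<le> real (snd J) * side J" by (rule mult_left_mono) simp
        ultimately have "real (snd J) \<le> (L - a) / 2 powi k" by (simp add: field_simps)
        also have "\<dots> \<le> real m" by (simp add: m_def real_nat_ceiling_ge)
        finally show ?thesis by simp
      qed
      ultimately show "J \<in> {k..int n} \<times> {..m}" by (cases J) simp
    qed
    then show ?thesis by (rule finite_subset) simp
  qed
  then have finQ: "finite Q" unfolding Q_def using maximal_cells_subset finite_subset by blast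
  have QS: "J \<in> S" if "J \<in> Q" for J using that maximal_cells_subset unfolding Q_def by blast
  \<comment> \<open>The parent of a maximal cell was not selected and is twice as long.\<close>
  have mass_le: "emeasure N (cell a J) \<le> ennreal (2 * \<alpha> * side J)" if "J \<in> Q" for J
  proof -
    have "emeasure N (cell a J) \<le> emeasure N (cell a (ancestor 1 J))"
      by (intro emeasure_mono cell_subset_ancestor) (simp add: N)
    also have "\<dots> \<le> ennreal (\<alpha> * side (ancestor 1 J))"
      using maximal_cells_parent[OF that[unfolded Q_def]] QS[OF that] unfolding S_def
      by (auto simp: ancestor_def not_less)
    finally show ?thesis by (simp add: side_ancestor mult_ac)
  qed
  have sum_mass: "(\<Sum>J\<in>Q. emeasure N (cell a J)) \<le> ennreal I"
    using nn_integral_maximal_cells[OF N, where a = a and S = S] total finQ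
    by (simp add: Q_def[symmetric] nn_integral_count_space_finite)
  have sum_side: "(\<Sum>J\<in>Q. side J) \<le> I / \<alpha>"
  proof -
    have "ennreal (\<alpha> * (\<Sum>J\<in>Q. side J)) = (\<Sum>J\<in>Q. ennreal (\<alpha> * side J))"
      using \<alpha> by (simp add: sum_distrib_left)
    also have "\<dots> \<le> (\<Sum>J\<in>Q. emeasure N (cell a J))"
      using QS by (intro sum_mono) (auto simp: S_def less_imp_le)
    also note sum_mass
    finally have "\<alpha> * (\<Sum>J\<in>Q. side J) \<le> I" using I(2) by simp
    then show ?thesis using \<alpha> by (simp add: field_simps)
  qed
  define v where "v J = (1 / side J) *\<^sub>R Bochner_Integration.simple_bochner_integral lebesgue
      (\<lambda>s. indicator (cell a J) s *\<^sub>R f s)" for J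
  define b where "b J = (\<lambda>s. indicator (cell a J) s *\<^sub>R f s - indicator (cell a J) s *\<^sub>R v J)" for J
  have same_cell: "s \<in> cell a J \<longleftrightarrow> t \<in> cell a J"
    if "k \<le> fst J" "s \<in> cell a (k, m)" "t \<in> cell a (k, m)" for s t m J
    using cell_mem_cong[of s a "(k, m)" t J] cell_mem_cong[of t a "(k, m)" s J] that by auto
  have step1: "dyadic_step a k L (\<lambda>s. indicator (cell a J) s *\<^sub>R f s)" if "J \<in> Q" for J
  proof (rule dyadic_step_indicator[OF f])
    fix m s t assume "s \<in> cell a (k, m)" "t \<in> cell a (k, m)" "s \<in> cell a J"
    then show "t \<in> cell a J" using same_cell[of J s m t] QS[OF that] by (simp add: S_def)
  qed
  have step2: "dyadic_step a k (left a J + side J) (\<lambda>s. indicator (cell a J) s *\<^sub>R w)" if "J \<in> Q" for J w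
    unfolding dyadic_step_def
  proof (intro conjI allI impI ballI)
    fix m t assume "t \<in> cell a (k, m)"
    then have "t \<in> cell a J \<longleftrightarrow> left a (k, m) \<in> cell a J"
      using same_cell[of J t m "left a (k, m)"] QS[OF that] by (simp add: S_def)
    then show "indicator (cell a J) t *\<^sub>R w = indicator (cell a J) (left a (k, m)) *\<^sub>R w"
      by (auto simp: indicator_def)
  next
    fix t assume "t < a \<or> left a J + side J \<le> t"
    then have "t \<notin> cell a J" using left_ge[of a J] by (auto simp: cell_def)
    then show "indicator (cell a J) t *\<^sub>R w = 0" by simp
  qed
  have bstep: "dyadic_step a k (max L (left a J + side J)) (b J)" if "J \<in> Q" for J
    unfolding b_def
    by (rule dyadic_step_compose2[where p = "(-)", OF dyadic_step_mono[OF step1[OF that]] dyadic_step_mono[OF step2[OF that]]])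
      auto
  have norm_v: "ennreal (side J * norm (v J)) \<le> emeasure N (cell a J)" if "J \<in> Q" for J
  proof -
    have "ennreal (side J * norm (v J)) = ennreal (norm (Bochner_Integration.simple_bochner_integral lebesgue
      (\<lambda>s. indicator (cell a J) s *\<^sub>R f s)))" by (simp add: v_def)
    also have "\<dots> \<le> (\<integral>\<^sup>+ s. ennreal (norm (indicator (cell a J) s *\<^sub>R f s)) \<partial>lebesgue)"
      by (rule simple_bochner_integral_norm_le[OF dyadic_step_integrable[OF step1[OF that]]])
    also have "\<dots> = emeasure N (cell a J)"
      by (subst mass) (auto intro!: nn_integral_cong simp: indicator_def)
    finally show ?thesis .
  qed
  have v_le: "norm (v J) \<le> 2 * \<alpha>" if "J \<in> Q" for J
  proof -
    have "ennreal (side J * norm (v J)) \<le> ennreal (2 * \<alpha> * side J)"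
      using norm_v[OF that] mass_le[OF that] by (rule order_trans)
    then have "side J * norm (v J) \<le> side J * (2 * \<alpha>)" using \<alpha> by (simp add: mult_ac)
    then show ?thesis by (rule mult_left_le_imp_le) simp
  qed
  have b_mean: "Bochner_Integration.simple_bochner_integral lebesgue (b J) = 0" if "J \<in> Q" for J
    unfolding b_def
    by (subst simple_bochner_integral_diff[OF dyadic_step_integrable[OF step1[OF that]] simple_bochner_integral_cell(1)])
      (subst simple_bochner_integral_cell(2), simp add: v_def)
  have b_norm: "(\<integral>\<^sup>+ t. ennreal (norm (b J t)) \<partial>lebesgue) \<le> 2 * emeasure N (cell a J)" if "J \<in> Q" for J
  proof -
    have "(\<integral>\<^sup>+ t. ennreal (norm (b J t)) \<partial>lebesgue) \<le>
        (\<integral>\<^sup>+ t. ennreal (norm (f t)) * indicator (cell a J) t + ennreal (norm (v J)) * indicator (cell a J) t \<partial>lebesgue)"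
    proof (intro nn_integral_mono)
      fix t show "ennreal (norm (b J t)) \<le> ennreal (norm (f t)) * indicator (cell a J) t + ennreal (norm (v J)) * indicator (cell a J) t"
        using norm_triangle_ineq4[of "f t" "v J"]
        by (auto simp: b_def indicator_def ennreal_plus[symmetric] simp del: ennreal_plus intro!: ennreal_leI)
    qed
    also have "\<dots> = emeasure N (cell a J) + ennreal (norm (v J)) * ennreal (side J)"
      by (subst nn_integral_add)
        (auto simp: mass nn_integral_cmult_indicator intro!: borel_measurable_times_ennreal admissible_ennreal_measurable[OF adm])
    also have "ennreal (norm (v J)) * ennreal (side J) \<le> emeasure N (cell a J)"
      using norm_v[OF that] by (simp add: ennreal_mult[symmetric] mult.commute)
    finally show ?thesis by (simp add: mult_2)
  qed
  define bb where "bb = (\<lambda>t. \<Sum>J\<in>Q. b J t)"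
  define g where "g = (\<lambda>t. f t - bb t)"
  have b_out: "b J t = 0" if "t \<notin> cell a J" for J t using that by (simp add: b_def)
  have g_le: "norm (g t) \<le> 2 * \<alpha>" for t
  proof (cases "\<exists>J\<in>Q. t \<in> cell a J")
    case True
    then obtain J where J: "J \<in> Q" "t \<in> cell a J" by blast
    have "t \<notin> cell a J'" if "J' \<in> Q" "J' \<noteq> J" for J'
      using disjoint_maximal_cells[of a S] J that unfolding Q_def disjoint_family_on_def by blast
    then have "bb t = b J t" unfolding bb_def using J(1) finQ
      by (subst sum.remove[of Q J]) (auto intro!: sum.neutral b_out)
    then have "g t = v J" using J(2) by (simp add: g_def b_def)
    then show ?thesis using v_le[OF J(1)] by simp
  next
    case False
    then have "bb t = 0" unfolding bb_def by (intro sum.neutral) (auto intro: b_out)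
    then have gf: "g t = f t" by (simp add: g_def)
    show ?thesis
    proof (cases "t < a")
      case True
      then show ?thesis using dyadic_stepD(2)[OF f True] gf \<alpha> by simp
    next
      case ta: False
      define J where "J = cell_at a k t"
      have tJ: "t \<in> cell a J" unfolding J_def using ta by (intro cell_at_mem) simp
      have "J \<notin> S"
      proof
        assume "J \<in> S"
        then have "t \<in> (\<Union>J\<in>maximal_cells S. cell a J)"
          using tJ UN_maximal_cells[of S "I / \<alpha>" a] bounded by blast
        then show False using False by (auto simp: Q_def)
      qed
      then have "emeasure N (cell a J) \<le> ennreal (\<alpha> * side J)" by (simp add: S_def J_def not_less)
      moreover have "emeasure N (cell a J) = ennreal (norm (f t)) * ennreal (side J)"
      proof -
        have "J = (k, snd J)" unfolding J_def by (simp add: prod_eq_iff)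
        then have "f s = f t" if "s \<in> cell a J" for s
          using dyadic_step_const[OF f, of s "snd J" t] tJ that by metis
        then have "emeasure N (cell a J) = (\<integral>\<^sup>+ s. ennreal (norm (f t)) * indicator (cell a J) s \<partial>lebesgue)"
          by (subst mass) (auto intro!: nn_integral_cong simp: indicator_def)
        then show ?thesis by (simp add: nn_integral_cmult_indicator)
      qed
      ultimately have "norm (f t) * side J \<le> \<alpha> * side J"
        using \<alpha> by (simp add: ennreal_mult[symmetric])
      then have "norm (f t) \<le> \<alpha>" by (rule mult_right_le_imp_le) simp
      then show ?thesis using gf \<alpha> by simp
    qed
  qed
  have sum_b: "(\<Sum>J\<in>Q. \<integral>\<^sup>+ t. ennreal (norm (b J t)) \<partial>lebesgue) \<le> ennreal (2 * I)"
  proof -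
    have "(\<Sum>J\<in>Q. \<integral>\<^sup>+ t. ennreal (norm (b J t)) \<partial>lebesgue) \<le> (\<Sum>J\<in>Q. 2 * emeasure N (cell a J))"
      by (intro sum_mono b_norm)
    also have "\<dots> \<le> 2 * ennreal I" unfolding sum_distrib_left[symmetric] by (intro mult_left_mono sum_mass) simp
    finally show ?thesis using I(2) by (simp add: ennreal_mult)
  qed
  show thesis
  proof (rule that[OF finQ _ b_out b_mean sum_side sum_b])
    show "\<exists>L. dyadic_step a k L (b J)" if "J \<in> Q" for J using bstep[OF that] by blast
    show "norm (f t - (\<Sum>J\<in>Q. b J t)) \<le> 2 * \<alpha>" for t using g_le[of t] by (simp add: g_def bb_def)
  qed
qed

lemma strongly_measurable_norm_indicator:
  assumes "strongly_measurable halfline F" "S \<in> sets lebesgue" "S \<subseteq> {0<..}"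
  shows "(\<lambda>t. ennreal (norm (F t)) * indicator S t) \<in> borel_measurable lebesgue"
proof -
  have "(\<lambda>t. norm (F t)) \<in> borel_measurable halfline"
    by (rule strongly_measurable_norm) (use assms in auto)
  then have "(\<lambda>t. ennreal (norm (F t))) \<in> borel_measurable halfline"
    by (rule measurable_compose[OF _ measurable_ennreal])
  then have "(\<lambda>t. ennreal (norm (F t)) * indicator {0<..} t) \<in> borel_measurable lebesgue"
    by (subst (asm) borel_measurable_restrict_space_iff_ennreal) auto
  then have "(\<lambda>t. ennreal (norm (F t)) * indicator {0<..} t * indicator S t) \<in> borel_measurable lebesgue"
    by (rule borel_measurable_times_ennreal) (rule borel_measurable_indicator[OF assms(2)])
  also have "(\<lambda>t. ennreal (norm (F t)) * indicator {0<..} t * indicator S t) = (\<lambda>t. ennreal (norm (F t)) * indicator S t)"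
    using assms(3) by (auto simp: fun_eq_iff indicator_def)
  finally show ?thesis .
qed

definition right_double :: "real \<Rightarrow> int \<times> nat \<Rightarrow> real set" where
  "right_double a J = {left a J ..< left a J + 2 * side J}"

lemma right_double_sets [simp]: "right_double a J \<in> sets lebesgue"
  by (simp add: right_double_def)

lemma emeasure_right_double: "emeasure lebesgue (right_double a J) = ennreal (2 * side J)"
  by (simp add: right_double_def)

context volterra_operator
begin

lemma left_pos: "0 < left a J"
  using a left_ge[of a J] by linarith

text \<open>
  To the left of the cell \<open>T b\<close> vanishes by causality. For \<open>t\<close> to the right of the doubled cell the
  mean value zero allows subtracting \<open>K t u\<close> from \<open>K t s\<close> under the integral, where \<open>u\<close> is the left
  end of the cell, and the regularity of the kernel in its second argument applies.
\<close>

lemma T_atom: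
  assumes b: "dyadic_step a k L b" and supp: "\<And>t. t \<notin> cell a J \<Longrightarrow> b t = 0"
    and mean: "Bochner_Integration.simple_bochner_integral lebesgue b = 0"
  shows "(\<integral>\<^sup>+ t. ennreal (norm (T b t)) * indicator ({0<..} - right_double a J) t \<partial>lebesgue)
     \<le> ennreal (M / \<sigma>) * (\<integral>\<^sup>+ t. ennreal (norm (b t)) \<partial>lebesgue)"
proof -
  let ?u = "left a J" and ?l = "side J"
  let ?b1 = "\<integral>\<^sup>+ t. ennreal (norm (b t)) \<partial>lebesgue"
  have adm: "admissible a b" by (rule admissible_step[OF b])
  have rep: "AE t in halfline. t \<notin> {?u..?u + ?l} \<longrightarrow>
      has_strong_integral (lebesgue_on {0<..<t}) (\<lambda>s. K t s (b s)) (T b t)"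
    by (rule T_kernel[OF adm _ left_pos]) (auto intro!: supp simp: cell_def)
  have zero: "AE t in halfline. t < ?u \<longrightarrow> T b t = 0"
    by (rule T_causal[OF adm _ left_pos]) (auto intro!: supp simp: cell_def)
  have far: "ennreal (norm (T b t)) \<le> ennreal (M * (?l powr \<sigma> / (t - ?u) powr (1 + \<sigma>))) * ?b1"
    if t: "?u + 2 * ?l \<le> t" and rep: "has_strong_integral (lebesgue_on {0<..<t}) (\<lambda>s. K t s (b s)) (T b t)" for t
  proof -
    let ?N = "lebesgue_on {0<..<t}"
    have ut: "?u + ?l < t" using t side_pos[of J] by linarith
    have res: "(\<lambda>s. indicator {0<..<t} s *\<^sub>R b s) = b"
    proof
      fix s show "indicator {0<..<t} s *\<^sub>R b s = b s"
      proof (cases "s \<in> cell a J")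
        case True
        then have "0 < s" "s < t" using ut left_pos[of J] unfolding cell_def by auto
        then show ?thesis by simp
      qed (simp add: supp)
    qed
    have bi: "Bochner_Integration.simple_bochner_integrable ?N b"
      using dyadic_step_integrable[OF b] by (subst simple_bochner_integrable_restrict_space) (auto simp: res)
    have b0: "Bochner_Integration.simple_bochner_integral ?N b = 0"
      using simple_bochner_integral_restrict_space[OF _ bi] mean by (simp add: res)
    have lin: "linear (blinfun_apply (K t ?u))" by (rule bounded_linear.linear) (rule blinfun.bounded_linear_right)
    have Kbi: "Bochner_Integration.simple_bochner_integrable ?N (\<lambda>s. K t ?u (b s))"
      by (rule simple_bochner_integrable_compose2[where p = "\<lambda>x y. K t ?u x", OF _ bi bi]) simp
    have "has_strong_integral ?N (\<lambda>s. K t ?u (b s)) 0"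
      using has_strong_integral_simple[OF Kbi] simple_bochner_integral_linear[OF lin bi] b0 by simp
    then have "has_strong_integral ?N (\<lambda>s. K t s (b s) - K t ?u (b s)) (T b t - 0)"
      by (intro has_strong_integral_diff rep) auto
    then have "ennreal (norm (T b t - 0)) \<le> (\<integral>\<^sup>+ s. ennreal (norm (K t s (b s) - K t ?u (b s))) \<partial>?N)"
      by (intro has_strong_integral_norm_bound) auto
    also have "\<dots> = (\<integral>\<^sup>+ s. ennreal (norm (K t s (b s) - K t ?u (b s))) * indicator {0<..<t} s \<partial>lebesgue)"
      by (subst nn_integral_restrict_space) auto
    also have "\<dots> \<le> (\<integral>\<^sup>+ s. ennreal (M * (?l powr \<sigma> / (t - ?u) powr (1 + \<sigma>))) * ennreal (norm (b s)) \<partial>lebesgue)"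
    proof (rule nn_integral_mono)
      fix s
      show "ennreal (norm (K t s (b s) - K t ?u (b s))) * indicator {0<..<t} s
        \<le> ennreal (M * (?l powr \<sigma> / (t - ?u) powr (1 + \<sigma>))) * ennreal (norm (b s))"
      proof (cases "s \<in> cell a J")
        case True
        then have s: "?u \<le> s" "s < ?u + ?l" "0 < s" using left_pos[of J] unfolding cell_def by auto
        have "norm (K t s (b s) - K t ?u (b s)) \<le> norm (K t s - K t ?u) * norm (b s)"
          by (metis blinfun.diff_left norm_blinfun)
        also have "\<dots> \<le> (M * \<bar>s - ?u\<bar> powr \<sigma> / (t - ?u) powr (1 + \<sigma>)) * norm (b s)"
        proof (rule mult_right_mono)
          show "norm (K t s - K t ?u) \<le> M * \<bar>s - ?u\<bar> powr \<sigma> / (t - ?u) powr (1 + \<sigma>)"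
            using kernel[unfolded volterra_kernel_def, THEN conjunct2, THEN conjunct1, rule_format, of s ?u t]
              s t ut left_pos[of J] side_pos[of J] by (simp add: abs_if)
        qed simp
        also have "\<dots> \<le> (M * ?l powr \<sigma> / (t - ?u) powr (1 + \<sigma>)) * norm (b s)"
          using s sigma M_nonneg
          by (intro mult_right_mono divide_right_mono mult_left_mono powr_mono2) auto
        finally show ?thesis using M_nonneg
          by (auto simp: ennreal_mult[symmetric] indicator_def intro!: ennreal_leI)
      qed (simp add: supp)
    qed
    also have "\<dots> = ennreal (M * (?l powr \<sigma> / (t - ?u) powr (1 + \<sigma>))) * ?b1"
      by (intro nn_integral_cmult admissible_ennreal_measurable[OF adm])
    finally show ?thesis by simp
  qed
  have "AE t in lebesgue. ennreal (norm (T b t)) * indicator ({0<..} - right_double a J) t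
     \<le> (ennreal M * ?b1) * (ennreal (?l powr \<sigma> / (t - ?u) powr (1 + \<sigma>)) * indicator {?u + 2 * ?l..} t)"
    using rep zero unfolding AE_halfline
  proof eventually_elim
    case (elim t)
    show ?case
    proof (cases "t \<in> {0<..} - right_double a J")
      case True
      then consider "0 < t" "t < ?u" | "0 < t" "?u + 2 * ?l \<le> t" unfolding right_double_def by force
      then show ?thesis
      proof cases
        case 1
        then show ?thesis using elim(2) by simp
      next
        case 2
        have "?u + ?l < t" using 2 side_pos[of J] by linarith
        then have "t \<notin> {?u..?u + ?l}" by simp
        then have "ennreal (norm (T b t)) \<le> ennreal (M * (?l powr \<sigma> / (t - ?u) powr (1 + \<sigma>))) * ?b1"
          using far[of t] 2 elim(1) by blast
        also have "ennreal (M * (?l powr \<sigma> / (t - ?u) powr (1 + \<sigma>)))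
            = ennreal M * ennreal (?l powr \<sigma> / (t - ?u) powr (1 + \<sigma>))"
          using M_nonneg by (rule ennreal_mult) simp
        finally show ?thesis using True 2 by (simp add: mult_ac)
      qed
    qed simp
  qed
  then have "(\<integral>\<^sup>+ t. ennreal (norm (T b t)) * indicator ({0<..} - right_double a J) t \<partial>lebesgue)
     \<le> (\<integral>\<^sup>+ t. (ennreal M * ?b1) * (ennreal (?l powr \<sigma> / (t - ?u) powr (1 + \<sigma>)) * indicator {?u + 2 * ?l..} t) \<partial>lebesgue)"
    by (rule nn_integral_mono_AE)
  also have "\<dots> = (ennreal M * ?b1) * (\<integral>\<^sup>+ t. ennreal (?l powr \<sigma> / (t - ?u) powr (1 + \<sigma>)) * indicator {?u + 2 * ?l..} t \<partial>lebesgue)"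
    by (rule nn_integral_cmult, rule measurable_completion) measurable
  also have "\<dots> \<le> (ennreal M * ?b1) * ennreal (1 / \<sigma>)"
    by (intro mult_left_mono nn_integral_power_tail sigma) auto
  also have "\<dots> = ennreal (M / \<sigma>) * ?b1"
    using M_nonneg sigma by (simp add: divide_inverse ennreal_mult mult_ac)
  finally show ?thesis .
qed

text \<open>
  The height \<open>\<alpha>\<close> is kept as a free parameter: the choice made in \<open>weak_type\<close> is \<open>l / (4 D)\<close> with
  \<open>D \<ge> max B M\<close>, which is meaningful only for \<open>D > 0\<close>. The three contributions are the level set of
  \<open>T g\<close>, the union of the doubled cells, and the level set of the image of the atoms off this union.
\<close>

lemma weak_type_step:
  assumes f: "dyadic_step a k L f" and \<alpha>: "0 < \<alpha>" "4 * B * \<alpha> \<le> l" and l: "0 < l"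
    and I: "(\<integral>\<^sup>+ t. ennreal (norm (f t)) \<partial>lebesgue) \<le> ennreal I" "0 < I"
  shows "emeasure lebesgue (super_level (T f) l) \<le> ennreal (4 * I / \<alpha> + 4 * (M / \<sigma>) * I / l)"
proof -
  have adm: "admissible a f" by (rule admissible_step[OF f])
  obtain Q b where finQ: "finite Q" and bstep: "\<And>J. J \<in> Q \<Longrightarrow> \<exists>L. dyadic_step a k L (b J)"
    and b_out: "\<And>J t. t \<notin> cell a J \<Longrightarrow> b J t = 0"
    and b_mean: "\<And>J. J \<in> Q \<Longrightarrow> Bochner_Integration.simple_bochner_integral lebesgue (b J) = 0"
    and sum_side: "(\<Sum>J\<in>Q. side J) \<le> I / \<alpha>"
    and sum_b: "(\<Sum>J\<in>Q. \<integral>\<^sup>+ t. ennreal (norm (b J t)) \<partial>lebesgue) \<le> ennreal (2 * I)"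
    and bounded: "\<And>t. norm (f t - (\<Sum>J\<in>Q. b J t)) \<le> 2 * \<alpha>"
    using calderon_zygmund_decomposition[OF f \<alpha>(1) I] by blast
  define bb where "bb = (\<lambda>t. \<Sum>J\<in>Q. b J t)"
  define g where "g = (\<lambda>t. f t - bb t)"
  have b_adm: "admissible a (b J)" if "J \<in> Q" for J using bstep[OF that] admissible_step by blast
  have bb_adm: "admissible a bb" unfolding bb_def by (rule admissible_sum[OF finQ b_adm])
  have g_adm: "admissible a g" unfolding g_def by (rule admissible_diff[OF adm bb_adm])
  have g_le: "norm (g t) \<le> 2 * \<alpha>" for t using bounded[of t] by (simp add: g_def bb_def)
  \<comment> \<open>In fact \<open>I\<close> would do; the triangle inequality is cheaper than integrating cell by cell.\<close>
  have "(\<integral>\<^sup>+ t. ennreal (norm (g t)) \<partial>lebesgue) \<le> ennreal (3 * I)"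
  proof -
    have "(\<integral>\<^sup>+ t. ennreal (norm (g t)) \<partial>lebesgue)
       \<le> (\<integral>\<^sup>+ t. ennreal (norm (f t)) + (\<Sum>J\<in>Q. ennreal (norm (b J t))) \<partial>lebesgue)"
    proof (intro nn_integral_mono)
      fix t
      have "norm (g t) \<le> norm (f t) + (\<Sum>J\<in>Q. norm (b J t))"
        using norm_triangle_ineq4[of "f t" "bb t"] norm_sum[of "\<lambda>J. b J t" Q] by (simp add: g_def bb_def)
      then show "ennreal (norm (g t)) \<le> ennreal (norm (f t)) + (\<Sum>J\<in>Q. ennreal (norm (b J t)))"
        by (simp add: ennreal_plus[symmetric] sum_nonneg del: ennreal_plus)
    qed
    also have "\<dots> = (\<integral>\<^sup>+ t. ennreal (norm (f t)) \<partial>lebesgue) + (\<Sum>J\<in>Q. \<integral>\<^sup>+ t. ennreal (norm (b J t)) \<partial>lebesgue)"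
    proof -
      have "(\<lambda>t. \<Sum>J\<in>Q. ennreal (norm (b J t))) \<in> borel_measurable lebesgue"
        by (rule borel_measurable_sum) (rule admissible_ennreal_measurable[OF b_adm])
      moreover have "(\<integral>\<^sup>+ t. (\<Sum>J\<in>Q. ennreal (norm (b J t))) \<partial>lebesgue)
          = (\<Sum>J\<in>Q. \<integral>\<^sup>+ t. ennreal (norm (b J t)) \<partial>lebesgue)"
        by (rule nn_integral_sum) (rule admissible_ennreal_measurable[OF b_adm])
      ultimately show ?thesis by (subst nn_integral_add[OF admissible_ennreal_measurable[OF adm]]) auto
    qed
    also have "\<dots> \<le> ennreal I + ennreal (2 * I)" by (intro add_mono I sum_b)
    finally show ?thesis using I(2) by (simp add: ennreal_plus[symmetric] del: ennreal_plus)
  qed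
  then have g_level: "emeasure lebesgue (super_level (T g) (l / 2)) \<le> ennreal (3 * I / (2 * \<alpha>))"
    using \<alpha> l I(2) by (intro T_super_level[OF g_adm g_le]) auto
  define D where "D = (\<Union>J\<in>Q. right_double a J)"
  have D: "D \<in> sets lebesgue" unfolding D_def using finQ by (intro sets.finite_UN) auto
  have D_le: "emeasure lebesgue D \<le> ennreal (2 * I / \<alpha>)"
  proof -
    have "emeasure lebesgue D \<le> (\<Sum>J\<in>Q. emeasure lebesgue (right_double a J))"
      unfolding D_def using finQ by (intro emeasure_subadditive_finite) auto
    also have "\<dots> = ennreal (2 * (\<Sum>J\<in>Q. side J))" by (simp add: emeasure_right_double sum_distrib_left)
    also have "\<dots> \<le> ennreal (2 * I / \<alpha>)" using sum_side by (intro ennreal_leI) simp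
    finally show ?thesis .
  qed
  have Tbb: "AE t in halfline. T bb t = (\<Sum>J\<in>Q. T (b J) t)"
    unfolding bb_def by (rule T_sum[OF finQ b_adm])
  define E where "E = super_level (T bb) (l / 2) - D"
  have E: "E \<in> sets lebesgue" unfolding E_def by (intro sets.Diff D super_level_sets T_strongly_measurable bb_adm)
  have Tb_meas: "(\<lambda>t. ennreal (norm (T (b J) t)) * indicator ({0<..} - right_double a J) t) \<in> borel_measurable lebesgue"
    if "J \<in> Q" for J
    by (intro strongly_measurable_norm_indicator T_strongly_measurable b_adm that) auto
  have "ennreal (l / 2) * emeasure lebesgue E = (\<integral>\<^sup>+ t. ennreal (l / 2) * indicator E t \<partial>lebesgue)"
    by (rule nn_integral_cmult_indicator[OF E, symmetric])
  also have "\<dots> \<le> (\<integral>\<^sup>+ t. (\<Sum>J\<in>Q. ennreal (norm (T (b J) t)) * indicator ({0<..} - right_double a J) t) \<partial>lebesgue)"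
  proof (rule nn_integral_mono_AE)
    show "AE t in lebesgue. ennreal (l / 2) * indicator E t
        \<le> (\<Sum>J\<in>Q. ennreal (norm (T (b J) t)) * indicator ({0<..} - right_double a J) t)"
      using Tbb unfolding AE_halfline
    proof eventually_elim
      case (elim t)
      show ?case
      proof (cases "t \<in> E")
        case True
        then have t: "0 < t" "l / 2 < norm (T bb t)" "\<And>J. J \<in> Q \<Longrightarrow> t \<notin> right_double a J"
          by (auto simp: E_def super_level_def D_def)
        have "norm (T bb t) \<le> (\<Sum>J\<in>Q. norm (T (b J) t))"
          using elim t(1) norm_sum[of "\<lambda>J. T (b J) t" Q] by simp
        then have "l / 2 \<le> (\<Sum>J\<in>Q. norm (T (b J) t))" using t(2) by linarith
        then have "ennreal (l / 2) \<le> (\<Sum>J\<in>Q. ennreal (norm (T (b J) t)))"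
          using ennreal_leI by force
        also have "\<dots> = (\<Sum>J\<in>Q. ennreal (norm (T (b J) t)) * indicator ({0<..} - right_double a J) t)"
          using t by (intro sum.cong) auto
        finally show ?thesis using True by simp
      qed simp
    qed
  qed
  also have "\<dots> = (\<Sum>J\<in>Q. \<integral>\<^sup>+ t. ennreal (norm (T (b J) t)) * indicator ({0<..} - right_double a J) t \<partial>lebesgue)"
    by (rule nn_integral_sum[OF Tb_meas])
  also have "\<dots> \<le> (\<Sum>J\<in>Q. ennreal (M / \<sigma>) * (\<integral>\<^sup>+ t. ennreal (norm (b J t)) \<partial>lebesgue))"
  proof (rule sum_mono)
    fix J assume J: "J \<in> Q"
    then obtain L' where "dyadic_step a k L' (b J)" using bstep by blast
    then show "(\<integral>\<^sup>+ t. ennreal (norm (T (b J) t)) * indicator ({0<..} - right_double a J) t \<partial>lebesgue)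
        \<le> ennreal (M / \<sigma>) * (\<integral>\<^sup>+ t. ennreal (norm (b J t)) \<partial>lebesgue)"
      by (rule T_atom[OF _ b_out b_mean[OF J]])
  qed
  also have "\<dots> \<le> ennreal (M / \<sigma>) * ennreal (2 * I)"
    unfolding sum_distrib_left[symmetric] by (intro mult_left_mono sum_b) simp
  finally have "ennreal (2 / l) * (ennreal (l / 2) * emeasure lebesgue E) \<le> ennreal (2 / l) * (ennreal (M / \<sigma>) * ennreal (2 * I))"
    by (rule mult_left_mono) simp
  then have E_le: "emeasure lebesgue E \<le> ennreal (4 * (M / \<sigma>) * I / l)"
    using l M_nonneg sigma I(2) by (simp add: mult.assoc[symmetric] ennreal_mult[symmetric]) (simp add: mult_ac)
  have "emeasure lebesgue (super_level (T bb) (l / 2)) \<le> emeasure lebesgue (D \<union> E)"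
    by (intro emeasure_mono sets.Un D E) (auto simp: E_def)
  also have "\<dots> \<le> emeasure lebesgue D + emeasure lebesgue E" by (intro emeasure_subadditive D E)
  also have "\<dots> \<le> ennreal (2 * I / \<alpha>) + ennreal (4 * (M / \<sigma>) * I / l)" by (intro add_mono D_le E_le)
  finally have bb_level: "emeasure lebesgue (super_level (T bb) (l / 2))
      \<le> ennreal (2 * I / \<alpha>) + ennreal (4 * (M / \<sigma>) * I / l)" .
  have fgb: "(\<lambda>s. g s + bb s) = f" by (simp add: g_def)
  have "AE t in halfline. T f t = T g t + T bb t" using T_add[OF g_adm bb_adm] unfolding fgb .
  then have "emeasure lebesgue (super_level (T f) (l / 2 + l / 2))
     \<le> emeasure lebesgue (super_level (T g) (l / 2)) + emeasure lebesgue (super_level (T bb) (l / 2))"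
    by (intro super_level_add T_strongly_measurable g_adm bb_adm)
  also have "\<dots> \<le> ennreal (3 * I / (2 * \<alpha>)) + (ennreal (2 * I / \<alpha>) + ennreal (4 * (M / \<sigma>) * I / l))"
    by (intro add_mono g_level bb_level)
  also have "\<dots> = ennreal (3 * I / (2 * \<alpha>) + (2 * I / \<alpha> + 4 * (M / \<sigma>) * I / l))"
    using \<alpha> l I M_nonneg sigma by (simp add: ennreal_plus[symmetric] del: ennreal_plus)
  also have "\<dots> \<le> ennreal (4 * I / \<alpha> + 4 * (M / \<sigma>) * I / l)"
    using \<alpha> I by (intro ennreal_leI) (simp add: field_simps)
  finally show ?thesis by simp
qed

end

section \<open>The weak type inequality and mean oscillation\<close>

text \<open>
  The integrals representing \<open>T f t\<close> and \<open>T f t'\<close> are taken over different intervals \<open>(0, t)\<close> and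
  \<open>(0, t')\<close>. To subtract them, both are extended by zero to the line.
\<close>

lemma has_strong_integral_extend:
  fixes h :: "real \<Rightarrow> 'b::real_normed_vector"
  assumes S: "S \<in> sets lebesgue" and h: "has_strong_integral (lebesgue_on S) h x"
    and zero: "\<And>t. t \<notin> S \<Longrightarrow> h t = 0"
  shows "has_strong_integral lebesgue h x"
proof -
  obtain u where u: "\<And>i::nat. simple_function (lebesgue_on S) (u i)" "AE t in lebesgue_on S. (\<lambda>i. u i t) \<longlonglongrightarrow> h t"
    using h by (auto simp: has_strong_integral_def strongly_measurable_def)
  have "strongly_measurable lebesgue h" unfolding strongly_measurable_def
  proof (intro exI[of _ "\<lambda>i t. indicator S t *\<^sub>R u i t"] conjI allI)
    show "simple_function lebesgue (\<lambda>t. indicator S t *\<^sub>R u i t)" for i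
      using u(1)[of i] S by (subst (asm) simple_function_restrict_space) auto
    have "AE t in lebesgue. t \<in> S \<longrightarrow> (\<lambda>i. u i t) \<longlonglongrightarrow> h t"
      using u(2) S by (subst (asm) AE_restrict_space_iff) auto
    then show "AE t in lebesgue. (\<lambda>i. indicator S t *\<^sub>R u i t) \<longlonglongrightarrow> h t"
    proof eventually_elim
      case (elim t)
      then show ?case using zero[of t] by (cases "t \<in> S") auto
    qed
  qed
  moreover obtain s where s: "\<And>i::nat. Bochner_Integration.simple_bochner_integrable (lebesgue_on S) (s i)"
        "(\<lambda>i. \<integral>\<^sup>+ t. ennreal (norm (h t - s i t)) \<partial>lebesgue_on S) \<longlonglongrightarrow> 0"
        "(\<lambda>i. Bochner_Integration.simple_bochner_integral (lebesgue_on S) (s i)) \<longlonglongrightarrow> x"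
    using h by (auto simp: has_strong_integral_def)
  have S': "S \<inter> space lebesgue \<in> sets lebesgue" using S by simp
  have "(\<integral>\<^sup>+ t. ennreal (norm (h t - indicator S t *\<^sub>R s i t)) \<partial>lebesgue)
     = (\<integral>\<^sup>+ t. ennreal (norm (h t - s i t)) \<partial>lebesgue_on S)" for i
    unfolding nn_integral_restrict_space[OF S']
  proof (rule nn_integral_cong)
    fix t show "ennreal (norm (h t - indicator S t *\<^sub>R s i t)) = ennreal (norm (h t - s i t)) * indicator S t"
      using zero[of t] by (cases "t \<in> S") auto
  qed
  moreover have "Bochner_Integration.simple_bochner_integrable lebesgue (\<lambda>t. indicator S t *\<^sub>R s i t)" for i
    using s(1)[of i] simple_bochner_integrable_restrict_space[OF S'] by blast
  moreover have "Bochner_Integration.simple_bochner_integral lebesgue (\<lambda>t. indicator S t *\<^sub>R s i t)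
     = Bochner_Integration.simple_bochner_integral (lebesgue_on S) (s i)" for i
    using simple_bochner_integral_restrict_space[OF S' s(1)[of i]] by simp
  ultimately show ?thesis using s(2,3) unfolding has_strong_integral_def
    by (intro conjI exI[of _ "\<lambda>i t. indicator S t *\<^sub>R s i t"]) simp_all
qed

lemma one_plus_half_le_powr:
  fixes x :: real assumes "0 \<le> x" shows "1 + x / 2 \<le> 2 powr x"
proof -
  have "1 + x * ln 2 \<le> exp (x * ln 2)" by (rule exp_ge_add_one_self)
  moreover have "x * (1 / 2) \<le> x * ln 2" using assms ln2_ge_two_thirds by (intro mult_left_mono) auto
  ultimately have "1 + x / 2 \<le> exp (x * ln 2)" by linarith
  then show ?thesis by (simp add: powr_def)
qed

text \<open>
  The sum of the geometric series of ratio \<open>2\<close> to the power \<open>-x\<close> grows only like \<open>1 / x\<close> as \<open>x\<close> tends to \<open>0\<close>.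
  It enters with \<open>x = \<sigma>\<close> through the decay of the kernel and with \<open>x = p - 1\<close> through the maximal
  function.
\<close>

lemma inverse_one_minus_powr_le:
  fixes x :: real
  assumes "0 < x"
  shows "2 powr (- x) < 1" "1 / (1 - 2 powr (- x)) \<le> 1 + 2 / x"
proof -
  have p: "1 + x / 2 \<le> 2 powr x" using assms by (intro one_plus_half_le_powr) simp
  then have p1: "1 < 2 powr x" using assms by linarith
  show "2 powr (- x) < 1" using p1 by (simp add: powr_minus field_simps)
  have "1 / (1 - 2 powr (- x)) = 1 + 1 / (2 powr x - 1)"
  proof -
    have "1 / (1 - 2 powr (- x)) = 2 powr x / (2 powr x - 1)" using p1 by (simp add: powr_minus field_simps)
    also have "\<dots> = (1 + (2 powr x - 1)) / (2 powr x - 1)" by simp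
    also have "\<dots> = 1 + 1 / (2 powr x - 1)" using p1 assms by (subst add_divide_distrib) simp
    finally show ?thesis .
  qed
  also have "1 / (2 powr x - 1) \<le> 1 / (x / 2)"
    using p assms by (intro divide_left_mono) auto
  finally show "1 / (1 - 2 powr (- x)) \<le> 1 + 2 / x" by simp
qed

lemma suminf_geometric_powr:
  assumes "0 < x"
  shows "(\<Sum>j. ennreal ((2 powr (- x)) ^ j)) = ennreal (1 / (1 - 2 powr (- x)))"
proof (rule suminf_ennreal_eq)
  show "(\<lambda>j. (2 powr (- x)) ^ j) sums (1 / (1 - 2 powr (- x)))"
    using inverse_one_minus_powr_le(1)[OF assms] by (intro geometric_sums) simp
qed simp

text \<open>
  The cell together with its two left neighbours. Points \<open>s\<close> further to the left have distance more
  than \<open>2 side J\<close> from the cell, as the regularity of the kernel requires; points to the right of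
  the cell have no influence on the values of \<open>T f\<close> there.
\<close>

definition left_triple :: "real \<Rightarrow> int \<times> nat \<Rightarrow> real set" where
  "left_triple a J = {left a J - 2 * side J ..< left a J + side J}"

lemma left_triple_sets [simp]: "left_triple a J \<in> sets lebesgue"
  by (simp add: left_triple_def)

lemma cell_subset_left_triple: "cell a J \<subseteq> left_triple a J"
  unfolding cell_def left_triple_def using side_pos[of J] by (simp add: subset_eq)

lemma grid_threshold:
  assumes "s \<in> cell a J" "t \<in> cell a J" "s < a + real_of_int i * side J"
  shows "t < a + real_of_int i * side J"
proof -
  have "left a J \<le> s" using assms(1) by (simp add: cell_def)
  then have "real (snd J) * side J < real_of_int i * side J"
    using assms(3) unfolding left_def by linarith
  then have "real (snd J) < real_of_int i" by simp
  then have "real_of_int (int (snd J)) < real_of_int i" by simp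
  then have "int (snd J) + 1 \<le> i" by simp
  then have "real_of_int (int (snd J) + 1) \<le> real_of_int i" by (simp only: of_int_le_iff)
  then have "real (snd J) + 1 \<le> real_of_int i" by simp
  then have "(real (snd J) + 1) * side J \<le> real_of_int i * side J" by (rule mult_right_mono) simp
  moreover have "t < a + (real (snd J) + 1) * side J"
    using assms(2) by (simp add: cell_def left_def algebra_simps)
  ultimately show ?thesis by linarith
qed

lemma admissible_below:
  assumes "admissible a f"
  shows "admissible a (\<lambda>t. indicator {..< a + real_of_int i * 2 powi k} t *\<^sub>R f t)"
proof (rule admissible_indicator[OF assms, of k])
  fix m s t assume "s \<in> cell a (k, m)" "t \<in> cell a (k, m)" "s \<in> {..< a + real_of_int i * 2 powi k}"
  then show "t \<in> {..< a + real_of_int i * 2 powi k}"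
    using grid_threshold[of s a "(k, m)" t i] by (simp add: side_def)
qed

context volterra_operator
begin

text \<open>
  Split \<open>f = g + (f - g)\<close> with a step function \<open>g\<close>. Since \<open>f - g\<close> is uniformly small on a bounded
  support, \<open>T_super_level\<close> bounds the level set of its image.
\<close>

lemma weak_type:
  assumes f: "admissible a f" and D: "0 < D" "B \<le> D" "M \<le> D" and l: "0 < l"
    and I: "(\<integral>\<^sup>+ t. ennreal (norm (f t)) \<partial>lebesgue) \<le> ennreal I" "0 < I"
  shows "emeasure lebesgue (super_level (T f) l) \<le> ennreal (100 * D * I / (\<sigma> * l))"
proof -
  have step: "emeasure lebesgue (super_level (T g) l) \<le> ennreal (20 * D * I / (\<sigma> * l))"
    if g: "dyadic_step a k L g" and l: "0 < l"
      and I: "(\<integral>\<^sup>+ t. ennreal (norm (g t)) \<partial>lebesgue) \<le> ennreal I" "0 < I" for g k L l I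
  proof -
    have "B * l \<le> D * l" using D l by (intro mult_right_mono) auto
    then have "emeasure lebesgue (super_level (T g) l)
        \<le> ennreal (4 * I / (l / (4 * D)) + 4 * (M / \<sigma>) * I / l)"
      using D l by (intro weak_type_step[OF g _ _ l I]) (auto simp: field_simps)
    also have "\<dots> \<le> ennreal (20 * D * I / (\<sigma> * l))"
    proof (rule ennreal_leI)
      have "16 * D * I / l \<le> 16 * D * I / l / \<sigma>"
        using sigma D l I by (simp add: field_simps mult_left_le)
      moreover have "4 * (M / \<sigma>) * I / l \<le> 4 * (D / \<sigma>) * I / l"
        using D sigma l I by (intro divide_right_mono mult_right_mono mult_left_mono) auto
      moreover have "20 * D * I / (\<sigma> * l) = 16 * D * I / l / \<sigma> + 4 * (D / \<sigma>) * I / l"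
        using sigma l by (simp add: field_simps)
      moreover have "4 * I / (l / (4 * D)) = 16 * D * I / l" by simp
      ultimately show "4 * I / (l / (4 * D)) + 4 * (M / \<sigma>) * I / l \<le> 20 * D * I / (\<sigma> * l)"
        by linarith
    qed
    finally show ?thesis .
  qed
  obtain L where L: "\<And>t. t < a \<or> L \<le> t \<Longrightarrow> f t = 0" "a < L"
      "\<And>e. e > 0 \<Longrightarrow> \<exists>k g. dyadic_step a k L g \<and> (\<forall>t. norm (f t - g t) \<le> e)"
    using admissible_support[OF f] by metis
  \<comment> \<open>\<open>h\<close> is the largest height admitted by \<open>T_super_level\<close> at level \<open>l / 2\<close>.\<close>
  define h where "h = l / (2 * D)"
  have h: "0 < h" using l D by (simp add: h_def)
  define e where "e = min h (I / (L - a))"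
  have e: "0 < e" "e \<le> h" "e * (L - a) \<le> I"
  proof -
    show "0 < e" "e \<le> h" using h I L(2) by (auto simp: e_def)
    have "e * (L - a) \<le> I / (L - a) * (L - a)" using L(2) by (intro mult_right_mono) (auto simp: e_def)
    then show "e * (L - a) \<le> I" using L(2) by simp
  qed
  obtain k g where g: "dyadic_step a k L g" "\<And>t. norm (f t - g t) \<le> e" using L(3)[OF e(1)] by blast
  have gadm: "admissible a g" by (rule admissible_step[OF g(1)])
  have dadm: "admissible a (\<lambda>t. f t - g t)" by (rule admissible_diff[OF f gadm])
  have "(\<integral>\<^sup>+ t. ennreal (norm (f t - g t)) \<partial>lebesgue) \<le> (\<integral>\<^sup>+ t. ennreal e * indicator {a..L} t \<partial>lebesgue)"
  proof (rule nn_integral_mono)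
    fix t show "ennreal (norm (f t - g t)) \<le> ennreal e * indicator {a..L} t"
    proof (cases "t \<in> {a..L}")
      case True then show ?thesis using g(2)[of t] by (simp add: ennreal_leI)
    next
      case False
      then have "f t = 0" "g t = 0" using L(1)[of t] dyadic_stepD(2,3)[OF g(1), of t] by auto
      then show ?thesis by simp
    qed
  qed
  also have "\<dots> = ennreal (e * (L - a))"
    using L(2) e(1) by (simp add: nn_integral_cmult_indicator ennreal_mult)
  also have "\<dots> \<le> ennreal I" by (rule ennreal_leI[OF e(3)])
  finally have d_int: "(\<integral>\<^sup>+ t. ennreal (norm (f t - g t)) \<partial>lebesgue) \<le> ennreal I" .
  have "(\<integral>\<^sup>+ t. ennreal (norm (g t)) \<partial>lebesgue)
      \<le> (\<integral>\<^sup>+ t. ennreal (norm (f t)) + ennreal (norm (f t - g t)) \<partial>lebesgue)"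
  proof (rule nn_integral_mono)
    fix t have "norm (g t) \<le> norm (f t) + norm (f t - g t)"
      by (metis norm_minus_commute norm_triangle_sub)
    then show "ennreal (norm (g t)) \<le> ennreal (norm (f t)) + ennreal (norm (f t - g t))"
      by (simp add: ennreal_plus[symmetric] del: ennreal_plus)
  qed
  also have "\<dots> = (\<integral>\<^sup>+ t. ennreal (norm (f t)) \<partial>lebesgue) + (\<integral>\<^sup>+ t. ennreal (norm (f t - g t)) \<partial>lebesgue)"
    by (rule nn_integral_add[OF admissible_ennreal_measurable[OF f] admissible_ennreal_measurable[OF dadm]])
  also have "\<dots> \<le> ennreal I + ennreal I" by (intro add_mono I d_int)
  finally have g_int: "(\<integral>\<^sup>+ t. ennreal (norm (g t)) \<partial>lebesgue) \<le> ennreal (2 * I)"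
    using I(2) by (simp add: ennreal_plus[symmetric] del: ennreal_plus)
  have fg: "(\<lambda>s. g s + (f s - g s)) = f" by simp
  have "AE t in halfline. T f t = T g t + T (\<lambda>s. f s - g s) t" using T_add[OF gadm dadm] unfolding fg .
  then have "emeasure lebesgue (super_level (T f) (l / 2 + l / 2))
     \<le> emeasure lebesgue (super_level (T g) (l / 2)) + emeasure lebesgue (super_level (T (\<lambda>s. f s - g s)) (l / 2))"
    by (intro super_level_add T_strongly_measurable gadm dadm)
  also have "\<dots> \<le> ennreal (20 * D * (2 * I) / (\<sigma> * (l / 2))) + ennreal (I / h)"
  proof (rule add_mono)
    show "emeasure lebesgue (super_level (T g) (l / 2)) \<le> ennreal (20 * D * (2 * I) / (\<sigma> * (l / 2)))"
      by (rule step[OF g(1) _ g_int]) (use l I in auto)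
    have "B * h \<le> D * h" using D h by (intro mult_right_mono) auto
    then have Bh: "B * h \<le> l / 2" using D by (simp add: h_def)
    show "emeasure lebesgue (super_level (T (\<lambda>s. f s - g s)) (l / 2)) \<le> ennreal (I / h)"
      by (rule T_super_level[OF dadm _ h Bh _ d_int I(2)]) (use l e(2) g(2) order_trans in auto)
  qed
  also have "\<dots> = ennreal (80 * D * I / (\<sigma> * l) + 2 * D * I / l)"
    using D l I sigma h by (subst ennreal_plus[symmetric]) (auto simp: h_def field_simps)
  also have "\<dots> \<le> ennreal (100 * D * I / (\<sigma> * l))"
  proof (rule ennreal_leI)
    have "2 * D * I / l \<le> 2 * D * I / l / \<sigma>" using sigma D l I by (simp add: field_simps mult_left_le)
    also have "\<dots> \<le> 20 * D * I / (\<sigma> * l)" using sigma D l I by (simp add: field_simps)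
    finally have "2 * D * I / l \<le> 20 * (D * I / (\<sigma> * l))" by simp
    moreover have "80 * D * I / (\<sigma> * l) = 80 * (D * I / (\<sigma> * l))"
      "100 * D * I / (\<sigma> * l) = 100 * (D * I / (\<sigma> * l))" by simp_all
    ultimately show "80 * D * I / (\<sigma> * l) + 2 * D * I / l \<le> 100 * D * I / (\<sigma> * l)"
      by linarith
  qed
  finally show ?thesis by simp
qed

text \<open>
  The constant is the value \<open>T f t0\<close> at a point of the cell where the kernel representation holds.
  Arrange the points \<open>s\<close> by the first ancestor of \<open>J\<close> whose triple contains them. If it is the one
  of generation \<open>j + 1\<close>, then \<open>s\<close> has distance at least \<open>2\<^sup>j side J\<close> from \<open>t0\<close>, so that the kernel
  changes by at most \<open>M (2\<^sup>j)\<^sup>-\<^sup>\<sigma> / (2\<^sup>j side J)\<close>. The triple has length \<open>6 (2\<^sup>j side J)\<close> and the mean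
  of \<open>|f|\<close> over it is at most \<open>m\<close>, so the contributions form a convergent geometric series in \<open>j\<close>.
\<close>

lemma T_oscillation_far:
  assumes f: "admissible a f" and supp: "\<And>t. left a J - 2 * side J \<le> t \<Longrightarrow> f t = 0"
    and m: "0 < m"
    and avg: "\<And>j. (\<integral>\<^sup>+ t. ennreal (norm (f t)) * indicator (left_triple a (ancestor j J)) t \<partial>lebesgue)
        \<le> ennreal (3 * side (ancestor j J) * m)"
  shows "\<exists>c. AE t in halfline. t \<in> cell a J \<longrightarrow> norm (T f t - c) \<le> 18 * M * m / \<sigma>"
proof -
  let ?u = "left a J" and ?l = "side J"
  define P where "P t \<longleftrightarrow> has_strong_integral lebesgue (\<lambda>s. K t s (f s)) (T f t)" for t
  have below: "f t = 0" if "t < a" for t using admissible_support[OF f] that by metis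
  have "AE t in halfline. t \<notin> {a..?u - 2 * ?l} \<longrightarrow> has_strong_integral (lebesgue_on {0<..<t}) (\<lambda>s. K t s (f s)) (T f t)"
    by (rule T_kernel[OF f _ a]) (use below supp in \<open>auto simp: not_le\<close>)
  then have P: "AE t in lebesgue. t \<in> cell a J \<longrightarrow> P t"
    unfolding AE_halfline
  proof eventually_elim
    case (elim t)
    show ?case
    proof
      assume t: "t \<in> cell a J"
      then have "0 < t" "?u \<le> t" using cell_ge[OF t] a by (simp_all add: cell_def)
      then have "?u - 2 * ?l < t" using side_pos[of J] by linarith
      then have "has_strong_integral (lebesgue_on {0<..<t}) (\<lambda>s. K t s (f s)) (T f t)"
        using elim \<open>0 < t\<close> by auto
      then show "P t" unfolding P_def
      proof (rule has_strong_integral_extend[rotated])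
        fix s assume "s \<notin> {0<..<t}"
        then have "s < a \<or> ?u - 2 * ?l \<le> s" using a \<open>?u - 2 * ?l < t\<close> by force
        then show "K t s (f s) = 0" using below supp by auto
      qed simp
    qed
  qed
  obtain t0 where t0: "t0 \<in> cell a J" "P t0"
  proof (rule ccontr)
    assume n: "\<not> thesis"
    have "AE t in lebesgue. \<not> t \<in> cell a J" using P by (rule eventually_mono) (use n that in blast)
    then have "emeasure lebesgue {t \<in> space lebesgue. t \<in> cell a J} = 0" by (rule emeasure_eq_0_AE)
    then show False by simp
  qed
  have far: "norm (T f t - T f t0) \<le> 18 * M * m / \<sigma>" if t: "t \<in> cell a J" "P t" for t
  proof -
    have tt: "0 < t" "0 < t0" using cell_ge[OF t(1)] cell_ge[OF t0(1)] a by simp_all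
    have near: "\<bar>t - t0\<bar> \<le> ?l" using t(1) t0(1) unfolding cell_def by auto
    define w where "w j = ?l powr \<sigma> / (2 ^ j * ?l) powr (1 + \<sigma>)" for j :: nat
    have "has_strong_integral (lebesgue_on UNIV) (\<lambda>s. K t s (f s) - K t0 s (f s)) (T f t - T f t0)"
      by (rule has_strong_integral_diff)
        (use t(2) t0(2) in \<open>auto simp: P_def lebesgue_on_UNIV_eq\<close>)
    then have "ennreal (norm (T f t - T f t0)) \<le> (\<integral>\<^sup>+ s. ennreal (norm (K t s (f s) - K t0 s (f s))) \<partial>lebesgue_on UNIV)"
      by (rule has_strong_integral_norm_bound[rotated]) simp
    also have "\<dots> \<le> (\<integral>\<^sup>+ s. (\<Sum>j. ennreal (M * w j) * (ennreal (norm (f s)) * indicator (left_triple a (ancestor (Suc j) J)) s)) \<partial>lebesgue)"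
      unfolding lebesgue_on_UNIV_eq
    proof (rule nn_integral_mono)
      fix s
      show "ennreal (norm (K t s (f s) - K t0 s (f s)))
        \<le> (\<Sum>j. ennreal (M * w j) * (ennreal (norm (f s)) * indicator (left_triple a (ancestor (Suc j) J)) s))"
      proof (cases "f s = 0")
        case False
        then have s: "a \<le> s" "s < ?u - 2 * ?l" using below supp by (meson not_le)+
        define i where "i = (LEAST i. s \<in> left_triple a (ancestor i J))"
        have ex: "\<exists>i. s \<in> left_triple a (ancestor i J)"
          using ancestor_mem_all[OF s(1), of J] cell_subset_left_triple by blast
        have i: "s \<in> left_triple a (ancestor i J)" unfolding i_def by (rule LeastI_ex[OF ex])
        have "s < ?u" using s(2) side_pos[of J] by linarith
        have "i \<noteq> 0"
        proof
          assume "i = 0"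
          then show False using i s(2) by (simp add: left_triple_def)
        qed
        then obtain j where j: "i = Suc j" using not0_implies_Suc by blast
        have "s \<notin> left_triple a (ancestor j J)" using j not_less_Least[of j "\<lambda>i. s \<in> left_triple a (ancestor i J)"] unfolding i_def by simp
        moreover have uj: "?u \<in> cell a (ancestor j J)" "t0 \<in> cell a (ancestor j J)"
          using cell_subset_ancestor[of a J j] t0(1) left_in_cell[of a J] by blast+
        ultimately have "s < left a (ancestor j J) - 2 * side (ancestor j J)"
          using \<open>s < ?u\<close> unfolding left_triple_def cell_def by auto
        moreover have "left a (ancestor j J) \<le> t0" using uj(2) by (simp add: cell_def)
        ultimately have "2 * (2 ^ j * ?l) \<le> t0 - s" by (simp add: side_ancestor)
        moreover have "0 < 2 ^ j * ?l" by simp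
        ultimately have dist: "2 ^ j * ?l \<le> t0 - s" by linarith
        have "?u \<le> t0" using t0(1) by (simp add: cell_def)
        moreover have "2 * \<bar>t - t0\<bar> \<le> 2 * ?l" using near by (rule mult_left_mono) simp
        ultimately have "2 * \<bar>t - t0\<bar> \<le> t0 - s" using s(2) by argo
        then have "norm (K t s - K t0 s) \<le> M * \<bar>t - t0\<bar> powr \<sigma> / (t0 - s) powr (1 + \<sigma>)"
          using kernel[unfolded volterra_kernel_def, THEN conjunct2, THEN conjunct2, rule_format, of s t t0]
            tt s a \<open>?u \<le> t0\<close> side_pos[of J] by auto
        also have "\<dots> \<le> M * ?l powr \<sigma> / (2 ^ j * ?l) powr (1 + \<sigma>)"
          using near M_nonneg sigma dist by (intro frac_le mult_left_mono powr_mono2 mult_nonneg_nonneg) auto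
        finally have "norm (K t s - K t0 s) \<le> M * w j" by (simp add: w_def)
        then have "norm (K t s (f s) - K t0 s (f s)) \<le> M * w j * norm (f s)"
          using norm_blinfun[of "K t s - K t0 s" "f s"] mult_right_mono[of "norm (K t s - K t0 s)" "M * w j" "norm (f s)"]
          by (simp add: blinfun.diff_left)
        then have "ennreal (norm (K t s (f s) - K t0 s (f s)))
            \<le> ennreal (M * w j) * (ennreal (norm (f s)) * indicator (left_triple a (ancestor (Suc j) J)) s)"
          using i j M_nonneg by (simp add: ennreal_mult[symmetric] w_def ennreal_leI)
        also have "\<dots> \<le> (\<Sum>j. ennreal (M * w j) * (ennreal (norm (f s)) * indicator (left_triple a (ancestor (Suc j) J)) s))"
          using sum_le_suminf[of "\<lambda>j. ennreal (M * w j) * (ennreal (norm (f s)) * indicator (left_triple a (ancestor (Suc j) J)) s)" "{j}"]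
          by simp
        finally show ?thesis .
      qed simp
    qed
    also have "\<dots> = (\<Sum>j. \<integral>\<^sup>+ s. ennreal (M * w j) * (ennreal (norm (f s)) * indicator (left_triple a (ancestor (Suc j) J)) s) \<partial>lebesgue)"
    proof (rule nn_integral_suminf)
      fix j
      show "(\<lambda>s. ennreal (M * w j) * (ennreal (norm (f s)) * indicator (left_triple a (ancestor (Suc j) J)) s)) \<in> borel_measurable lebesgue"
        by (intro borel_measurable_times_ennreal borel_measurable_const admissible_ennreal_measurable[OF f] borel_measurable_indicator left_triple_sets)
    qed
    also have "\<dots> \<le> (\<Sum>j. ennreal (6 * M * m) * ennreal ((2 powr (- \<sigma>)) ^ j))"
    proof (rule suminf_le)
      fix j
      have "(\<integral>\<^sup>+ s. ennreal (M * w j) * (ennreal (norm (f s)) * indicator (left_triple a (ancestor (Suc j) J)) s) \<partial>lebesgue)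
         = ennreal (M * w j) * (\<integral>\<^sup>+ s. ennreal (norm (f s)) * indicator (left_triple a (ancestor (Suc j) J)) s \<partial>lebesgue)"
        by (intro nn_integral_cmult borel_measurable_times_ennreal admissible_ennreal_measurable[OF f] borel_measurable_indicator left_triple_sets)
      also have "\<dots> \<le> ennreal (M * w j) * ennreal (3 * side (ancestor (Suc j) J) * m)"
        by (rule mult_left_mono[OF avg]) simp
      also have "\<dots> = ennreal (M * w j * (3 * side (ancestor (Suc j) J) * m))"
        using M_nonneg by (intro ennreal_mult[symmetric]) (auto simp: w_def m less_imp_le)
      also have "M * w j * (3 * side (ancestor (Suc j) J) * m) = 6 * M * m * (2 powr (- \<sigma>)) ^ j"
      proof -
        define x where "x = 2 ^ j * ?l"
        have x: "0 < x" by (simp add: x_def)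
        have "x powr (1 + \<sigma>) = x * x powr \<sigma>" using x by (simp add: powr_add)
        moreover have "x powr \<sigma> = (2 powr \<sigma>) ^ j * ?l powr \<sigma>"
          by (simp add: x_def powr_mult powr_power powr_realpow[symmetric] powr_powr mult.commute)
        moreover have "(2 powr (- \<sigma>)) ^ j = 1 / (2 powr \<sigma>) ^ j" by (simp add: powr_minus_divide power_one_over)
        ultimately have "w j * x = (2 powr (- \<sigma>)) ^ j"
          using x by (simp add: w_def x_def[symmetric])
        moreover have "side (ancestor (Suc j) J) = 2 * x" by (simp add: side_ancestor x_def)
        ultimately show ?thesis by (simp add: mult_ac)
      qed
      also have "ennreal (6 * M * m * (2 powr (- \<sigma>)) ^ j) = ennreal (6 * M * m) * ennreal ((2 powr (- \<sigma>)) ^ j)"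
        using M_nonneg m by (intro ennreal_mult) auto
      finally show "(\<integral>\<^sup>+ s. ennreal (M * w j) * (ennreal (norm (f s)) * indicator (left_triple a (ancestor (Suc j) J)) s) \<partial>lebesgue)
          \<le> ennreal (6 * M * m) * ennreal ((2 powr (- \<sigma>)) ^ j)" .
    qed auto
    also have "\<dots> = ennreal (6 * M * m) * ennreal (1 / (1 - 2 powr (- \<sigma>)))"
      by (simp add: ennreal_suminf_cmult suminf_geometric_powr[OF sigma(1)])
    also have "\<dots> = ennreal (6 * M * m * (1 / (1 - 2 powr (- \<sigma>))))"
      using M_nonneg m inverse_one_minus_powr_le(1)[OF sigma(1)] by (intro ennreal_mult[symmetric]) auto
    also have "\<dots> \<le> ennreal (18 * M * m / \<sigma>)"
    proof (rule ennreal_leI)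
      have "1 + 2 / \<sigma> \<le> 3 / \<sigma>" using sigma by (simp add: field_simps)
      then have "1 / (1 - 2 powr (- \<sigma>)) \<le> 3 / \<sigma>" using inverse_one_minus_powr_le(2)[OF sigma(1)] by linarith
      then have "6 * M * m * (1 / (1 - 2 powr (- \<sigma>))) \<le> 6 * M * m * (3 / \<sigma>)"
        using M_nonneg m by (intro mult_left_mono) auto
      then show "6 * M * m * (1 / (1 - 2 powr (- \<sigma>))) \<le> 18 * M * m / \<sigma>" by simp
    qed
    finally show ?thesis using M_nonneg m sigma by (simp add: ennreal_le_iff)
  qed
  have "AE t in halfline. t \<in> cell a J \<longrightarrow> norm (T f t - T f t0) \<le> 18 * M * m / \<sigma>"
    using P unfolding AE_halfline by eventually_elim (use far in blast)
  then show ?thesis by blast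
qed

text \<open>
  \<open>f\<close> is cut at the two ends of the triple of \<open>J\<close>. The middle part is subject to the weak type
  inequality, the left part to \<open>T_oscillation_far\<close>, and the right part to causality.
\<close>

lemma T_oscillation:
  assumes f: "admissible a f" and D: "0 < D" "B \<le> D" "M \<le> D" and e: "0 < e" "e \<le> 1" and m: "0 < m"
    and avg: "\<And>j. (\<integral>\<^sup>+ t. ennreal (norm (f t)) * indicator (left_triple a (ancestor j J)) t \<partial>lebesgue)
        \<le> ennreal (3 * side (ancestor j J) * m)"
  shows "\<exists>c. emeasure lebesgue {t \<in> cell a J. 400 * D / (\<sigma> * e) * m < \<bar>norm (T f t) - c\<bar>} \<le> ennreal (e * side J)"
proof -
  let ?u = "left a J" and ?l = "side J"
  define A1 where "A1 = {..< ?u - 2 * ?l}"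
  define A2 where "A2 = {..< ?u + ?l}"
  have A12: "A1 \<subseteq> A2" using side_pos[of J] by (auto simp: A1_def A2_def)
  have thr: "?u - 2 * ?l = a + real_of_int (int (snd J) - 2) * 2 powi fst J"
    "?u + ?l = a + real_of_int (int (snd J) + 1) * 2 powi fst J"
    by (simp_all add: left_def side_def algebra_simps)
  define far where "far = (\<lambda>t. indicator A1 t *\<^sub>R f t)"
  define left_part where "left_part = (\<lambda>t. indicator A2 t *\<^sub>R f t)"
  define near where "near = (\<lambda>t. left_part t - far t)"
  define right where "right = (\<lambda>t. f t - left_part t)"
  have far_adm: "admissible a far" unfolding far_def A1_def thr by (rule admissible_below[OF f])
  have left_adm: "admissible a left_part" unfolding left_part_def A2_def thr by (rule admissible_below[OF f])
  have near_adm: "admissible a near" unfolding near_def by (rule admissible_diff[OF left_adm far_adm])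
  have right_adm: "admissible a right" unfolding right_def by (rule admissible_diff[OF f left_adm])
  have near_eq: "near t = indicator (left_triple a J) t *\<^sub>R f t" for t
  proof -
    have "t < ?u - 2 * ?l \<Longrightarrow> t < ?u + ?l" using side_pos[of J] by linarith
    then show ?thesis by (auto simp: near_def left_part_def far_def A1_def A2_def left_triple_def indicator_def)
  qed
  obtain c where c: "AE t in halfline. t \<in> cell a J \<longrightarrow> norm (T far t - c) \<le> 18 * M * m / \<sigma>"
  proof -
    have "(\<integral>\<^sup>+ t. ennreal (norm (far t)) * indicator (left_triple a (ancestor j J)) t \<partial>lebesgue)
        \<le> ennreal (3 * side (ancestor j J) * m)" for j
      by (rule order_trans[OF nn_integral_mono avg]) (auto simp: far_def indicator_def)
    then have "\<exists>c. AE t in halfline. t \<in> cell a J \<longrightarrow> norm (T far t - c) \<le> 18 * M * m / \<sigma>"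
      by (intro T_oscillation_far[OF far_adm _ m]) (auto simp: far_def A1_def)
    then show thesis using that by blast
  qed
  have right0: "AE t in halfline. t < ?u + ?l \<longrightarrow> T right t = 0"
  proof (rule T_causal[OF right_adm])
    show "0 < ?u + ?l" using left_pos[of J] by (simp add: add_pos_pos)
  qed (auto simp: right_def left_part_def A2_def)
  have "(\<lambda>s. near s + far s) = left_part" by (simp add: near_def)
  then have T1: "AE t in halfline. T left_part t = T near t + T far t" using T_add[OF near_adm far_adm] by simp
  have "(\<lambda>s. right s + left_part s) = f" by (simp add: right_def)
  then have T2: "AE t in halfline. T f t = T right t + T left_part t" using T_add[OF right_adm left_adm] by simp
  \<comment> \<open>At this level the weak type inequality, with total mass \<open>3 side J * m\<close>, gives exactly \<open>e * side J\<close>.\<close>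
  define l where "l = 300 * D * m / (\<sigma> * e)"
  have l: "0 < l" using D m sigma e by (simp add: l_def)
  have l_le: "l + 18 * M * m / \<sigma> \<le> 400 * D / (\<sigma> * e) * m"
  proof -
    have "18 * M * m / \<sigma> \<le> 18 * D * m / \<sigma>"
      using D m sigma by (intro divide_right_mono mult_right_mono) auto
    also have "\<dots> \<le> 18 * D * m / \<sigma> / e" using e D m sigma by (simp add: field_simps mult_left_le)
    also have "\<dots> = 18 * (D * m / (\<sigma> * e))" by simp
    finally have "18 * M * m / \<sigma> \<le> 18 * (D * m / (\<sigma> * e))" .
    moreover have "l = 300 * (D * m / (\<sigma> * e))" "400 * D / (\<sigma> * e) * m = 400 * (D * m / (\<sigma> * e))"
      by (simp_all add: l_def)
    moreover have "0 \<le> D * m / (\<sigma> * e)" using D m sigma e by simp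
    ultimately show ?thesis by linarith
  qed
  have "AE t in lebesgue. t \<in> {t \<in> cell a J. 400 * D / (\<sigma> * e) * m < \<bar>norm (T f t) - norm c\<bar>}
     \<longrightarrow> t \<in> super_level (T near) l"
    using c right0 T1 T2 unfolding AE_halfline
  proof eventually_elim
    case (elim t)
    show ?case
    proof
      assume t: "t \<in> {t \<in> cell a J. 400 * D / (\<sigma> * e) * m < \<bar>norm (T f t) - norm c\<bar>}"
      then have pos: "0 < t" using cell_ge[of t a J] a by simp
      have "t < ?u + ?l" using t by (simp add: cell_def)
      then have "T f t = T near t + T far t" using elim pos by simp
      then have "norm (T f t - c) \<le> norm (T near t) + norm (T far t - c)"
        using norm_triangle_ineq[of "T near t" "T far t - c"] by (simp add: algebra_simps)
      moreover have "\<bar>norm (T f t) - norm c\<bar> \<le> norm (T f t - c)" by (rule norm_triangle_ineq3)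
      moreover have "norm (T far t - c) \<le> 18 * M * m / \<sigma>" using elim(1) pos t by simp
      ultimately have "l < norm (T near t)" using t l_le by auto
      then show "t \<in> super_level (T near) l" using pos by (simp add: super_level_def)
    qed
  qed
  then have "emeasure lebesgue {t \<in> cell a J. 400 * D / (\<sigma> * e) * m < \<bar>norm (T f t) - norm c\<bar>}
      \<le> emeasure lebesgue (super_level (T near) l)"
    by (rule emeasure_mono_AE) (intro super_level_sets T_strongly_measurable near_adm)
  also have "\<dots> \<le> ennreal (100 * D * (3 * ?l * m) / (\<sigma> * l))"
  proof (rule weak_type[OF near_adm D l])
    have "(\<integral>\<^sup>+ t. ennreal (norm (near t)) \<partial>lebesgue) =
        (\<integral>\<^sup>+ t. ennreal (norm (f t)) * indicator (left_triple a (ancestor 0 J)) t \<partial>lebesgue)"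
      by (intro nn_integral_cong) (auto simp: near_eq indicator_def)
    also have "\<dots> \<le> ennreal (3 * side (ancestor 0 J) * m)" by (rule avg)
    finally show "(\<integral>\<^sup>+ t. ennreal (norm (near t)) \<partial>lebesgue) \<le> ennreal (3 * ?l * m)" by simp
  qed (simp add: m)
  also have "100 * D * (3 * ?l * m) / (\<sigma> * l) = e * ?l"
    using D m sigma e by (simp add: l_def)
  finally show ?thesis by blast
qed

end

section \<open>A dyadic maximal function and the good-lambda inequality\<close>

lemma emeasure_UN_le_nn_integral:
  assumes X: "\<And>i. i \<in> I \<Longrightarrow> X i \<in> sets N" and I: "countable I"
  shows "emeasure N (\<Union>i\<in>I. X i) \<le> (\<integral>\<^sup>+i. emeasure N (X i) \<partial>count_space I)"
proof -
  have UN: "(\<Union>i\<in>I. X i) \<in> sets N" using X I by (intro sets.countable_UN') auto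
  have "emeasure N (\<Union>i\<in>I. X i) = (\<integral>\<^sup>+x. indicator (\<Union>i\<in>I. X i) x \<partial>N)"
    using UN by simp
  also have "\<dots> \<le> (\<integral>\<^sup>+x. \<integral>\<^sup>+i. indicator (X i) x \<partial>count_space I \<partial>N)"
  proof (rule nn_integral_mono)
    fix x show "indicator (\<Union>i\<in>I. X i) x \<le> (\<integral>\<^sup>+i. indicator (X i) x \<partial>count_space I)"
    proof (cases "\<exists>i\<in>I. x \<in> X i")
      case True
      then obtain i where i: "i \<in> I" "x \<in> X i" by blast
      have "(indicator (X i) x :: ennreal) \<le> (\<integral>\<^sup>+i. indicator (X i) x \<partial>count_space I)"
        using i(1) by (rule nn_integral_ge_point)
      moreover have "indicator (\<Union>i\<in>I. X i) x = (indicator (X i) x :: ennreal)" using i unfolding indicator_def by auto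
      ultimately show ?thesis by simp
    qed auto
  qed
  also have "\<dots> = (\<integral>\<^sup>+i. \<integral>\<^sup>+x. indicator (X i) x \<partial>N \<partial>count_space I)"
    by (rule nn_integral_count_space_nn_integral[OF I]) (rule borel_measurable_indicator[OF X])
  also have "\<dots> = (\<integral>\<^sup>+i. emeasure N (X i) \<partial>count_space I)"
    by (intro nn_integral_cong) (simp add: X)
  finally show ?thesis .
qed

text \<open>
  A weak form of the Lebesgue density theorem, and a direct consequence of outer regularity: let
  \<open>N\<close> be the set of exceptional points. Every cell fills at most a quarter of itself with \<open>N\<close>, so the
  cells inside an open set \<open>U\<close> around \<open>N\<close> give \<open>|N| \<le> |U| / 4\<close>, while \<open>|U| < 2 |N|\<close> can be achieved
  if \<open>|N| > 0\<close>.
\<close>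

lemma AE_dense_cells:
  assumes E: "E \<in> sets lebesgue" "E \<subseteq> {a..}" and fin: "emeasure lebesgue E < \<infinity>"
  shows "AE t in lebesgue. t \<in> E \<longrightarrow>
    t \<in> (\<Union>J\<in>{J. ennreal (side J / 4) < emeasure lebesgue (E \<inter> cell a J)}. cell a J)"
proof -
  define S where "S = {J. ennreal (side J / 4) < emeasure lebesgue (E \<inter> cell a J)}"
  define N where "N = E - (\<Union>J\<in>S. cell a J)"
  have N: "N \<in> sets lebesgue" unfolding N_def using E(1) by (intro sets.Diff sets.countable_UN') auto
  have "emeasure lebesgue N = 0"
  proof (rule ccontr)
    assume nz: "emeasure lebesgue N \<noteq> 0"
    have "emeasure lebesgue N \<le> emeasure lebesgue E" using E(1) by (intro emeasure_mono) (auto simp: N_def)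
    then have "emeasure lebesgue N < \<infinity>" using fin by (rule le_less_trans)
    then obtain e where e: "emeasure lebesgue N = ennreal e" "0 \<le> e" by (cases "emeasure lebesgue N") auto
    then have e0: "0 < e" using nz by (cases "e = 0") auto
    obtain U where U: "open U" "N \<subseteq> U" "U - N \<in> lmeasurable" "emeasure lebesgue (U - N) < ennreal e"
      using sets_lebesgue_outer_open[OF N e0] by blast
    have "U = N \<union> (U - N)" using U(2) by blast
    then have "emeasure lebesgue U \<le> emeasure lebesgue N + emeasure lebesgue (U - N)"
      using emeasure_subadditive[OF N fmeasurableD[OF U(3)]] by simp
    also have "\<dots> \<le> ennreal e + ennreal e" using U(4) e(1) by (intro add_mono) auto
    also have "\<dots> = ennreal (2 * e)" using e0 by (simp add: ennreal_plus[symmetric] del: ennreal_plus)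
    finally have U_le: "emeasure lebesgue U \<le> ennreal (2 * e)" .
    define F where "F = {J. fst J \<le> 0 \<and> cell a J \<subseteq> U}"
    define Q where "Q = maximal_cells F"
    have bounded: "side J \<le> 1" if "J \<in> F" for J
    proof -
      have "(2::real) powi fst J \<le> 2 powi 0" using that by (intro power_int_increasing) (auto simp: F_def)
      then show ?thesis by (simp add: side_def)
    qed
    have UN: "(\<Union>J\<in>Q. cell a J) = (\<Union>J\<in>F. cell a J)" unfolding Q_def by (rule UN_maximal_cells[OF bounded])
    have sub: "N \<subseteq> (\<Union>J\<in>Q. cell a J)" unfolding UN
    proof
      fix t assume t: "t \<in> N"
      then have "a \<le> t" "t \<in> U" using E(2) U(2) by (auto simp: N_def)
      then obtain k where k: "k \<le> 0" "cell a (cell_at a k t) \<subseteq> U" using small_cell_subset_open[OF U(1)] by metis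
      then have "cell_at a k t \<in> F" by (simp add: F_def)
      then show "t \<in> (\<Union>J\<in>F. cell a J)" using cell_at_mem[OF \<open>a \<le> t\<close>] by blast
    qed
    define V where "V = density lebesgue (indicator N)"
    have V: "emeasure V X = emeasure lebesgue (N \<inter> X)" if "X \<in> sets lebesgue" for X
      unfolding V_def by (rule emeasure_restricted[OF N that])
    have setsV: "sets V = sets lebesgue" by (simp add: V_def)
    have "ennreal e = emeasure V (\<Union>J\<in>Q. cell a J)"
      using sub e(1) by (subst V) (auto intro!: sets.countable_UN' simp: Int_absorb2)
    also have "\<dots> = (\<integral>\<^sup>+J. emeasure V (cell a J) \<partial>count_space Q)"
      unfolding Q_def by (rule nn_integral_maximal_cells[OF setsV, symmetric])
    also have "\<dots> \<le> (\<integral>\<^sup>+J. ennreal (1 / 4) * emeasure lebesgue (cell a J) \<partial>count_space Q)"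
    proof (rule nn_integral_mono)
      fix J
      show "emeasure V (cell a J) \<le> ennreal (1 / 4) * emeasure lebesgue (cell a J)"
      proof (cases "J \<in> S")
        case True
        then have "N \<inter> cell a J = {}" by (auto simp: N_def)
        then show ?thesis by (simp add: V)
      next
        case False
        have "emeasure lebesgue (N \<inter> cell a J) \<le> emeasure lebesgue (E \<inter> cell a J)"
          using E(1) by (intro emeasure_mono) (auto simp: N_def)
        also have "\<dots> \<le> ennreal (side J / 4)" using False by (simp add: S_def not_less)
        also have "\<dots> = ennreal (1 / 4) * ennreal (side J)" by (subst ennreal_mult[symmetric]) auto
        finally show ?thesis by (simp add: V)
      qed
    qed
    also have "\<dots> = ennreal (1 / 4) * (\<integral>\<^sup>+J. emeasure lebesgue (cell a J) \<partial>count_space Q)"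
      by (rule nn_integral_cmult) simp
    also have "(\<integral>\<^sup>+J. emeasure lebesgue (cell a J) \<partial>count_space Q) = emeasure lebesgue (\<Union>J\<in>Q. cell a J)"
      unfolding Q_def by (rule nn_integral_maximal_cells) simp
    also have "\<dots> \<le> emeasure lebesgue U"
    proof (rule emeasure_mono)
      show "(\<Union>J\<in>Q. cell a J) \<subseteq> U" unfolding UN by (auto simp: F_def)
      show "U \<in> sets lebesgue" using U(1) by auto
    qed
    also note U_le
    finally have "ennreal e \<le> ennreal (1 / 4) * ennreal (2 * e)" by (simp add: mult_left_mono)
    then have "ennreal e \<le> ennreal (e / 2)" using e0 by (simp add: ennreal_mult[symmetric])
    then show False using e0 by simp
  qed
  then have "N \<in> null_sets lebesgue" using N by auto
  then have "AE t in lebesgue. t \<notin> N" by (rule AE_not_in)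
  then show ?thesis by eventually_elim (auto simp: N_def S_def)
qed

text \<open>
  The set where the maximal function of \<open>\<phi>\<close>, the supremum of its means over the triples of the
  cells containing a point, exceeds \<open>\<mu>\<close>. Only these level sets are used, never the maximal function
  itself.
\<close>

definition maximal_level :: "real \<Rightarrow> (real \<Rightarrow> real) \<Rightarrow> real \<Rightarrow> real set" where
  "maximal_level a \<phi> \<mu> = (\<Union>J\<in>{J. ennreal (3 * side J * \<mu>) <
     (\<integral>\<^sup>+ t. ennreal (\<phi> t) * indicator (left_triple a J) t \<partial>lebesgue)}. cell a J)"

lemma maximal_level_sets [simp]: "maximal_level a \<phi> \<mu> \<in> sets lebesgue"
  unfolding maximal_level_def by (intro sets.countable_UN') auto

text \<open>
  If the mean over a triple exceeds \<open>\<mu>\<close>, so does the mean over one of its three intervals. This is a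
  cell, contained in a maximal one \<open>Q\<close> with mean exceeding \<open>\<mu>\<close>; the original cell lies at most two
  of its own lengths to the right, hence within three lengths of \<open>Q\<close> from the left end of \<open>Q\<close>.
\<close>

lemma maximal_level_weak_type:
  assumes \<phi>: "\<phi> \<in> borel_measurable lebesgue" "\<And>t. t < a \<Longrightarrow> \<phi> t = 0" "\<And>t. 0 \<le> \<phi> t"
    and fin: "(\<integral>\<^sup>+ t. ennreal (\<phi> t) \<partial>lebesgue) < \<infinity>" and \<mu>: "0 < \<mu>"
  shows "emeasure lebesgue (maximal_level a \<phi> \<mu>) \<le> ennreal (3 / \<mu>) * (\<integral>\<^sup>+ t. ennreal (\<phi> t) \<partial>lebesgue)"
proof -
  have m: "(\<lambda>t. ennreal (\<phi> t)) \<in> borel_measurable lebesgue" using \<phi>(1) by measurable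
  define N where "N = density lebesgue (\<lambda>t. ennreal (\<phi> t))"
  have setsN: "sets N = sets lebesgue" by (simp add: N_def)
  have N: "emeasure N X = (\<integral>\<^sup>+ t. ennreal (\<phi> t) * indicator X t \<partial>lebesgue)" if "X \<in> sets lebesgue" for X
    unfolding N_def by (rule emeasure_density[OF m that])
  have total: "emeasure N X \<le> (\<integral>\<^sup>+ t. ennreal (\<phi> t) \<partial>lebesgue)" for X
    using emeasure_space[of N X] N[of UNIV] by (simp add: N_def)
  obtain I where I: "(\<integral>\<^sup>+ t. ennreal (\<phi> t) \<partial>lebesgue) = ennreal I" "0 \<le> I"
    using fin by (cases "\<integral>\<^sup>+ t. ennreal (\<phi> t) \<partial>lebesgue") auto
  define S where "S = {J. ennreal (side J * \<mu>) < emeasure N (cell a J)}"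
  define Q where "Q = maximal_cells S"
  define triple where "triple J = {left a J ..< left a J + 3 * side J}" for J
  have bounded: "side J \<le> I / \<mu>" if "J \<in> S" for J
  proof -
    have "ennreal (side J * \<mu>) \<le> ennreal I" using that total[of "cell a J"] I(1) unfolding S_def by force
    then show ?thesis using \<mu> I(2) by (simp add: field_simps)
  qed
  have cover: "cell a J \<subseteq> (\<Union>J\<in>Q. triple J)"
    if J: "ennreal (3 * side J * \<mu>) < (\<integral>\<^sup>+ t. ennreal (\<phi> t) * indicator (left_triple a J) t \<partial>lebesgue)" for J
  proof -
    let ?l = "side J" and ?u = "left a J"
    define P where "P i = {?u - real i * ?l ..< ?u - real i * ?l + ?l}" for i :: nat
    have P: "P i \<in> sets lebesgue" for i by (simp add: P_def)
    have "left_triple a J \<subseteq> P 0 \<union> P 1 \<union> P 2" by (auto simp: left_triple_def P_def)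
    then have "emeasure N (left_triple a J) \<le> emeasure N (P 0 \<union> P 1 \<union> P 2)"
      by (rule emeasure_mono) (simp only: setsN sets.Un P)
    also have "\<dots> \<le> emeasure N (P 0) + emeasure N (P 1) + emeasure N (P 2)"
    proof -
      have "emeasure N (P 0 \<union> P 1 \<union> P 2) \<le> emeasure N (P 0 \<union> P 1) + emeasure N (P 2)"
        by (rule emeasure_subadditive) (simp_all only: setsN sets.Un P)
      also have "\<dots> \<le> emeasure N (P 0) + emeasure N (P 1) + emeasure N (P 2)"
        by (rule add_right_mono, rule emeasure_subadditive) (simp_all only: setsN P)
      finally show ?thesis .
    qed
    finally have le: "emeasure N (left_triple a J) \<le> emeasure N (P 0) + emeasure N (P 1) + emeasure N (P 2)" .
    have "\<exists>i\<le>2. ennreal (?l * \<mu>) < emeasure N (P i)"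
    proof (rule ccontr)
      assume "\<not> ?thesis"
      then have le_i: "emeasure N (P i) \<le> ennreal (?l * \<mu>)" if "i \<le> 2" for i using that by (auto simp: not_less)
      have "emeasure N (left_triple a J) \<le> ennreal (?l * \<mu>) + ennreal (?l * \<mu>) + ennreal (?l * \<mu>)"
        by (rule order_trans[OF le]) (intro add_mono le_i; simp)
      also have "\<dots> = ennreal (3 * ?l * \<mu>)" using \<mu> by (simp add: ennreal_plus[symmetric] del: ennreal_plus)
      finally show False using J by (simp add: N not_less[symmetric])
    qed
    then obtain i where i: "i \<le> 2" "ennreal (?l * \<mu>) < emeasure N (P i)" by blast
    \<comment> \<open>The interval does not reach beyond the base point, where \<open>\<phi>\<close> has no mass.\<close>
    have "i \<le> snd J"
    proof (rule ccontr)
      assume "\<not> i \<le> snd J"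
      then have "real (snd J) + 1 \<le> real i" by simp
      then have "(real (snd J) + 1) * ?l \<le> real i * ?l" by (rule mult_right_mono) simp
      then have "t < a" if "t \<in> P i" for t using that by (auto simp: P_def left_def algebra_simps)
      then have "(\<lambda>t. ennreal (\<phi> t) * indicator (P i) t) = (\<lambda>t. 0)"
        using \<phi>(2) by (auto simp: fun_eq_iff indicator_def)
      then have "emeasure N (P i) = 0" by (simp add: N P)
      then show False using i(2) by simp
    qed
    define J1 where "J1 = (fst J, snd J - i)"
    have s1: "side J1 = ?l" by (simp add: J1_def side_def)
    have u1: "left a J1 = ?u - real i * ?l"
      using \<open>i \<le> snd J\<close> s1 by (simp add: left_def J1_def of_nat_diff algebra_simps)
    have "J1 \<in> S" using i(2) by (simp add: S_def s1 cell_def u1 P_def)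
    then obtain j where j: "ancestor j J1 \<in> Q" unfolding Q_def using bounded by (rule maximal_cell_exists)
    have "cell a J \<subseteq> triple (ancestor j J1)"
    proof
      fix t assume t: "t \<in> cell a J"
      have "cell a J1 \<subseteq> cell a (ancestor j J1)" by (rule cell_subset_ancestor)
      moreover have "cell a J1 \<noteq> {}" using left_in_cell by blast
      ultimately have "left a (ancestor j J1) \<le> left a J1"
          "left a J1 + side J1 \<le> left a (ancestor j J1) + side (ancestor j J1)"
        using side_pos[of J1] unfolding cell_def by (simp_all add: atLeastLessThan_subset_iff not_le[symmetric])
      moreover have "side J1 \<le> side (ancestor j J1)"
        unfolding side_ancestor using mult_right_mono[of 1 "2 ^ j" "side J1"] by simp
      moreover have "real i * ?l \<le> 2 * ?l" using i(1) by (intro mult_right_mono) auto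
      moreover have "0 \<le> real i * ?l" by simp
      moreover have "?u \<le> t" "t < ?u + ?l" using t by (simp_all add: cell_def)
      ultimately have "left a (ancestor j J1) \<le> t" "t < left a (ancestor j J1) + 3 * side (ancestor j J1)"
        unfolding s1 u1 by linarith+
      then show "t \<in> triple (ancestor j J1)" by (simp add: triple_def)
    qed
    then show ?thesis using j by blast
  qed
  have countable: "countable Q" by simp
  have "emeasure lebesgue (maximal_level a \<phi> \<mu>) \<le> emeasure lebesgue (\<Union>J\<in>Q. triple J)"
    unfolding maximal_level_def using cover
    by (intro emeasure_mono UN_least sets.countable_UN') (auto simp: triple_def)
  also have "\<dots> \<le> (\<integral>\<^sup>+J. emeasure lebesgue (triple J) \<partial>count_space Q)"
    by (intro emeasure_UN_le_nn_integral) (auto simp: triple_def)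
  also have "\<dots> \<le> (\<integral>\<^sup>+J. ennreal (3 / \<mu>) * emeasure N (cell a J) \<partial>count_space Q)"
  proof (rule nn_integral_mono)
    fix J assume "J \<in> space (count_space Q)"
    then have "J \<in> S" using maximal_cells_subset by (auto simp: Q_def)
    have "emeasure lebesgue (triple J) = ennreal (3 / \<mu> * (side J * \<mu>))" using \<mu> by (simp add: triple_def)
    also have "\<dots> = ennreal (3 / \<mu>) * ennreal (side J * \<mu>)" using \<mu> by (intro ennreal_mult) auto
    also have "\<dots> \<le> ennreal (3 / \<mu>) * emeasure N (cell a J)"
      using \<open>J \<in> S\<close> by (intro mult_left_mono) (auto simp: S_def less_imp_le)
    finally show "emeasure lebesgue (triple J) \<le> ennreal (3 / \<mu>) * emeasure N (cell a J)" .
  qed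
  also have "\<dots> = ennreal (3 / \<mu>) * (\<integral>\<^sup>+J. emeasure N (cell a J) \<partial>count_space Q)"
    by (rule nn_integral_cmult) simp
  also have "(\<integral>\<^sup>+J. emeasure N (cell a J) \<partial>count_space Q) = emeasure N (\<Union>J\<in>Q. cell a J)"
    unfolding Q_def by (rule nn_integral_maximal_cells[OF setsN])
  also have "ennreal (3 / \<mu>) * \<dots> \<le> ennreal (3 / \<mu>) * (\<integral>\<^sup>+ t. ennreal (\<phi> t) \<partial>lebesgue)"
    by (intro mult_left_mono total) simp
  finally show ?thesis .
qed

text \<open>
  The part of \<open>\<phi>\<close> below \<open>\<mu> / 2\<close> contributes at most \<open>\<mu> / 2\<close> to each mean. The gain over
  the untruncated inequality is integrability in \<open>\<mu>\<close> against powers.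
\<close>

lemma maximal_level_truncated:
  assumes \<phi>: "\<phi> \<in> borel_measurable lebesgue" "\<And>t. t < a \<Longrightarrow> \<phi> t = 0" "\<And>t. 0 \<le> \<phi> t"
    and fin: "(\<integral>\<^sup>+ t. ennreal (\<phi> t) \<partial>lebesgue) < \<infinity>" and \<mu>: "0 < \<mu>"
  shows "emeasure lebesgue (maximal_level a \<phi> \<mu>)
    \<le> ennreal (6 / \<mu>) * (\<integral>\<^sup>+ t. ennreal (\<phi> t) * indicator {t. \<mu> / 2 < \<phi> t} t \<partial>lebesgue)"
proof -
  define \<phi>' where "\<phi>' t = (if \<mu> / 2 < \<phi> t then \<phi> t else 0)" for t
  have m': "\<phi>' \<in> borel_measurable lebesgue" unfolding \<phi>'_def using \<phi>(1) by measurable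
  have le: "\<phi>' t \<le> \<phi> t" "\<phi> t \<le> \<phi>' t + \<mu> / 2" "0 \<le> \<phi>' t" for t using \<phi>(3)[of t] \<mu> by (auto simp: \<phi>'_def)
  have "maximal_level a \<phi> \<mu> \<subseteq> maximal_level a \<phi>' (\<mu> / 2)"
  proof -
    have "ennreal (3 * side J * (\<mu> / 2)) < (\<integral>\<^sup>+ t. ennreal (\<phi>' t) * indicator (left_triple a J) t \<partial>lebesgue)"
      if J: "ennreal (3 * side J * \<mu>) < (\<integral>\<^sup>+ t. ennreal (\<phi> t) * indicator (left_triple a J) t \<partial>lebesgue)" for J
    proof (rule ccontr)
      assume n: "\<not> ?thesis"
      have "(\<integral>\<^sup>+ t. ennreal (\<phi> t) * indicator (left_triple a J) t \<partial>lebesgue)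
         \<le> (\<integral>\<^sup>+ t. ennreal (\<phi>' t) * indicator (left_triple a J) t + ennreal (\<mu> / 2) * indicator (left_triple a J) t \<partial>lebesgue)"
        using le \<mu> by (intro nn_integral_mono)
          (auto simp: indicator_def ennreal_plus[symmetric] simp del: ennreal_plus intro!: ennreal_leI)
      also have "\<dots> = (\<integral>\<^sup>+ t. ennreal (\<phi>' t) * indicator (left_triple a J) t \<partial>lebesgue) + ennreal (\<mu> / 2) * emeasure lebesgue (left_triple a J)"
      proof (subst nn_integral_add)
        show "(\<lambda>t. ennreal (\<phi>' t) * indicator (left_triple a J) t) \<in> borel_measurable lebesgue"
          using measurable_compose[OF m' measurable_ennreal] by (intro borel_measurable_times_ennreal borel_measurable_indicator) auto
        show "(\<lambda>t. ennreal (\<mu> / 2) * indicator (left_triple a J) t) \<in> borel_measurable lebesgue"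
          by (intro borel_measurable_times_ennreal borel_measurable_indicator) auto
      qed (simp add: nn_integral_cmult_indicator)
      also have "\<dots> \<le> ennreal (3 * side J * (\<mu> / 2)) + ennreal (\<mu> / 2) * ennreal (3 * side J)"
        using n by (intro add_mono mult_left_mono) (auto simp: left_triple_def not_less)
      also have "\<dots> = ennreal (3 * side J * \<mu>)"
        using \<mu> by (simp add: ennreal_mult[symmetric] ennreal_plus[symmetric] del: ennreal_plus)
      finally show False using J by (simp add: not_less[symmetric])
    qed
    then show ?thesis unfolding maximal_level_def by blast
  qed
  then have "emeasure lebesgue (maximal_level a \<phi> \<mu>) \<le> emeasure lebesgue (maximal_level a \<phi>' (\<mu> / 2))"
    by (rule emeasure_mono) simp
  also have "\<dots> \<le> ennreal (3 / (\<mu> / 2)) * (\<integral>\<^sup>+ t. ennreal (\<phi>' t) \<partial>lebesgue)"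
  proof (rule maximal_level_weak_type[OF m' _ le(3)])
    show "\<phi>' t = 0" if "t < a" for t using \<phi>(2)[OF that] by (simp add: \<phi>'_def)
    have "(\<integral>\<^sup>+ t. ennreal (\<phi>' t) \<partial>lebesgue) \<le> (\<integral>\<^sup>+ t. ennreal (\<phi> t) \<partial>lebesgue)"
      by (intro nn_integral_mono ennreal_leI le)
    then show "(\<integral>\<^sup>+ t. ennreal (\<phi>' t) \<partial>lebesgue) < \<infinity>" using fin by (rule le_less_trans)
  qed (use \<mu> in simp)
  also have "(\<integral>\<^sup>+ t. ennreal (\<phi>' t) \<partial>lebesgue) = (\<integral>\<^sup>+ t. ennreal (\<phi> t) * indicator {t. \<mu> / 2 < \<phi> t} t \<partial>lebesgue)"
    by (intro nn_integral_cong) (auto simp: \<phi>'_def indicator_def)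
  finally show ?thesis using \<mu> by simp
qed

text \<open>
  Up to a null set, \<open>{\<psi> > l}\<close> is covered by the maximal cells \<open>J\<close> in which it has density more than \<open>1/4\<close>.
  In the parent of \<open>J\<close> its density is at most \<open>1/4\<close>. Unless \<open>J\<close> is part of the level set of the
  maximal function, the oscillation hypothesis applies to the parent, and the constant \<open>c\<close>
  provided by it is at most \<open>3 l / 2\<close>; otherwise the exceptional set would contain all points of the
  parent with \<open>\<psi> \<le> l\<close>, which make up at least three quarters of it. Hence \<open>\<psi> > 2 l\<close> within \<open>J\<close> only on the
  exceptional set, which is small.
\<close>

lemma good_lambda:
  assumes \<psi>: "\<psi> \<in> borel_measurable lebesgue" "\<And>t. t < a \<Longrightarrow> \<psi> t = 0"
    and l: "0 < l" and A: "0 < A" and e: "0 < e" "e < 1 / 2"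
    and fin: "emeasure lebesgue {t. l < \<psi> t} < \<infinity>"
    and osc: "\<And>J. (\<And>j. (\<integral>\<^sup>+ t. ennreal (\<phi> t) * indicator (left_triple a (ancestor j J)) t \<partial>lebesgue)
        \<le> ennreal (3 * side (ancestor j J) * (l / (2 * A)))) \<Longrightarrow>
      \<exists>c. emeasure lebesgue {t \<in> cell a J. l / 2 < \<bar>\<psi> t - c\<bar>} \<le> ennreal (e * side J)"
  shows "emeasure lebesgue {t. 2 * l < \<psi> t}
     \<le> emeasure lebesgue (maximal_level a \<phi> (l / (2 * A))) + ennreal (8 * e) * emeasure lebesgue {t. l < \<psi> t}"
proof -
  define E where "E = {t. l < \<psi> t}"
  define O' where "O' = maximal_level a \<phi> (l / (2 * A))"
  have lev: "{t. c < \<psi> t} \<in> sets lebesgue" for c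
    using borel_measurable_less[OF borel_measurable_const[of c] \<psi>(1)] by simp
  have E: "E \<in> sets lebesgue" unfolding E_def by (rule lev)
  have Ea: "E \<subseteq> {a..}" using \<psi>(2) l by (force simp: E_def not_less[symmetric])
  define S where "S = {J. ennreal (side J / 4) < emeasure lebesgue (E \<inter> cell a J)}"
  define Q where "Q = maximal_cells S"
  obtain W where W: "emeasure lebesgue E = ennreal W" "0 \<le> W"
    using fin unfolding E_def[symmetric] by (cases "emeasure lebesgue E") auto
  have bounded: "side J \<le> 4 * W" if "J \<in> S" for J
  proof -
    have "emeasure lebesgue (E \<inter> cell a J) \<le> emeasure lebesgue E" using E by (intro emeasure_mono) auto
    then have "ennreal (side J / 4) < ennreal W" using that W(1) unfolding S_def by (auto elim: less_le_trans)
    then show ?thesis using W(2) by (simp add: ennreal_less_iff)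
  qed
  have UN: "(\<Union>J\<in>Q. cell a J) = (\<Union>J\<in>S. cell a J)" unfolding Q_def by (rule UN_maximal_cells[OF bounded])
  have small: "emeasure lebesgue {t \<in> cell a J. 2 * l < \<psi> t} \<le> ennreal (8 * e) * emeasure lebesgue (E \<inter> cell a J)"
    if J: "J \<in> Q" "\<not> cell a J \<subseteq> O'" for J
  proof -
    let ?P = "ancestor 1 J"
    obtain t where t: "t \<in> cell a J" "t \<notin> O'" using J(2) by blast
    have "(\<integral>\<^sup>+ t. ennreal (\<phi> t) * indicator (left_triple a (ancestor j ?P)) t \<partial>lebesgue)
        \<le> ennreal (3 * side (ancestor j ?P) * (l / (2 * A)))" for j
    proof (rule ccontr)
      assume "\<not> ?thesis"
      then have "cell a (ancestor j ?P) \<subseteq> O'" unfolding O'_def maximal_level_def not_le by blast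
      then show False using t cell_subset_ancestor[of a J 1] cell_subset_ancestor[of a ?P j] by blast
    qed
    then obtain c where c: "emeasure lebesgue {t \<in> cell a ?P. l / 2 < \<bar>\<psi> t - c\<bar>} \<le> ennreal (e * side ?P)"
      using osc by blast
    define X where "X = {t \<in> cell a ?P. l / 2 < \<bar>\<psi> t - c\<bar>}"
    have X: "X \<in> sets lebesgue"
    proof -
      have "{t \<in> space lebesgue. l / 2 < \<bar>\<psi> t - c\<bar>} \<in> sets lebesgue"
        using \<psi>(1) by measurable
      then have "cell a ?P \<inter> {t \<in> space lebesgue. l / 2 < \<bar>\<psi> t - c\<bar>} \<in> sets lebesgue" by (intro sets.Int) auto
      also have "cell a ?P \<inter> {t \<in> space lebesgue. l / 2 < \<bar>\<psi> t - c\<bar>} = X" by (auto simp: X_def)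
      finally show ?thesis .
    qed
    have "?P \<notin> S" using maximal_cells_parent J(1) unfolding Q_def by blast
    then have dens: "emeasure lebesgue (E \<inter> cell a ?P) \<le> ennreal (side ?P / 4)" by (simp add: S_def not_less)
    have "c \<le> l + l / 2"
    proof (rule ccontr)
      assume n: "\<not> c \<le> l + l / 2"
      have "cell a ?P \<subseteq> (E \<inter> cell a ?P) \<union> X"
      proof
        fix t assume t: "t \<in> cell a ?P"
        show "t \<in> (E \<inter> cell a ?P) \<union> X"
        proof (cases "l < \<psi> t")
          case True then show ?thesis using t by (simp add: E_def)
        next
          case False
          then have "l / 2 < \<bar>\<psi> t - c\<bar>" using n by linarith
          then show ?thesis using t by (simp add: X_def)
        qed
      qed
      then have "emeasure lebesgue (cell a ?P) \<le> emeasure lebesgue ((E \<inter> cell a ?P) \<union> X)"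
        using E X by (intro emeasure_mono) auto
      also have "\<dots> \<le> emeasure lebesgue (E \<inter> cell a ?P) + emeasure lebesgue X"
        using E X by (intro emeasure_subadditive) auto
      also have "\<dots> \<le> ennreal (side ?P / 4) + ennreal (e * side ?P)"
        using dens c by (intro add_mono) (auto simp: X_def)
      also have "\<dots> = ennreal (side ?P / 4 + e * side ?P)" using e by (simp add: ennreal_plus[symmetric] del: ennreal_plus)
      finally have "ennreal (side ?P) \<le> ennreal (side ?P / 4 + e * side ?P)" by (simp only: emeasure_cell)
      moreover have "0 \<le> side ?P / 4 + e * side ?P" using e by (simp add: add_nonneg_nonneg)
      ultimately have "side ?P \<le> side ?P / 4 + e * side ?P" by (simp only: ennreal_le_iff)
      moreover have "e * side ?P < 1 / 2 * side ?P" using e(2) by (rule mult_strict_right_mono) simp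
      ultimately show False using side_pos[of ?P] by linarith
    qed
    then have "l / 2 < \<bar>\<psi> t - c\<bar>" if "2 * l < \<psi> t" for t using that by linarith
    then have "{t \<in> cell a J. 2 * l < \<psi> t} \<subseteq> X"
      using cell_subset_ancestor[of a J 1] unfolding X_def by blast
    then have "emeasure lebesgue {t \<in> cell a J. 2 * l < \<psi> t} \<le> emeasure lebesgue X"
      using X by (intro emeasure_mono)
    also have "\<dots> \<le> ennreal (e * side ?P)" using c by (simp add: X_def)
    also have "\<dots> = ennreal (8 * e) * ennreal (side J / 4)"
      using e by (simp add: side_ancestor ennreal_mult[symmetric])
    also have "\<dots> \<le> ennreal (8 * e) * emeasure lebesgue (E \<inter> cell a J)"
    proof (rule mult_left_mono)
      have "J \<in> S" using J(1) maximal_cells_subset unfolding Q_def by blast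
      then show "ennreal (side J / 4) \<le> emeasure lebesgue (E \<inter> cell a J)" by (simp add: S_def less_imp_le)
    qed simp
    finally show ?thesis .
  qed
  define Y where "Y J = (if cell a J \<subseteq> O' then {} else {t \<in> cell a J. 2 * l < \<psi> t})" for J
  define Z where "Z = (\<Union>J\<in>Q. Y J)"
  have piece: "Y J \<in> sets lebesgue" for J
    using sets.Int[OF cell_sets(2)[of a J] lev[of "2 * l"]] by (simp add: Int_def Y_def)
  have Z: "Z \<in> sets lebesgue" unfolding Z_def by (intro sets.countable_UN') (auto intro: piece)
  have "AE t in lebesgue. t \<in> {t. 2 * l < \<psi> t} \<longrightarrow> t \<in> O' \<union> Z"
    using AE_dense_cells[OF E Ea fin[folded E_def]] unfolding S_def[symmetric] UN[symmetric]
  proof eventually_elim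
    case (elim t)
    show ?case
    proof
      assume t: "t \<in> {t. 2 * l < \<psi> t}"
      then have "t \<in> E" using l by (simp add: E_def)
      then obtain J where "J \<in> Q" "t \<in> cell a J" using elim by blast
      then show "t \<in> O' \<union> Z" using t by (auto simp: Z_def Y_def)
    qed
  qed
  then have "emeasure lebesgue {t. 2 * l < \<psi> t} \<le> emeasure lebesgue (O' \<union> Z)"
    by (rule emeasure_mono_AE) (auto simp: O'_def Z)
  also have "\<dots> \<le> emeasure lebesgue O' + emeasure lebesgue Z"
    by (intro emeasure_subadditive) (auto simp: O'_def Z)
  also have "emeasure lebesgue Z \<le> ennreal (8 * e) * emeasure lebesgue E"
  proof -
    define V where "V = density lebesgue (indicator E)"
    have V: "emeasure V X = emeasure lebesgue (E \<inter> X)" if "X \<in> sets lebesgue" for X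
      unfolding V_def by (rule emeasure_restricted[OF E that])
    have setsV: "sets V = sets lebesgue" by (simp add: V_def)
    have "emeasure lebesgue Z \<le> (\<integral>\<^sup>+J. emeasure lebesgue (Y J) \<partial>count_space Q)"
      unfolding Z_def by (rule emeasure_UN_le_nn_integral) (auto intro: piece)
    also have "\<dots> \<le> (\<integral>\<^sup>+J. ennreal (8 * e) * emeasure V (cell a J) \<partial>count_space Q)"
      by (intro nn_integral_mono) (auto simp: V Y_def intro: small)
    also have "\<dots> = ennreal (8 * e) * (\<integral>\<^sup>+J. emeasure V (cell a J) \<partial>count_space Q)"
      by (rule nn_integral_cmult) simp
    also have "(\<integral>\<^sup>+J. emeasure V (cell a J) \<partial>count_space Q) = emeasure V (\<Union>J\<in>Q. cell a J)"
      unfolding Q_def by (rule nn_integral_maximal_cells[OF setsV])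
    also have "\<dots> = emeasure lebesgue (E \<inter> (\<Union>J\<in>Q. cell a J))"
      by (intro V sets.countable_UN') auto
    also have "\<dots> \<le> emeasure lebesgue E" using E by (intro emeasure_mono) auto
    finally show ?thesis by (simp add: mult_left_mono)
  qed
  finally show ?thesis by (simp add: O'_def E_def add_left_mono)
qed

section \<open>From level sets to integrals of powers\<close>

text \<open>
  Integrals of powers are computed by sums over the heights \<open>b, b/2, b/4, \<dots>\<close> counted downwards from
  some \<open>b\<close>. The largest height below \<open>x\<close> dominates, so the bound does not depend on \<open>b\<close>.
\<close>

lemma sum_geometric_below:
  fixes b q x :: real
  assumes q: "0 < q" and "0 < b"
  shows "(\<Sum>i<n. if b / 2 ^ i < x then (b / 2 ^ i) powr q else 0) \<le> x powr q * (1 / (1 - 2 powr (- q)))"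
  using \<open>0 < b\<close>
proof (induction n arbitrary: b)
  case 0
  then show ?case using inverse_one_minus_powr_le(1)[OF q] by simp
next
  case (Suc n)
  let ?\<theta> = "2 powr (- q)"
  have th: "0 < ?\<theta>" "?\<theta> < 1" using inverse_one_minus_powr_le(1)[OF q] by auto
  show ?case
  proof (cases "b < x")
    case True
    have level_powr: "(b / 2 ^ i) powr q = b powr q * ?\<theta> ^ i" for i
    proof -
      have "(b / 2 ^ i) powr q = b powr q / (2 powr real i) powr q"
        using Suc.prems by (simp add: powr_divide powr_realpow)
      also have "(2 powr real i) powr q = (2 powr q) powr real i" by (simp add: powr_powr mult.commute)
      also have "\<dots> = (2 powr q) ^ i" by (simp add: powr_realpow)
      finally show ?thesis by (simp add: powr_minus power_inverse divide_inverse)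
    qed
    have "(\<Sum>i<Suc n. if b / 2 ^ i < x then (b / 2 ^ i) powr q else 0) \<le> (\<Sum>i<Suc n. b powr q * ?\<theta> ^ i)"
      by (intro sum_mono) (simp add: level_powr th less_imp_le)
    also have "\<dots> = b powr q * (\<Sum>i<Suc n. ?\<theta> ^ i)" by (rule sum_distrib_left[symmetric])
    also have "\<dots> \<le> b powr q * (\<Sum>i. ?\<theta> ^ i)"
      using th by (intro mult_left_mono sum_le_suminf summable_geometric) auto
    also have "\<dots> = b powr q * (1 / (1 - ?\<theta>))" using th by (simp add: suminf_geometric)
    also have "\<dots> \<le> x powr q * (1 / (1 - ?\<theta>))"
      using True Suc.prems q th by (intro mult_right_mono powr_mono2) auto
    finally show ?thesis .
  next
    case False
    have "(\<Sum>i<Suc n. if b / 2 ^ i < x then (b / 2 ^ i) powr q else 0)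
        = (\<Sum>i<n. if b / 2 / 2 ^ i < x then (b / 2 / 2 ^ i) powr q else 0)"
    proof -
      have "b / 2 ^ Suc i = b / 2 / 2 ^ i" for i :: nat by simp
      then show ?thesis using False by (subst sum.lessThan_Suc_shift) (simp only: if_False power_0 div_by_1 add_0)
    qed
    also have "\<dots> \<le> x powr q * (1 / (1 - ?\<theta>))" using Suc.IH[of "b / 2"] Suc.prems by simp
    finally show ?thesis .
  qed
qed

lemma suminf_geometric_below:
  fixes b q x :: real
  assumes "0 < q" "0 < b"
  shows "(\<Sum>i. ennreal (if b / 2 ^ i < x then (b / 2 ^ i) powr q else 0)) \<le> ennreal (x powr q * (1 / (1 - 2 powr (- q))))"
proof (rule suminf_le_const[OF summableI])
  fix n
  have "(\<Sum>i<n. ennreal (if b / 2 ^ i < x then (b / 2 ^ i) powr q else 0))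
      = ennreal (\<Sum>i<n. if b / 2 ^ i < x then (b / 2 ^ i) powr q else 0)"
    by (rule sum_ennreal) simp
  then show "(\<Sum>i<n. ennreal (if b / 2 ^ i < x then (b / 2 ^ i) powr q else 0)) \<le> ennreal (x powr q * (1 / (1 - 2 powr (- q))))"
    using sum_geometric_below[OF assms] by (simp only: ennreal_leI)
qed

lemma ennreal_le_suminf: "g i \<le> (\<Sum>i. g i :: ennreal)"
  using sum_le_suminf[OF summableI, of "{i}" g] by simp

lemma powr_le_suminf_levels:
  fixes b p y :: real
  assumes p: "0 < p" and b: "0 < b" and y: "0 \<le> y" "y \<le> 2 * b"
  shows "ennreal (y powr p) \<le> (\<Sum>i. ennreal (if b / 2 ^ i < y then (2 * (b / 2 ^ i)) powr p else 0))"
proof (cases "y = 0")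
  case False
  obtain n where "(1 / 2) ^ n < y / b"
    using real_arch_pow_inv[of "y / b" "1 / 2"] False y b by auto
  then have ex: "\<exists>i. b / 2 ^ i < y" using b by (intro exI[of _ n]) (simp add: field_simps)
  define i where "i = (LEAST i. b / 2 ^ i < y)"
  have i: "b / 2 ^ i < y" unfolding i_def by (rule LeastI_ex[OF ex])
  have "y \<le> 2 * (b / 2 ^ i)"
  proof (cases i)
    case 0 then show ?thesis using y by simp
  next
    case (Suc j)
    then have "\<not> b / 2 ^ j < y" using not_less_Least[of j "\<lambda>i. b / 2 ^ i < y"] unfolding i_def by simp
    then show ?thesis using Suc by simp
  qed
  then have "ennreal (y powr p) \<le> ennreal (if b / 2 ^ i < y then (2 * (b / 2 ^ i)) powr p else 0)"
    using i y p by (auto intro!: ennreal_leI powr_mono2)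
  also have "\<dots> \<le> (\<Sum>i. ennreal (if b / 2 ^ i < y then (2 * (b / 2 ^ i)) powr p else 0))"
    by (rule ennreal_le_suminf[of "\<lambda>i. ennreal (if b / 2 ^ i < y then (2 * (b / 2 ^ i)) powr p else 0)" i])
  finally show ?thesis .
qed simp

lemma suminf_Suc_le: "(\<Sum>i. g (Suc i)) \<le> (\<Sum>i. g i :: ennreal)"
proof (rule suminf_le_const[OF summableI])
  fix n
  have "(\<Sum>i<n. g (Suc i)) \<le> (\<Sum>i<Suc n. g i)" by (subst sum.lessThan_Suc_shift) simp
  also have "\<dots> \<le> suminf g" by (rule sum_le_suminf) auto
  finally show "(\<Sum>i<n. g (Suc i)) \<le> (\<Sum>i. g i)" .
qed

text \<open>
  Let \<open>S\<close> be the sum of \<open>\<lambda>\<^sup>p |{\<psi> > \<lambda>}|\<close> over \<open>\<lambda> = b, b/2, b/4, \<dots>\<close>. The hypothesis at \<open>\<lambda>/2\<close> gives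
  \<open>S \<le> 2\<^sup>p R + S / 2\<close>, where \<open>R\<close> collects the terms with \<open>\<phi>\<close>. Here \<open>S\<close> is finite, since its
  terms are at most \<open>C \<lambda>\<^sup>p\<^sup>-\<^sup>1\<close> and \<open>p > 1\<close>; so \<open>S \<le> 2 (2\<^sup>p R)\<close> with a bound independent of \<open>b\<close>, and \<open>b\<close> may tend to infinity.
\<close>

lemma nn_integral_powr_le_of_good_lambda:
  fixes \<phi> \<psi> :: "real \<Rightarrow> real"
  assumes m: "\<phi> \<in> borel_measurable lebesgue" "\<psi> \<in> borel_measurable lebesgue"
    and nn: "\<And>t. 0 \<le> \<phi> t" "\<And>t. 0 \<le> \<psi> t" and p: "1 < p" and \<gamma>: "0 < \<gamma>" and C: "0 \<le> C"
    and weak: "\<And>l. 0 < l \<Longrightarrow> emeasure lebesgue {t. l < \<psi> t} \<le> ennreal (C / l)"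
    and gl: "\<And>l. 0 < l \<Longrightarrow> emeasure lebesgue {t. 2 * l < \<psi> t}
       \<le> ennreal (6 / (\<gamma> * l)) * (\<integral>\<^sup>+ t. ennreal (\<phi> t) * indicator {t. \<gamma> * l / 2 < \<phi> t} t \<partial>lebesgue)
          + ennreal (1 / (2 * 2 powr p)) * emeasure lebesgue {t. l < \<psi> t}"
  shows "(\<integral>\<^sup>+ t. ennreal (\<psi> t powr p) \<partial>lebesgue)
    \<le> ennreal (6 * (1 + 2 / (p - 1)) * (8 / \<gamma>) powr p) * (\<integral>\<^sup>+ t. ennreal (\<phi> t powr p) \<partial>lebesgue)"
    (is "_ \<le> ?rhs")
proof -
  let ?\<Phi> = "\<integral>\<^sup>+ t. ennreal (\<phi> t powr p) \<partial>lebesgue"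
  define \<kappa> where "\<kappa> = 1 / (1 - 2 powr (- (p - 1)))"
  have pm1: "0 < p - 1" using p by simp
  have kap: "0 \<le> \<kappa>" "\<kappa> \<le> 1 + 2 / (p - 1)"
    using inverse_one_minus_powr_le[of "p - 1"] p unfolding \<kappa>_def by auto
  define W where "W l = emeasure lebesgue {t. l < \<psi> t}" for l
  have lev: "{t. c < \<psi> t} \<in> sets lebesgue" "{t. c < \<phi> t} \<in> sets lebesgue" for c
    using borel_measurable_less[OF borel_measurable_const[of c] m(2)]
      borel_measurable_less[OF borel_measurable_const[of c] m(1)] by simp_all
  have m\<phi>: "(\<lambda>t. ennreal (\<phi> t)) \<in> borel_measurable lebesgue" using m(1) by measurable
  \<comment> \<open>Heights start at \<open>2\<^sup>n\<close>, so they only see the part of \<open>\<psi>\<close> below \<open>2 * 2\<^sup>n\<close>.\<close>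
  have main: "(\<integral>\<^sup>+ t. ennreal (\<psi> t powr p) * indicator {t. \<psi> t \<le> 2 * 2 ^ n} t \<partial>lebesgue) \<le> ?rhs" for n :: nat
  proof -
    define b :: real where "b = 2 ^ n"
    have b: "0 < b" by (simp add: b_def)
    define lam where "lam i = b / 2 ^ i" for i :: nat
    have lam: "0 < lam i" "lam i = 2 * lam (Suc i)" for i using b by (simp_all add: lam_def)
    define G where "G i = ennreal (lam i powr p) * W (lam i)" for i
    define R where "R i = ennreal (lam i powr p) * (ennreal (6 / (\<gamma> * lam i)) *
       (\<integral>\<^sup>+ t. ennreal (\<phi> t) * indicator {t. \<gamma> * lam i / 2 < \<phi> t} t \<partial>lebesgue))" for i
    have G_fin: "suminf G < \<infinity>"
    proof -
      have "G i \<le> ennreal (C * b powr (p - 1)) * ennreal ((2 powr (- (p - 1))) ^ i)" for i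
      proof -
        have "G i \<le> ennreal (lam i powr p) * ennreal (C / lam i)"
          unfolding G_def W_def using lam(1) by (intro mult_left_mono weak) auto
        also have "\<dots> = ennreal (lam i powr p * (C / lam i))" using C lam(1) by (intro ennreal_mult[symmetric]) (auto simp: less_imp_le)
        also have "lam i powr p * (C / lam i) = C * lam i powr (p - 1)"
          using lam(1)[of i] by (simp add: powr_diff)
        also have "lam i powr (p - 1) = b powr (p - 1) * (2 powr (- (p - 1))) ^ i"
        proof -
          have "(2 ^ i) powr (p - 1) = (2 powr (p - 1)) ^ i"
          proof -
            have "(2 ^ i) powr (p - 1) = (2 powr real i) powr (p - 1)" by (simp add: powr_realpow)
            also have "\<dots> = (2 powr (p - 1)) powr real i" by (simp only: powr_powr mult.commute)
            also have "\<dots> = (2 powr (p - 1)) ^ i" by (simp add: powr_realpow)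
            finally show ?thesis .
          qed
          then have "lam i powr (p - 1) = b powr (p - 1) / (2 powr (p - 1)) ^ i"
            using b by (simp add: lam_def powr_divide)
          moreover have "(2 powr (- (p - 1))) ^ i = 1 / (2 powr (p - 1)) ^ i"
            by (simp only: powr_minus_divide power_one_over)
          ultimately show ?thesis by simp
        qed
        also have "ennreal (C * (b powr (p - 1) * (2 powr (- (p - 1))) ^ i))
            = ennreal (C * b powr (p - 1)) * ennreal ((2 powr (- (p - 1))) ^ i)"
          using C by (subst ennreal_mult[symmetric]) (auto simp: mult.assoc)
        finally show ?thesis .
      qed
      then have "suminf G \<le> (\<Sum>i. ennreal (C * b powr (p - 1)) * ennreal ((2 powr (- (p - 1))) ^ i))"
        by (intro suminf_le) auto
      also have "\<dots> = ennreal (C * b powr (p - 1)) * ennreal \<kappa>"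
        by (simp only: ennreal_suminf_cmult \<kappa>_def suminf_geometric_powr[OF pm1])
      also have "\<dots> < \<infinity>" by (simp add: ennreal_mult_less_top)
      finally show ?thesis .
    qed
    have step: "G i \<le> ennreal (2 powr p) * R (Suc i) + ennreal (1 / 2) * G (Suc i)" for i
    proof -
      let ?l = "lam (Suc i)"
      let ?X = "ennreal (6 / (\<gamma> * ?l)) * (\<integral>\<^sup>+ t. ennreal (\<phi> t) * indicator {t. \<gamma> * ?l / 2 < \<phi> t} t \<partial>lebesgue)"
      have "lam i powr p = 2 powr p * ?l powr p" unfolding lam(2)[of i] using lam(1)[of "Suc i"] by (simp add: powr_mult)
      then have e1: "ennreal (lam i powr p) = ennreal (2 powr p) * ennreal (?l powr p)" by (simp add: ennreal_mult)
      have "G i \<le> ennreal (lam i powr p) * (?X + ennreal (1 / (2 * 2 powr p)) * W ?l)"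
        unfolding G_def W_def lam(2)[of i] by (intro mult_left_mono gl lam(1)) simp
      also have "\<dots> = ennreal (2 powr p) * R (Suc i) + (ennreal (2 powr p) * ennreal (1 / (2 * 2 powr p))) * G (Suc i)"
        unfolding e1 R_def G_def by (simp add: distrib_left mult_ac)
      also have "ennreal (2 powr p) * ennreal (1 / (2 * 2 powr p)) = ennreal (1 / 2)"
        by (subst ennreal_mult[symmetric]) auto
      finally show ?thesis .
    qed
    have "suminf G \<le> (\<Sum>i. ennreal (2 powr p) * R (Suc i) + ennreal (1 / 2) * G (Suc i))"
      by (intro suminf_le step) auto
    also have "\<dots> = ennreal (2 powr p) * (\<Sum>i. R (Suc i)) + ennreal (1 / 2) * (\<Sum>i. G (Suc i))"
      by (simp add: suminf_add[symmetric] ennreal_suminf_cmult)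
    also have "\<dots> \<le> ennreal (2 powr p) * suminf R + ennreal (1 / 2) * suminf G"
      by (intro add_mono mult_left_mono suminf_Suc_le) auto
    finally have absorb: "suminf G \<le> ennreal (2 powr p) * suminf R + ennreal (1 / 2) * suminf G" .
    have G_le: "suminf G \<le> 2 * (ennreal (2 powr p) * suminf R)"
    proof (cases "ennreal (2 powr p) * suminf R")
      case top
      then show ?thesis by (simp add: ennreal_mult_top)
    next
      case (real x)
      obtain y where y: "suminf G = ennreal y" "0 \<le> y" using G_fin by (cases "suminf G") auto
      have "ennreal y \<le> ennreal x + ennreal (1 / 2) * ennreal y"
        using absorb unfolding real(2) y(1) .
      also have "ennreal (1 / 2) * ennreal y = ennreal (1 / 2 * y)"
        using y(2) by (intro ennreal_mult[symmetric]) auto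
      also have "ennreal x + ennreal (1 / 2 * y) = ennreal (x + 1 / 2 * y)"
        using real(1) y(2) by (intro ennreal_plus[symmetric]) auto
      finally have "y \<le> x + 1 / 2 * y" using real(1) y(2) by (subst (asm) ennreal_le_iff) auto
      then have "y \<le> 2 * x" by simp
      then have "ennreal y \<le> ennreal (2 * x)" by (rule ennreal_leI)
      then show ?thesis using real y by (simp add: ennreal_mult)
    qed
    have R_le: "suminf R \<le> ennreal (3 * (2 / \<gamma>) powr p * \<kappa>) * ?\<Phi>"
    proof -
      define g where "g i t = (if lam i < 2 * \<phi> t / \<gamma> then lam i powr (p - 1) else 0)" for i t
      have g_meas: "(\<lambda>t. ennreal (\<phi> t) * ennreal (g i t)) \<in> borel_measurable lebesgue" for i
      proof -
        have "g i \<in> borel_measurable lebesgue" unfolding g_def using m(1) by measurable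
        then have "(\<lambda>t. ennreal (g i t)) \<in> borel_measurable lebesgue" by (rule measurable_compose[OF _ measurable_ennreal])
        then show ?thesis by (rule borel_measurable_times_ennreal[OF m\<phi>])
      qed
      have "R i = ennreal (6 / \<gamma>) * (\<integral>\<^sup>+ t. ennreal (\<phi> t) * ennreal (g i t) \<partial>lebesgue)" for i
      proof -
        have "lam i powr p * (6 / (\<gamma> * lam i)) = 6 / \<gamma> * lam i powr (p - 1)"
          using lam(1)[of i] \<gamma> by (simp add: powr_diff)
        then have "ennreal (lam i powr p) * ennreal (6 / (\<gamma> * lam i)) = ennreal (6 / \<gamma>) * ennreal (lam i powr (p - 1))"
          using lam(1)[of i] \<gamma> by (simp add: ennreal_mult[symmetric] less_imp_le)
        then have "R i = ennreal (6 / \<gamma>) * (ennreal (lam i powr (p - 1)) *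
            (\<integral>\<^sup>+ t. ennreal (\<phi> t) * indicator {t. \<gamma> * lam i / 2 < \<phi> t} t \<partial>lebesgue))"
          unfolding R_def by (simp add: mult.assoc[symmetric])
        also have "ennreal (lam i powr (p - 1)) * (\<integral>\<^sup>+ t. ennreal (\<phi> t) * indicator {t. \<gamma> * lam i / 2 < \<phi> t} t \<partial>lebesgue)
            = (\<integral>\<^sup>+ t. ennreal (lam i powr (p - 1)) * (ennreal (\<phi> t) * indicator {t. \<gamma> * lam i / 2 < \<phi> t} t) \<partial>lebesgue)"
          by (intro nn_integral_cmult[symmetric] borel_measurable_times_ennreal m\<phi> borel_measurable_indicator lev)
        also have "\<dots> = (\<integral>\<^sup>+ t. ennreal (\<phi> t) * ennreal (g i t) \<partial>lebesgue)"
        proof (rule nn_integral_cong)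
          fix t
          have "\<gamma> * lam i / 2 < \<phi> t \<longleftrightarrow> lam i < 2 * \<phi> t / \<gamma>" using \<gamma> by (simp add: field_simps)
          then show "ennreal (lam i powr (p - 1)) * (ennreal (\<phi> t) * indicator {t. \<gamma> * lam i / 2 < \<phi> t} t)
            = ennreal (\<phi> t) * ennreal (g i t)" by (simp add: g_def indicator_def mult.commute)
        qed
        finally show ?thesis .
      qed
      then have "R = (\<lambda>i. ennreal (6 / \<gamma>) * (\<integral>\<^sup>+ t. ennreal (\<phi> t) * ennreal (g i t) \<partial>lebesgue))"
        by (rule ext)
      then have "suminf R = ennreal (6 / \<gamma>) * (\<Sum>i. \<integral>\<^sup>+ t. ennreal (\<phi> t) * ennreal (g i t) \<partial>lebesgue)"
        by (simp only: ennreal_suminf_cmult)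
      also have "(\<Sum>i. \<integral>\<^sup>+ t. ennreal (\<phi> t) * ennreal (g i t) \<partial>lebesgue) = (\<integral>\<^sup>+ t. (\<Sum>i. ennreal (\<phi> t) * ennreal (g i t)) \<partial>lebesgue)"
        by (rule nn_integral_suminf[OF g_meas, symmetric])
      also have "\<dots> \<le> (\<integral>\<^sup>+ t. ennreal ((2 / \<gamma>) powr (p - 1) * \<kappa>) * ennreal (\<phi> t powr p) \<partial>lebesgue)"
      proof (rule nn_integral_mono)
        fix t
        have "(\<Sum>i. ennreal (g i t)) \<le> ennreal ((2 * \<phi> t / \<gamma>) powr (p - 1) * \<kappa>)"
          unfolding g_def lam_def \<kappa>_def using p b by (intro suminf_geometric_below) auto
        then have "ennreal (\<phi> t) * (\<Sum>i. ennreal (g i t)) \<le> ennreal (\<phi> t) * ennreal ((2 * \<phi> t / \<gamma>) powr (p - 1) * \<kappa>)"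
          by (rule mult_left_mono) simp
        also have "\<dots> = ennreal (\<phi> t * ((2 * \<phi> t / \<gamma>) powr (p - 1) * \<kappa>))"
          using nn(1)[of t] kap by (intro ennreal_mult[symmetric]) auto
        also have "\<phi> t * ((2 * \<phi> t / \<gamma>) powr (p - 1) * \<kappa>) = (2 / \<gamma>) powr (p - 1) * \<kappa> * \<phi> t powr p"
        proof -
          have "(2 * \<phi> t / \<gamma>) powr (p - 1) = (2 / \<gamma>) powr (p - 1) * \<phi> t powr (p - 1)"
            using nn(1)[of t] \<gamma> powr_mult[of "2 / \<gamma>" "\<phi> t" "p - 1"] by (simp add: mult.commute)
          moreover have "\<phi> t powr p = \<phi> t * \<phi> t powr (p - 1)"
            using nn(1)[of t] powr_add[of "\<phi> t" 1 "p - 1"] by simp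
          ultimately show ?thesis by simp
        qed
        also have "ennreal ((2 / \<gamma>) powr (p - 1) * \<kappa> * \<phi> t powr p) = ennreal ((2 / \<gamma>) powr (p - 1) * \<kappa>) * ennreal (\<phi> t powr p)"
          using kap by (intro ennreal_mult) auto
        finally show "(\<Sum>i. ennreal (\<phi> t) * ennreal (g i t)) \<le> ennreal ((2 / \<gamma>) powr (p - 1) * \<kappa>) * ennreal (\<phi> t powr p)"
          by (simp add: ennreal_suminf_cmult)
      qed
      also have "\<dots> = ennreal ((2 / \<gamma>) powr (p - 1) * \<kappa>) * ?\<Phi>"
      proof (rule nn_integral_cmult)
        show "(\<lambda>t. ennreal (\<phi> t powr p)) \<in> borel_measurable lebesgue" using m(1) by measurable
      qed
      finally have "suminf R \<le> ennreal (6 / \<gamma>) * (ennreal ((2 / \<gamma>) powr (p - 1) * \<kappa>) * ?\<Phi>)"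
        by (simp add: mult_left_mono)
      also have "\<dots> = ennreal (6 / \<gamma> * ((2 / \<gamma>) powr (p - 1) * \<kappa>)) * ?\<Phi>"
        using \<gamma> kap by (subst ennreal_mult) (auto simp: mult.assoc)
      also have "6 / \<gamma> * ((2 / \<gamma>) powr (p - 1) * \<kappa>) = 3 * (2 / \<gamma>) powr p * \<kappa>"
      proof -
        have "(2 / \<gamma>) powr p = 2 / \<gamma> * (2 / \<gamma>) powr (p - 1)"
          using \<gamma> powr_add[of "2 / \<gamma>" 1 "p - 1"] by simp
        then show ?thesis by simp
      qed
      finally show ?thesis .
    qed
    have "(\<integral>\<^sup>+ t. ennreal (\<psi> t powr p) * indicator {t. \<psi> t \<le> 2 * 2 ^ n} t \<partial>lebesgue)
      \<le> (\<integral>\<^sup>+ t. (\<Sum>i. ennreal ((2 * lam i) powr p) * indicator {t. lam i < \<psi> t} t) \<partial>lebesgue)"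
    proof (rule nn_integral_mono)
      fix t
      have eq: "ennreal (if b / 2 ^ i < \<psi> t then (2 * (b / 2 ^ i)) powr p else 0)
         = ennreal ((2 * lam i) powr p) * indicator {t. lam i < \<psi> t} t" for i by (simp add: lam_def)
      show "ennreal (\<psi> t powr p) * indicator {t. \<psi> t \<le> 2 * 2 ^ n} t
          \<le> (\<Sum>i. ennreal ((2 * lam i) powr p) * indicator {t. lam i < \<psi> t} t)"
      proof (cases "\<psi> t \<le> 2 * b")
        case True
        then show ?thesis using powr_le_suminf_levels[of p b "\<psi> t"] p b nn(2)[of t] unfolding eq by (simp add: b_def)
      qed (simp add: b_def)
    qed
    also have "\<dots> = (\<Sum>i. \<integral>\<^sup>+ t. ennreal ((2 * lam i) powr p) * indicator {t. lam i < \<psi> t} t \<partial>lebesgue)"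
      by (intro nn_integral_suminf borel_measurable_times_ennreal borel_measurable_indicator lev) simp
    also have "\<dots> = (\<Sum>i. ennreal (2 powr p) * G i)"
    proof (rule arg_cong[where f = suminf], rule ext)
      fix i
      have e: "ennreal ((2 * lam i) powr p) = ennreal (2 powr p) * ennreal (lam i powr p)"
        using lam(1)[of i] by (simp add: powr_mult ennreal_mult)
      show "(\<integral>\<^sup>+ t. ennreal ((2 * lam i) powr p) * indicator {t. lam i < \<psi> t} t \<partial>lebesgue) = ennreal (2 powr p) * G i"
        unfolding nn_integral_cmult_indicator[OF lev(1)] e G_def W_def by (rule mult.assoc)
    qed
    also have "\<dots> = ennreal (2 powr p) * suminf G" by (simp add: ennreal_suminf_cmult)
    also have "\<dots> \<le> ennreal (2 powr p) * (2 * (ennreal (2 powr p) * (ennreal (3 * (2 / \<gamma>) powr p * \<kappa>) * ?\<Phi>)))"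
      by (intro mult_left_mono order_trans[OF G_le] R_le) auto
    also have "\<dots> = ennreal (2 powr p * (2 * (2 powr p * (3 * (2 / \<gamma>) powr p * \<kappa>)))) * ?\<Phi>"
    proof -
      have "ennreal (2 powr p * (2 * (2 powr p * z))) = ennreal (2 powr p) * (2 * (ennreal (2 powr p) * ennreal z))"
        if "0 \<le> z" for z using that by (simp add: ennreal_mult)
      moreover have "0 \<le> 3 * (2 / \<gamma>) powr p * \<kappa>" using kap by simp
      ultimately show ?thesis by (simp only: mult.assoc)
    qed
    also have "\<dots> \<le> ?rhs"
    proof (intro mult_right_mono ennreal_leI)
      have "(8 / \<gamma>) powr p = 2 powr p * (2 powr p * (2 / \<gamma>) powr p)"
        using \<gamma> powr_mult[of 2 "2 / \<gamma>" p] powr_mult[of 2 "4 / \<gamma>" p] by simp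
      then have "2 powr p * (2 * (2 powr p * (3 * (2 / \<gamma>) powr p * \<kappa>))) = 6 * \<kappa> * (8 / \<gamma>) powr p" by simp
      also have "\<dots> \<le> 6 * (1 + 2 / (p - 1)) * (8 / \<gamma>) powr p"
        using kap by (intro mult_right_mono mult_left_mono) auto
      finally show "2 powr p * (2 * (2 powr p * (3 * (2 / \<gamma>) powr p * \<kappa>))) \<le> 6 * (1 + 2 / (p - 1)) * (8 / \<gamma>) powr p" .
    qed simp
    finally show ?thesis .
  qed
  have "(\<integral>\<^sup>+ t. ennreal (\<psi> t powr p) \<partial>lebesgue)
      = (\<integral>\<^sup>+ t. (SUP n. ennreal (\<psi> t powr p) * indicator {t. \<psi> t \<le> 2 * 2 ^ n} t) \<partial>lebesgue)"
  proof (rule nn_integral_cong)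
    fix t
    show "ennreal (\<psi> t powr p) = (SUP n. ennreal (\<psi> t powr p) * indicator {t. \<psi> t \<le> 2 * 2 ^ n} t)"
    proof (rule antisym)
      obtain n where "\<psi> t < 2 ^ n" using real_arch_pow[of 2 "\<psi> t"] by auto
      moreover have "(2::real) ^ n \<le> 2 * 2 ^ n" by simp
      ultimately have "\<psi> t \<le> 2 * 2 ^ n" by linarith
      then show "ennreal (\<psi> t powr p) \<le> (SUP n. ennreal (\<psi> t powr p) * indicator {t. \<psi> t \<le> 2 * 2 ^ n} t)"
        by (intro SUP_upper2[of n]) auto
    qed (auto intro!: SUP_least simp: indicator_def)
  qed
  also have "\<dots> = (SUP n. \<integral>\<^sup>+ t. ennreal (\<psi> t powr p) * indicator {t. \<psi> t \<le> 2 * 2 ^ n} t \<partial>lebesgue)"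
  proof (rule nn_integral_monotone_convergence_SUP)
    show "incseq (\<lambda>n t. ennreal (\<psi> t powr p) * indicator {t. \<psi> t \<le> 2 * 2 ^ n} t)"
    proof (intro incseq_SucI le_funI)
      fix n t
      have "(2::real) * 2 ^ n \<le> 2 * 2 ^ Suc n" by simp
      then have "\<psi> t \<le> 2 * 2 ^ n \<Longrightarrow> \<psi> t \<le> 2 * 2 ^ Suc n" by linarith
      then show "ennreal (\<psi> t powr p) * indicator {t. \<psi> t \<le> 2 * 2 ^ n} t \<le> ennreal (\<psi> t powr p) * indicator {t. \<psi> t \<le> 2 * 2 ^ Suc n} t"
        by (auto simp: indicator_def)
    qed
    show "(\<lambda>t. ennreal (\<psi> t powr p) * indicator {t. \<psi> t \<le> 2 * 2 ^ n} t) \<in> borel_measurable lebesgue" for n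
    proof (rule borel_measurable_times_ennreal)
      show "(\<lambda>t. ennreal (\<psi> t powr p)) \<in> borel_measurable lebesgue" using m(2) by measurable
      show "indicator {t. \<psi> t \<le> 2 * 2 ^ n} \<in> borel_measurable lebesgue"
      proof (rule borel_measurable_indicator)
        have "{t. \<psi> t \<le> 2 * 2 ^ n} = UNIV - {t. 2 * 2 ^ n < \<psi> t}" by auto
        also have "\<dots> \<in> sets lebesgue" by (intro sets.Diff lev) simp
        finally show "{t. \<psi> t \<le> 2 * 2 ^ n} \<in> sets lebesgue" .
      qed
    qed
  qed
  also have "\<dots> \<le> ?rhs" by (rule SUP_least) (rule main)
  finally show ?thesis .
qed

section \<open>The strong type inequality and the theorem\<close>

lemma weak_type_const_ge:
  assumes "0 < \<sigma>" shows "100 / \<sigma> \<le> weak_type_const \<sigma>"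
proof -
  have "1 + (1000 / \<sigma>) / 2 \<le> 2 powr (1000 / \<sigma>)" using assms by (intro one_plus_half_le_powr) simp
  moreover have "100 / \<sigma> \<le> (1000 / \<sigma>) / 2" using assms by (simp add: field_simps)
  ultimately show ?thesis unfolding weak_type_const_def by linarith
qed

lemma strong_type_const_ge:
  assumes s: "0 < \<sigma>" and p: "1 < p"
  shows "6 * (1 + 2 / (p - 1)) * (16 * (400 / (\<sigma> * 2 powr (- p - 4)))) \<le> strong_type_const p \<sigma>"
proof -
  have 1: "1 + 2 / (p - 1) \<le> 2 powr (4 / (p - 1))"
  proof -
    have "4 / (p - 1) / 2 = 2 / (p - 1)" using p by (simp add: field_simps)
    then show ?thesis using one_plus_half_le_powr[of "4 / (p - 1)"] p by force
  qed
  have 2: "1 / \<sigma> \<le> 2 powr (2 / \<sigma>)"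
    using one_plus_half_le_powr[of "2 / \<sigma>"] s by simp
  have e: "2 powr (- p - 4) = 1 / 2 powr (p + 4)"
    using powr_minus_divide[of 2 "p + 4"] by simp
  have "6 * (1 + 2 / (p - 1)) * (16 * (400 / (\<sigma> * 2 powr (- p - 4))))
      = 38400 * (1 + 2 / (p - 1)) * (1 / \<sigma>) * 2 powr (p + 4)"
    unfolding e by simp
  also have "\<dots> \<le> 2 powr 16 * 2 powr (4 / (p - 1)) * 2 powr (2 / \<sigma>) * 2 powr (p + 4)"
  proof (intro mult_mono 1 2)
    have "2 powr (16::real) = 2 ^ 16" using powr_realpow[of 2 16] by simp
    then show "38400 \<le> 2 powr (16::real)" by simp
  qed (use s p in auto)
  also have "\<dots> = 2 powr (16 + 4 / (p - 1) + 2 / \<sigma> + (p + 4))" by (simp only: powr_add)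
  also have "\<dots> \<le> strong_type_const p \<sigma>"
    unfolding strong_type_const_def
  proof (rule powr_mono)
    have "0 \<le> 1 / (p - 1)" "0 \<le> 1 / \<sigma>" using s p by auto
    moreover have "4 / (p - 1) = 4 * (1 / (p - 1))" "2 / \<sigma> = 2 * (1 / \<sigma>)" by simp_all
    ultimately show "16 + 4 / (p - 1) + 2 / \<sigma> + (p + 4) \<le> 1000 * (p + 1 / (p - 1) + 1 / \<sigma>)"
      using p by argo
  qed simp
  finally show ?thesis .
qed

lemma le_ennreal_limit:
  fixes g :: "real \<Rightarrow> real"
  assumes "\<And>e. 0 < e \<Longrightarrow> x \<le> ennreal (g e)" "(g \<longlongrightarrow> g0) (at_right 0)"
  shows "x \<le> ennreal g0"
proof (rule tendsto_lowerbound)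
  show "((\<lambda>e. ennreal (g e)) \<longlongrightarrow> ennreal g0) (at_right 0)" by (rule tendsto_ennrealI[OF assms(2)])
  show "\<forall>\<^sub>F e in at_right 0. x \<le> ennreal (g e)"
    using assms(1) by (auto simp: eventually_at_right_field intro!: exI[of _ 1])
qed simp

lemma Lp_norm_cong:
  assumes "\<And>t. 0 < t \<Longrightarrow> f t = g t" shows "Lp_norm q f = Lp_norm q g"
proof -
  have "(\<integral>\<^sup>+ t. ennreal (norm (f t) powr enn2real q) \<partial>halfline) = (\<integral>\<^sup>+ t. ennreal (norm (g t) powr enn2real q) \<partial>halfline)"
    by (intro nn_integral_cong) (simp add: assms)
  moreover have "esssup halfline (\<lambda>t. ennreal (norm (f t))) = esssup halfline (\<lambda>t. ennreal (norm (g t)))"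
  proof -
    have "(\<lambda>t. ennreal (norm (f t))) \<in> borel_measurable halfline \<longleftrightarrow> (\<lambda>t. ennreal (norm (g t))) \<in> borel_measurable halfline"
      by (rule measurable_cong) (simp add: assms)
    moreover have "Limsup (ae_filter halfline) (\<lambda>t. ennreal (norm (f t))) = Limsup (ae_filter halfline) (\<lambda>t. ennreal (norm (g t)))"
    proof (rule Limsup_eq)
      show "AE t in halfline. ennreal (norm (f t)) = ennreal (norm (g t))"
        unfolding AE_halfline by (simp add: assms)
    qed
    ultimately show ?thesis unfolding esssup_def by simp
  qed
  ultimately show ?thesis unfolding Lp_norm_def by simp
qed

lemma Lp_space_cong:
  assumes g: "g \<in> Lp_space q" and eq: "\<And>t. 0 < t \<Longrightarrow> f t = g t" shows "f \<in> Lp_space q"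
proof -
  obtain s where s: "\<And>i::nat. simple_function halfline (s i)" "AE t in halfline. (\<lambda>i. s i t) \<longlonglongrightarrow> g t"
    using g by (auto simp: Lp_space_def strongly_measurable_def)
  have "AE t in halfline. (\<lambda>i. s i t) \<longlonglongrightarrow> f t"
    using s(2) unfolding AE_halfline by eventually_elim (simp add: eq)
  then have "strongly_measurable halfline f" unfolding strongly_measurable_def using s(1) by blast
  moreover have "Lp_norm q f = Lp_norm q g" by (rule Lp_norm_cong[OF eq])
  ultimately show ?thesis using g by (simp add: Lp_space_def)
qed

context volterra_operator
begin

text \<open>
  The maximal function of \<open>|f|\<close> controls \<open>|T f|\<close> through \<open>good_lambda\<close>. The parameter of \<open>T_oscillation\<close>
  has to satisfy \<open>8 e 2\<^sup>p = 1/2\<close>; hence the growth of the constant, which is exponential in \<open>p\<close>.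
\<close>

lemma strong_type:
  assumes f: "admissible a f" and D: "0 < D" "B \<le> D" "M \<le> D" and p: "1 < p"
  shows "(\<integral>\<^sup>+ t. ennreal (norm (T f t) powr p) \<partial>halfline)
    \<le> ennreal ((strong_type_const p \<sigma> * D) powr p) * (\<integral>\<^sup>+ t. ennreal (norm (f t) powr p) \<partial>lebesgue)"
proof -
  define e where "e = 2 powr (- p - 4)"
  have e: "0 < e" "e < 1 / 2" "8 * e = 1 / (2 * 2 powr p)"
  proof -
    show "0 < e" by (simp add: e_def)
    have p4: "2 powr (4::real) = 16" using powr_realpow[of 2 4] by simp
    have e16: "e = 1 / (16 * 2 powr p)"
      using powr_add[of 2 p 4] powr_minus_divide[of 2 "p + 4"] by (simp add: e_def p4)
    have "1 \<le> 2 powr p" using p by (intro ge_one_powr_ge_zero) auto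
    then show "e < 1 / 2" unfolding e16 by (simp add: field_simps)
    show "8 * e = 1 / (2 * 2 powr p)" unfolding e16 by simp
  qed
  define A where "A = 400 * D / (\<sigma> * e)"
  have A: "0 < A" using D sigma e by (simp add: A_def)
  define \<gamma> where "\<gamma> = 1 / (2 * A)"
  have \<gamma>: "0 < \<gamma>" using A by (simp add: \<gamma>_def)
  define \<phi> where "\<phi> = (\<lambda>t. norm (f t))"
  define \<psi> where "\<psi> t = indicator {a..} t * norm (T f t)" for t
  have \<phi>: "\<phi> \<in> borel_measurable lebesgue" "\<And>t. t < a \<Longrightarrow> \<phi> t = 0" "\<And>t. 0 \<le> \<phi> t"
    using admissible_norm_measurable[OF f] admissible_eq_0[OF f] by (auto simp: \<phi>_def)
  have \<phi>_fin: "(\<integral>\<^sup>+ t. ennreal (\<phi> t) \<partial>lebesgue) < \<infinity>" unfolding \<phi>_def by (rule admissible_integral_finite[OF f])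
  have \<psi>m: "\<psi> \<in> borel_measurable lebesgue"
  proof -
    have "(\<lambda>t. norm (T f t)) \<in> borel_measurable halfline"
      by (rule strongly_measurable_norm[OF _ T_strongly_measurable[OF f]]) simp
    then have "(\<lambda>t. indicator {0<..} t *\<^sub>R norm (T f t)) \<in> borel_measurable lebesgue"
      by (subst (asm) borel_measurable_restrict_space_iff) auto
    then have "(\<lambda>t. indicator {a..} t * (indicator {0<..} t *\<^sub>R norm (T f t))) \<in> borel_measurable lebesgue"
      by (rule borel_measurable_times[rotated]) (rule borel_measurable_indicator, simp)
    also have "(\<lambda>t. indicator {a..} t * (indicator {0<..} t *\<^sub>R norm (T f t))) = \<psi>"
      using a by (auto simp: fun_eq_iff \<psi>_def indicator_def)
    finally show ?thesis .
  qed
  have lev: "{t. l < \<psi> t} \<subseteq> super_level (T f) l" if "0 < l" for l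
    using that a by (auto simp: \<psi>_def super_level_def indicator_def split: if_splits)
  obtain I where I: "(\<integral>\<^sup>+ t. ennreal (norm (f t)) \<partial>lebesgue) \<le> ennreal I" "0 < I"
  proof -
    obtain x where "(\<integral>\<^sup>+ t. ennreal (norm (f t)) \<partial>lebesgue) = ennreal x" "0 \<le> x"
      using admissible_integral_finite[OF f] by (cases "\<integral>\<^sup>+ t. ennreal (norm (f t)) \<partial>lebesgue") auto
    then show thesis by (intro that[of "x + 1"]) auto
  qed
  have weak: "emeasure lebesgue {t. l < \<psi> t} \<le> ennreal (100 * D * I / \<sigma> / l)" if l: "0 < l" for l
  proof -
    have "emeasure lebesgue {t. l < \<psi> t} \<le> emeasure lebesgue (super_level (T f) l)"
      by (intro emeasure_mono lev l super_level_sets T_strongly_measurable f)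
    also have "\<dots> \<le> ennreal (100 * D * I / (\<sigma> * l))" by (rule weak_type[OF f D l I])
    finally show ?thesis by simp
  qed
  have "(\<integral>\<^sup>+ t. ennreal (norm (T f t) powr p) \<partial>halfline) = (\<integral>\<^sup>+ t. ennreal (\<psi> t powr p) \<partial>lebesgue)"
    unfolding nn_integral_halfline
  proof (rule nn_integral_cong_AE)
    have "AE t in halfline. t < a \<longrightarrow> T f t = 0"
      by (rule T_causal[OF f _ a]) (rule admissible_eq_0[OF f])
    then show "AE t in lebesgue. ennreal (norm (T f t) powr p) * indicator {0<..} t = ennreal (\<psi> t powr p)"
      unfolding AE_halfline by eventually_elim (use a in \<open>auto simp: \<psi>_def indicator_def\<close>)
  qed
  also have "\<dots> \<le> ennreal (6 * (1 + 2 / (p - 1)) * (8 / \<gamma>) powr p) * (\<integral>\<^sup>+ t. ennreal (\<phi> t powr p) \<partial>lebesgue)"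
  proof (rule nn_integral_powr_le_of_good_lambda[OF \<phi>(1) \<psi>m \<phi>(3) _ p \<gamma> _ weak])
    show "0 \<le> \<psi> t" for t by (simp add: \<psi>_def)
    show "0 \<le> 100 * D * I / \<sigma>" using D I sigma by simp
    fix l :: real assume l: "0 < l"
    have gl: "\<gamma> * l = l / (2 * A)" by (simp add: \<gamma>_def)
    have "emeasure lebesgue {t. 2 * l < \<psi> t}
        \<le> emeasure lebesgue (maximal_level a \<phi> (l / (2 * A))) + ennreal (8 * e) * emeasure lebesgue {t. l < \<psi> t}"
    proof (rule good_lambda[OF \<psi>m _ l A e(1,2)])
      show "\<psi> t = 0" if "t < a" for t using that by (simp add: \<psi>_def)
      show "emeasure lebesgue {t. l < \<psi> t} < \<infinity>" using weak[OF l] by (rule le_less_trans) simp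
      fix J assume avg: "\<And>j. (\<integral>\<^sup>+ t. ennreal (\<phi> t) * indicator (left_triple a (ancestor j J)) t \<partial>lebesgue)
        \<le> ennreal (3 * side (ancestor j J) * (l / (2 * A)))"
      obtain c where c: "emeasure lebesgue {t \<in> cell a J. 400 * D / (\<sigma> * e) * (l / (2 * A)) < \<bar>norm (T f t) - c\<bar>}
          \<le> ennreal (e * side J)"
      proof -
        have "e \<le> 1" using e(2) by simp
        moreover have "0 < l / (2 * A)" using l A by (intro divide_pos_pos) auto
        ultimately show thesis using T_oscillation[OF f D e(1) _ _ avg[unfolded \<phi>_def]] that by blast
      qed
      have "400 * D / (\<sigma> * e) * (l / (2 * A)) = l / 2" using A by (simp add: A_def[symmetric])
      moreover have "\<psi> t = norm (T f t)" if "t \<in> cell a J" for t using cell_ge[OF that] by (simp add: \<psi>_def)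
      ultimately have "{t \<in> cell a J. l / 2 < \<bar>\<psi> t - c\<bar>}
          = {t \<in> cell a J. 400 * D / (\<sigma> * e) * (l / (2 * A)) < \<bar>norm (T f t) - c\<bar>}" by auto
      then show "\<exists>c. emeasure lebesgue {t \<in> cell a J. l / 2 < \<bar>\<psi> t - c\<bar>} \<le> ennreal (e * side J)"
        using c by metis
    qed
    also have "emeasure lebesgue (maximal_level a \<phi> (l / (2 * A)))
      \<le> ennreal (6 / (\<gamma> * l)) * (\<integral>\<^sup>+ t. ennreal (\<phi> t) * indicator {t. \<gamma> * l / 2 < \<phi> t} t \<partial>lebesgue)"
      unfolding gl by (rule maximal_level_truncated[OF \<phi> \<phi>_fin]) (use l A in \<open>auto intro: divide_pos_pos\<close>)
    finally show "emeasure lebesgue {t. 2 * l < \<psi> t}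
       \<le> ennreal (6 / (\<gamma> * l)) * (\<integral>\<^sup>+ t. ennreal (\<phi> t) * indicator {t. \<gamma> * l / 2 < \<phi> t} t \<partial>lebesgue)
          + ennreal (1 / (2 * 2 powr p)) * emeasure lebesgue {t. l < \<psi> t}"
      unfolding e(3) by (simp add: add_right_mono)
  qed
  also have "\<dots> \<le> ennreal ((strong_type_const p \<sigma> * D) powr p) * (\<integral>\<^sup>+ t. ennreal (\<phi> t powr p) \<partial>lebesgue)"
  proof (intro mult_right_mono ennreal_leI)
    define c0 where "c0 = 6 * (1 + 2 / (p - 1))"
    have c0: "1 \<le> c0" using p by (simp add: c0_def)
    have "c0 powr 1 \<le> c0 powr p" using c0 p by (intro powr_mono) auto
    then have "c0 * (8 / \<gamma>) powr p \<le> c0 powr p * (8 / \<gamma>) powr p"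
      using c0 by (intro mult_right_mono) auto
    also have "\<dots> = (c0 * (8 / \<gamma>)) powr p" by (subst powr_mult) (use c0 \<gamma> in auto)
    also have "c0 * (8 / \<gamma>) = c0 * (16 * (400 / (\<sigma> * e))) * D" by (simp add: \<gamma>_def A_def)
    also have "(c0 * (16 * (400 / (\<sigma> * e))) * D) powr p \<le> (strong_type_const p \<sigma> * D) powr p"
      using strong_type_const_ge[OF sigma(1) p] c0 sigma e D p unfolding c0_def e_def
      by (intro powr_mono2 mult_right_mono) auto
    finally show "6 * (1 + 2 / (p - 1)) * (8 / \<gamma>) powr p \<le> (strong_type_const p \<sigma> * D) powr p"
      by (simp add: c0_def)
  qed simp
  finally show ?thesis by (simp add: \<phi>_def)
qed

lemma T_cong:
  assumes g: "admissible a g" and fg: "\<And>t. 0 < t \<Longrightarrow> f t = g t"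
  shows "AE t in halfline. T f t = T g t"
proof -
  have "AE t in halfline. f t = g t" unfolding AE_halfline by (simp add: fg)
  then show ?thesis using linear admissible_Lp[OF g] Lp_space_cong[OF admissible_Lp[OF g] fg]
    unfolding Lp_linear_operator_def by blast
qed

lemma admissible_Lp_integral:
  assumes g: "admissible a g"
  shows "(\<integral>\<^sup>+ t. ennreal (norm (g t) powr q) \<partial>halfline) = (\<integral>\<^sup>+ t. ennreal (norm (g t) powr q) \<partial>lebesgue)"
  unfolding nn_integral_halfline
proof (rule nn_integral_cong)
  fix t
  have "g t = 0" if "t \<le> 0" using admissible_eq_0[OF g] a that by simp
  then show "ennreal (norm (g t) powr q) * indicator {0<..} t = ennreal (norm (g t) powr q)"
    by (auto simp: indicator_def)
qed

text \<open>
  \<open>weak_type\<close> needs strict upper bounds for \<open>M + B\<close> and for the \<open>L\<^sup>1\<close> norm, as both may vanish;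
  these bounds are then let go to their limits.
\<close>

lemma weak_type_norm:
  assumes g: "admissible a g" and fg: "\<And>t. 0 < t \<Longrightarrow> f t = g t"
  shows "weak_L1_norm (T f) \<le> ennreal (weak_type_const \<sigma> * (M + B)) * Lp_norm 1 f"
proof -
  have dM: "0 \<le> M + B" using M_nonneg B(1) by simp
  have TfTg: "AE t in halfline. T f t = T g t" by (rule T_cong[OF g fg])
  obtain I where I: "(\<integral>\<^sup>+ t. ennreal (norm (g t)) \<partial>lebesgue) = ennreal I" "0 \<le> I"
    using admissible_integral_finite[OF g] by (cases "\<integral>\<^sup>+ t. ennreal (norm (g t)) \<partial>lebesgue") auto
  have norm1: "Lp_norm 1 f = ennreal I"
  proof -
    have "Lp_norm 1 f = Lp_norm 1 g" by (rule Lp_norm_cong[OF fg])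
    then show ?thesis using admissible_Lp_integral[OF g, of 1] I by (simp add: Lp_norm_def Let_def)
  qed
  have "ennreal c * emeasure halfline {t \<in> {0<..}. norm (T f t) > c} \<le> ennreal (weak_type_const \<sigma> * (M + B) * I)"
    if c: "0 < c" for c
  proof (rule le_ennreal_limit)
    fix e :: real assume e: "0 < e"
    have "emeasure halfline {t \<in> {0<..}. norm (T f t) > c} = emeasure lebesgue (super_level (T f) c)"
      unfolding super_level_def by (rule emeasure_restrict_space) auto
    also have "\<dots> \<le> emeasure lebesgue (super_level (T g) c)"
    proof (rule emeasure_mono_AE)
      show "AE t in lebesgue. t \<in> super_level (T f) c \<longrightarrow> t \<in> super_level (T g) c"
        using TfTg unfolding AE_halfline by eventually_elim (auto simp: super_level_def)
    qed (intro super_level_sets T_strongly_measurable g)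
    also have "\<dots> \<le> ennreal (100 * (M + B + e) * (I + e) / (\<sigma> * c))"
      by (rule weak_type[OF g _ _ _ c]) (use dM M_nonneg B(1) e I in \<open>auto intro: ennreal_leI\<close>)
    finally have "ennreal c * emeasure halfline {t \<in> {0<..}. norm (T f t) > c}
        \<le> ennreal c * ennreal (100 * (M + B + e) * (I + e) / (\<sigma> * c))"
      by (rule mult_left_mono) simp
    also have "\<dots> = ennreal (100 / \<sigma> * (M + B + e) * (I + e))"
      using c sigma by (subst ennreal_mult'[symmetric]) auto
    also have "\<dots> \<le> ennreal (weak_type_const \<sigma> * (M + B + e) * (I + e))"
      using weak_type_const_ge[OF sigma(1)] dM e I by (intro ennreal_leI mult_right_mono) auto
    finally show "ennreal c * emeasure halfline {t \<in> {0<..}. norm (T f t) > c}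
        \<le> ennreal (weak_type_const \<sigma> * (M + B + e) * (I + e))" .
  next
    have "((\<lambda>e. weak_type_const \<sigma> * (M + B + e) * (I + e)) \<longlongrightarrow> weak_type_const \<sigma> * (M + B + 0) * (I + 0)) (at_right 0)"
      by (intro tendsto_intros)
    then show "((\<lambda>e. weak_type_const \<sigma> * (M + B + e) * (I + e)) \<longlongrightarrow> weak_type_const \<sigma> * (M + B) * I) (at_right 0)" by simp
  qed
  then have "weak_L1_norm (T f) \<le> ennreal (weak_type_const \<sigma> * (M + B) * I)"
    unfolding weak_L1_norm_def by (intro SUP_least) auto
  then show ?thesis unfolding norm1 using I(2) by (simp add: ennreal_mult'')
qed

text \<open>
  As for the weak type, \<open>strong_type\<close> is used with \<open>D = M + B + e\<close>, and \<open>e\<close> tends to zero.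
\<close>

lemma strong_type_norm:
  assumes g: "admissible a g" and fg: "\<And>t. 0 < t \<Longrightarrow> f t = g t" and p: "1 < p"
  shows "Lp_norm (ennreal p) (T f) \<le> ennreal (strong_type_const p \<sigma> * (M + B)) * Lp_norm (ennreal p) f"
proof -
  have dM: "0 \<le> M + B" using M_nonneg B(1) by simp
  have TfTg: "AE t in halfline. T f t = T g t" by (rule T_cong[OF g fg])
  let ?I = "\<integral>\<^sup>+ t. ennreal (norm (g t) powr p) \<partial>lebesgue"
  let ?C = "strong_type_const p \<sigma>"
  have C: "0 \<le> ?C" by (simp add: strong_type_const_def)
  have "?I < \<infinity>"
  proof -
    obtain c where c: "0 < c" "\<And>t. norm (g t) \<le> c" using admissible_bounded[OF g] by blast
    have "?I \<le> (\<integral>\<^sup>+ t. ennreal (c powr (p - 1)) * ennreal (norm (g t)) \<partial>lebesgue)"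
    proof (rule nn_integral_mono)
      fix t
      have "norm (g t) powr p = norm (g t) powr (p - 1) * norm (g t)"
        using powr_add[of "norm (g t)" "p - 1" 1] by simp
      also have "\<dots> \<le> c powr (p - 1) * norm (g t)" using c p by (intro mult_right_mono powr_mono2) auto
      finally show "ennreal (norm (g t) powr p) \<le> ennreal (c powr (p - 1)) * ennreal (norm (g t))"
        by (simp add: ennreal_mult[symmetric] ennreal_leI)
    qed
    also have "\<dots> = ennreal (c powr (p - 1)) * (\<integral>\<^sup>+ t. ennreal (norm (g t)) \<partial>lebesgue)"
      by (rule nn_integral_cmult[OF admissible_ennreal_measurable[OF g]])
    also have "\<dots> < \<infinity>" using admissible_integral_finite[OF g] by (simp add: ennreal_mult_less_top)
    finally show ?thesis .
  qed
  then obtain I where I: "?I = ennreal I" "0 \<le> I" by (cases ?I) auto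
  define N where "N = I powr (1 / p)"
  have N: "0 \<le> N" "N powr p = I" using I(2) p by (simp_all add: N_def powr_powr)
  have norm_f: "Lp_norm (ennreal p) f = ennreal N"
  proof -
    have "Lp_norm (ennreal p) f = Lp_norm (ennreal p) g" by (rule Lp_norm_cong[OF fg])
    then show ?thesis using p admissible_Lp_integral[OF g, of p] I
      by (simp add: Lp_norm_def Let_def N_def)
  qed
  have "Lp_norm (ennreal p) (T f) \<le> ennreal (?C * (M + B) * N)"
  proof (rule le_ennreal_limit)
    fix e :: real assume e: "0 < e"
    have D: "0 < M + B + e" "B \<le> M + B + e" "M \<le> M + B + e" using dM M_nonneg B(1) e by auto
    have "(\<integral>\<^sup>+ t. ennreal (norm (T f t) powr p) \<partial>halfline) = (\<integral>\<^sup>+ t. ennreal (norm (T g t) powr p) \<partial>halfline)"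
      by (rule nn_integral_cong_AE) (use TfTg in eventually_elim, simp)
    also have "\<dots> \<le> ennreal ((?C * (M + B + e)) powr p) * ?I" by (rule strong_type[OF g D p])
    also have "\<dots> = ennreal ((?C * (M + B + e) * N) powr p)"
    proof -
      have "(?C * (M + B + e) * N) powr p = (?C * (M + B + e)) powr p * I"
        using C D N by (subst powr_mult) auto
      then show ?thesis unfolding I(1) using I(2) by (simp only: ennreal_mult powr_ge_zero)
    qed
    finally show "Lp_norm (ennreal p) (T f) \<le> ennreal (?C * (M + B + e) * N)"
      using p C D N by (intro Lp_norm_le_iff[THEN iffD2]) auto
  next
    have "((\<lambda>e. ?C * (M + B + e) * N) \<longlongrightarrow> ?C * (M + B + 0) * N) (at_right 0)"
      by (intro tendsto_intros)
    then show "((\<lambda>e. ?C * (M + B + e) * N) \<longlongrightarrow> ?C * (M + B) * N) (at_right 0)" by simp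
  qed
  then show ?thesis unfolding norm_f using N(1) by (simp add: ennreal_mult'')
qed

end

text \<open>
  The base point is the least element of a compact subset of the half-line off which the function
  vanishes. To the left of it the function is replaced by zero, since the values of a test function
  at nonpositive arguments are arbitrary. Uniform continuity makes the dyadic step
  functions sampled at left ends converge uniformly.
\<close>

lemma test_function_admissible:
  assumes f: "f \<in> test_functions"
  obtains a g where "0 < a" "admissible a g" "\<And>t. 0 < t \<Longrightarrow> f t = g t"
proof -
  obtain D :: "nat \<Rightarrow> real \<Rightarrow> 'a" and S where D: "\<And>t. 0 < t \<Longrightarrow> D 0 t = f t"
      "\<And>n t. 0 < t \<Longrightarrow> (D n has_vector_derivative D (Suc n) t) (at t)"
    and S: "compact S" "S \<subseteq> {0<..}" "\<And>t. 0 < t \<Longrightarrow> t \<notin> S \<Longrightarrow> f t = 0"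
    using f unfolding test_functions_def by blast
  obtain a where a: "0 < a" "\<And>t. 0 < t \<Longrightarrow> t < a \<Longrightarrow> f t = 0"
  proof (cases "S = {}")
    case True
    then show thesis using S(3) by (intro that[of 1]) auto
  next
    case False
    obtain x where x: "x \<in> S" "\<And>y. y \<in> S \<Longrightarrow> x \<le> y" using compact_attains_inf[OF S(1) False] by blast
    show thesis
    proof (rule that[of x])
      show "0 < x" using x(1) S(2) by auto
      show "f t = 0" if "0 < t" "t < x" for t using S(3)[OF that(1)] x(2)[of t] that(2) by fastforce
    qed
  qed
  obtain b where "\<And>t. t \<in> S \<Longrightarrow> \<bar>t\<bar> \<le> b" using compact_imp_bounded[OF S(1)] unfolding bounded_real by blast
  then have b: "f t = 0" if "0 < t" "b < t" for t using S(3)[OF that(1)] that by fastforce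
  define g where "g t = (if t < a then 0 else f t)" for t
  have "continuous_on {a..b + 2} (D 0)"
    using a(1) by (intro continuous_at_imp_continuous_on ballI has_vector_derivative_continuous[OF D(2)]) auto
  then have "uniformly_continuous_on {a..b + 2} (D 0)"
    by (intro compact_uniformly_continuous) auto
  then have uc: "\<exists>d>0. \<forall>s\<in>{a..b+2}. \<forall>t\<in>{a..b+2}. dist t s < d \<longrightarrow> dist (D 0 t) (D 0 s) < e" if "0 < e" for e
    using that unfolding uniformly_continuous_on_def by blast
  have "admissible a g" unfolding admissible_def
  proof (intro exI[of _ "b + 1"] allI impI)
    fix e :: real assume e: "0 < e"
    obtain d where d: "0 < d" "\<And>s t. s \<in> {a..b+2} \<Longrightarrow> t \<in> {a..b+2} \<Longrightarrow> dist t s < d \<Longrightarrow> dist (D 0 t) (D 0 s) < e"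
      using uc[OF e] by blast
    have "0 < min d 1" using d(1) by simp
    then obtain n where n: "(1 / 2) ^ n < min d 1" using real_arch_pow_inv[of "min d 1" "1 / 2"] by auto
    define k where "k = - int n"
    have k: "2 powi k < d" "2 powi k < (1::real)"
      using n by (simp_all add: k_def power_int_minus power_one_over inverse_eq_divide)
    define h where "h t = (if t < a then 0 else f (left a (cell_at a k t)))" for t
    have near: "left a (cell_at a k t) \<le> t" "t < left a (cell_at a k t) + 2 powi k" if "a \<le> t" for t
      using cell_at_mem[OF that, of k] by (auto simp: cell_def side_def)
    have "dyadic_step a k (b + 1) h" unfolding dyadic_step_def
    proof (intro conjI allI ballI impI)
      fix m t assume t: "t \<in> cell a (k, m)"
      have "cell_at a k t = (k, m)" using cell_at_eqI[OF t] by simp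
      moreover have "cell_at a k (left a (k, m)) = (k, m)" using cell_at_eqI[OF left_in_cell[of a "(k, m)"]] by simp
      ultimately show "h t = h (left a (k, m))"
        using cell_ge[OF t] left_ge[of a "(k, m)"] by (simp add: h_def)
    next
      fix t assume t: "t < a \<or> b + 1 \<le> t"
      show "h t = 0"
      proof (cases "t < a")
        case False
        then have "b < left a (cell_at a k t)" using near[of t] k(2) t by linarith
        moreover have "0 < left a (cell_at a k t)" using a(1) left_ge[of a "cell_at a k t"] by linarith
        ultimately show ?thesis using b False by (simp add: h_def)
      qed (simp add: h_def)
    qed
    moreover have "norm (g t - h t) \<le> e" for t
    proof (cases "t < a")
      case False
      define s where "s = left a (cell_at a k t)"
      have s: "a \<le> s" "s \<le> t" "t < s + 2 powi k" using near[of t] False left_ge[of a "cell_at a k t"] by (auto simp: s_def)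
      have gh: "g t - h t = f t - f s" using False by (simp add: g_def h_def s_def)
      show ?thesis
      proof (cases "t \<le> b + 2")
        case True
        have "dist (D 0 t) (D 0 s) < e" using s True False k(1) by (intro d(2)) (auto simp: dist_real_def)
        then show ?thesis using gh D(1)[of t] D(1)[of s] s a(1) by (simp add: dist_norm)
      next
        case False
        then have "f t = 0" "f s = 0" using b[of t] b[of s] s k(2) a(1) by auto
        then show ?thesis using gh e by simp
      qed
    qed (use e in \<open>simp add: g_def h_def\<close>)
    ultimately show "\<exists>k h. dyadic_step a k (b + 1) h \<and> (\<forall>t. norm (g t - h t) \<le> e)" by blast
  qed
  moreover have "f t = g t" if "0 < t" for t using a(2)[OF that] by (simp add: g_def)
  ultimately show thesis using that a(1) by blast
qed

theorem theorem2p1: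
  fixes T :: "(real \<Rightarrow> 'x::banach) \<Rightarrow> (real \<Rightarrow> 'y::banach)"
    and K :: "real \<Rightarrow> real \<Rightarrow> 'x \<Rightarrow>\<^sub>L 'y"
    and r :: ennreal and B M \<sigma> :: real
  assumes "reflexive_space TYPE('x)" and "reflexive_space TYPE('y)"
    and "1 < r"
    and "0 < \<sigma>" and "\<sigma> \<le> 1"
    and "Lp_linear_operator r T"
    and "0 \<le> B" and "Lp_opnorm r T = ennreal B"
    and "volterra_kernel M \<sigma> K"
    and "has_volterra_kernel r T K"
  shows "(\<forall>f\<in>test_functions.
            weak_L1_norm (T f) \<le> ennreal (weak_type_const \<sigma> * (M + B)) * Lp_norm 1 f) \<and>
         (\<forall>p::real. 1 < p \<longrightarrow> (\<forall>f\<in>test_functions.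
            Lp_norm (ennreal p) (T f)
              \<le> ennreal (strong_type_const p \<sigma> * (M + B)) * Lp_norm (ennreal p) f))"
proof -
  have "weak_L1_norm (T f) \<le> ennreal (weak_type_const \<sigma> * (M + B)) * Lp_norm 1 f \<and>
      (\<forall>p. 1 < p \<longrightarrow> Lp_norm (ennreal p) (T f)
         \<le> ennreal (strong_type_const p \<sigma> * (M + B)) * Lp_norm (ennreal p) f)"
    if f: "f \<in> test_functions" for f
  proof -
    obtain a g where a: "0 < a" and g: "admissible a g" and fg: "\<And>t. 0 < t \<Longrightarrow> f t = g t"
      using test_function_admissible[OF f] by blast
    interpret volterra_operator T K r B M \<sigma> a
      by unfold_locales (use assms a in auto)
    show ?thesis
      by (intro conjI allI impI) (rule weak_type_norm[OF g fg] strong_type_norm[OF g fg]; assumption)+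
  qed
  then show ?thesis by blast
qed

end
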